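(* For real numbers $X,R_1,R_2\ge1$ with $R_1<R_2$, let $\mathcal{N}_{\mathrm{I}}(X,R_1,R_2)$ (resp. $\mathcal{N}_{\mathrm{II}}(X,R_1,R_2)$) be the number of isomorphism classes of pure cubic fields of Type I (resp. Type II) with $|\Delta(K)|<X$ and ratio $r_K\in(R_1,R_2)$, and let $\mathcal{N}(X,R_1,R_2)=\mathcal{N}_{\mathrm{I}}(X,R_1,R_2)+\mathcal{N}_{\mathrm{II}}(X,R_1,R_2)$. Then for fixed $R_1,R_2$, as $X\to\infty$, \begin{align*} \mathcal{N}_{\mathrm{I}}(X,R_1,R_2)&=\frac{2C}{15\sqrt3}\sqrt X\log\frac{R_2}{R_1}+o(\sqrt X),\\ \mathcal{N}_{\mathrm{II}}(X,R_1,R_2)&=\frac{C}{10\sqrt3}\sqrt X\log\frac{R_2}{R_1}+o(\sqrt X),\\ \mathcal{N}(X,R_1,R_2)&=\frac{7C}{30\sqrt3}\sqrt X\log\frac{R_2}{R_1}+o(\sqrt X), \end{align*} where $C=\prod_p\left(1-\frac{3}{p^2}+\frac{2}{p^3}\right)$, the product over all primes.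
   Context: A pure cubic field is $K=\mathbf{Q}(m^{1/3})$, $m$ a positive non-cube integer; it can be written uniquely as $\mathbf{Q}((ab^2)^{1/3})$ with $a,b$ coprime squarefree positive integers and $a>b$; the ratio of $K$ is $r_K=a/b$. With $m=ab^2$, $K$ is of Type II if $3\nmid m$ and $r_K\equiv\pm1\pmod 9$, and of Type I otherwise. $\Delta(K)$ denotes the discriminant of $K$. *)

theory Defs
  imports
    "HOL-Analysis.Analysis"
    "HOL-Algebra.Algebra"
    "HOL-Algebra.Algebraic_Closure_Type"
    "HOL-Computational_Algebra.Nth_Powers"
    "HOL-Computational_Algebra.Squarefree"
    "HOL-Library.Landau_Symbols"
    "Jordan_Normal_Form.Determinant"
begin

section \<open>Number fields inside the complex numbers\<close>

text \<open>
  Every number field embeds into the complex numbers, so number fields are represented by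
  subfields of \<open>CC\<close>; distinct subfields may be isomorphic (conjugate fields).
\<close>

abbreviation CC :: "complex ring" where
  "CC \<equiv> ring_of_type_algebra"

definition field_isomorphic :: "complex set \<Rightarrow> complex set \<Rightarrow> bool" where
  "field_isomorphic K L \<longleftrightarrow> (CC\<lparr>carrier := K\<rparr>) \<simeq> (CC\<lparr>carrier := L\<rparr>)"

interpretation rat_complex: vector_space "\<lambda>(q::rat) (x::complex). of_rat q * x"
  by unfold_locales (simp_all add: algebra_simps of_rat_add of_rat_mult)

interpretation int_complex: Modules.module "\<lambda>(n::int) (x::complex). of_int n * x"
  by unfold_locales (simp_all add: algebra_simps)

text \<open>
  The trace of the \<open>\<rat>\<close>-linear map \<open>y \<mapsto> x * y\<close> on \<open>K\<close>,
  read off as the sum of the diagonal matrix entries in some \<open>\<rat>\<close>-basis \<open>B\<close> of \<open>K\<close>.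
\<close>

definition field_trace :: "complex set \<Rightarrow> complex \<Rightarrow> rat" where
  "field_trace K x =
     (let B = (SOME B. rat_complex.independent B \<and> rat_complex.span B = K)
      in \<Sum>b\<in>B. rat_complex.representation B (x * b) b)"

definition ring_of_integers :: "complex set \<Rightarrow> complex set" where
  "ring_of_integers K = {x \<in> K. algebraic_int x}"

definition integral_basis :: "complex set \<Rightarrow> complex list \<Rightarrow> bool" where
  "integral_basis K bs \<longleftrightarrow>
     distinct bs \<and> int_complex.independent (set bs) \<and>
     int_complex.span (set bs) = ring_of_integers K"

text \<open>The discriminant is an integer, but is kept here in the rationals, where the trace lives.\<close>

definition discriminant :: "complex set \<Rightarrow> rat" where
  "discriminant K =
     (let bs = (SOME bs. integral_basis K bs); n = length bs
      in Determinant.det (Matrix.mat n n (\<lambda>(i, j). field_trace K (bs ! i * bs ! j))))"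


section \<open>Pure cubic fields\<close>

definition cbrt_field :: "nat \<Rightarrow> complex set" where
  "cbrt_field m = generate_field CC {complex_of_real (root 3 (real m))}"

definition pure_cubic_field :: "complex set \<Rightarrow> bool" where
  "pure_cubic_field K \<longleftrightarrow> subfield K CC \<and>
     (\<exists>m>0. \<not> is_nth_power 3 m \<and> field_isomorphic K (cbrt_field m))"

definition cubic_params :: "complex set \<Rightarrow> nat \<Rightarrow> nat \<Rightarrow> bool" where
  "cubic_params K a b \<longleftrightarrow>
     0 < b \<and> b < a \<and> coprime a b \<and> squarefree a \<and> squarefree b \<and>
     field_isomorphic K (cbrt_field (a * b ^ 2))"

definition ratio :: "complex set \<Rightarrow> rat" where
  "ratio K = (THE r. \<exists>a b. cubic_params K a b \<and> r = of_nat a / of_nat b)"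

text \<open>
  Congruence of rational numbers modulo \<open>n\<close>: the difference is \<open>n\<close> times a fraction whose
  denominator is coprime to \<open>n\<close>.
\<close>

definition rat_cong :: "rat \<Rightarrow> rat \<Rightarrow> int \<Rightarrow> bool" where
  "rat_cong r s n \<longleftrightarrow>
     (\<exists>u v. v \<noteq> 0 \<and> coprime v n \<and> r - s = of_int n * (of_int u / of_int v))"

definition type_II :: "complex set \<Rightarrow> bool" where
  "type_II K \<longleftrightarrow>
     (\<exists>a b. cubic_params K a b \<and> \<not> 3 dvd a * b ^ 2) \<and>
     (rat_cong (ratio K) 1 9 \<or> rat_cong (ratio K) (- 1) 9)"

definition type_I :: "complex set \<Rightarrow> bool" where
  "type_I K \<longleftrightarrow> \<not> type_II K"

definition pure_cubic_iso :: "(complex set \<times> complex set) set" where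
  "pure_cubic_iso =
     {(K, L). pure_cubic_field K \<and> pure_cubic_field L \<and> field_isomorphic K L}"

definition fields_in_range :: "real \<Rightarrow> real \<Rightarrow> real \<Rightarrow> complex set set" where
  "fields_in_range x R1 R2 =
     {K. pure_cubic_field K \<and> abs (real_of_rat (discriminant K)) < x \<and>
         R1 < real_of_rat (ratio K) \<and> real_of_rat (ratio K) < R2}"

definition N_I :: "real \<Rightarrow> real \<Rightarrow> real \<Rightarrow> nat" where
  "N_I x R1 R2 = card ({K \<in> fields_in_range x R1 R2. type_I K} // pure_cubic_iso)"

definition N_II :: "real \<Rightarrow> real \<Rightarrow> real \<Rightarrow> nat" where
  "N_II x R1 R2 = card ({K \<in> fields_in_range x R1 R2. type_II K} // pure_cubic_iso)"

definition N_total :: "real \<Rightarrow> real \<Rightarrow> real \<Rightarrow> nat" where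
  "N_total x R1 R2 = N_I x R1 R2 + N_II x R1 R2"

definition C_const :: real where
  "C_const = prodinf (\<lambda>p::nat.
     if normalization_semidom_class.prime p then 1 - 3 / real p ^ 2 + 2 / real p ^ 3 else 1)"

end

theory Submission
  imports Defs "HOL-Number_Theory.Cong" "HOL-Real_Asymp.Real_Asymp"
begin

text \<open>
  Let \<open>a, b\<close> be coprime and squarefree, \<open>\<theta>\<^sup>3 = a b\<^sup>2\<close> and \<open>\<phi> = \<theta>\<^sup>2 / b\<close>, so that \<open>\<phi>\<^sup>3 = a\<^sup>2 b\<close>. The field
  \<open>\<rat>(\<theta>)\<close> has basis \<open>1, \<theta>, \<phi>\<close>, and everything algebraic is read off the norm form
  \<open>x\<^sup>3 + a b\<^sup>2 y\<^sup>3 + a\<^sup>2 b z\<^sup>3 - 3 a b x y z\<close>. At a prime dividing \<open>a b\<close> its monomials have distinct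
  valuations modulo 3, so such a prime never divides the denominator of an algebraic integer; for
  the other primes only 3 can occur, and it does exactly for Type II. Hence the
  discriminant is \<open>-27 (a b)\<^sup>2\<close> for Type I and \<open>-3 (a b)\<^sup>2\<close> for Type II. An element of \<open>\<rat>(\<theta>)\<close> with
  rational cube is a rational multiple of \<open>1\<close>, \<open>\<theta>\<close> or \<open>\<phi>\<close>, so isomorphism classes correspond to the
  pairs \<open>(a, b)\<close> with \<open>a > b\<close>.

  It remains to count such pairs with \<open>R1 < a / b < R2\<close> and \<open>a b < T\<^sup>2\<close>. A residue class modulo \<open>q\<close>
  contains \<open>T\<^sup>2 ln (R2 / R1) / (2 q\<^sup>2) + O(T)\<close> of the lattice points (a Riemann sum over \<open>b\<close>). Coprimality and
  squarefreeness are the conjunction over all primes \<open>p\<close> of a condition modulo \<open>p\<^sup>2\<close> of density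
  \<open>1 - 3/p\<^sup>2 + 2/p\<^sup>3\<close>. The conditions at \<open>p \<le> z\<close> are independent by the Chinese remainder
  theorem, and those at \<open>p > z\<close> exclude only \<open>O(T\<^sup>2 / z)\<close> pairs. The type is a condition modulo 9.
\<close>

section \<open>The norm form\<close>

text \<open>The discriminant and the trace in it are defined through bases picked by
  \<open>SOME\<close>, and \<open>K\<close> may be any subfield of the complex numbers in its
  isomorphism class. Basis independence is therefore proved for the trace and for the Gram
  determinant, so that one explicit basis can be used. And \<theta> is kept as an arbitrary complex
  cube root of \<open>a * b ^ 2\<close>: an isomorphic copy is generated by such a root as well, so
  the computation applies to every copy without transporting integers, traces or discriminants.

  The difficulty with the integers is to see, without Galois conjugates, that an algebraic integer
  has integral norm. Multiplicativity of the norm form, together with a common denominator for all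
  powers of the element, replaces the conjugates.

  The two types are counted at different scales: \<open>T ^ 2\<close> is
  \<open>sqrt (x / 27)\<close> for Type I and \<open>sqrt (x / 3)\<close> for Type II. At the prime
  3 the admissible pairs have density 20/27, of which 4/27 belong to Type II and 16/27 to Type
  I.\<close>

abbreviation nprime :: "'a::normalization_semidom \<Rightarrow> bool" where
  "nprime \<equiv> normalization_semidom_class.prime"

text \<open>The norm of \<open>x + y \<theta> + z \<theta>\<^sup>2 / b\<close>, where \<open>\<theta>\<^sup>3 = a b\<^sup>2\<close>.\<close>

definition norm_form :: "'a::comm_ring_1 \<Rightarrow> 'a \<Rightarrow> 'a \<Rightarrow> 'a \<Rightarrow> 'a \<Rightarrow> 'a" where
  "norm_form a b x y z = x^3 + a * b^2 * y^3 + a^2 * b * z^3 - 3 * a * b * x * y * z"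

text \<open>Exchanging \<open>a\<close> and \<open>b\<close> exchanges \<theta> and \<phi>, so
  primes dividing \<open>b\<close> are covered by the argument for primes dividing
  \<open>a\<close>.\<close>

lemma norm_form_swap: "norm_form a b x y z = norm_form b a x z y"
  by (simp add: norm_form_def algebra_simps)

lemma norm_form_scale: "norm_form a b (k * x) (k * y) (k * z) = k^3 * norm_form a b x y z"
  by (simp add: norm_form_def algebra_simps power3_eq_cube)

text \<open>Since \<open>p\<close> divides \<open>a\<close> exactly once and does not divide
  \<open>b\<close>, the coordinates can be peeled off one at a time, modulo \<open>p\<close>,
  \<open>p^2\<close> and \<open>p^3\<close>. At each stage the mixed term has already gained enough
  factors \<open>p\<close> from the coordinates treated before.\<close>

lemma norm_form_ramified_aux:
  fixes a b W Y Z p :: int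
  assumes p: "nprime p" "p dvd a" and cop: "coprime a b" and sq: "squarefree a"
    and N: "p^3 dvd norm_form a b W Y Z"
  shows "p dvd W \<and> p dvd Y \<and> p dvd Z"
proof -
  obtain a' where a': "a = p * a'" using p by blast
  have pb: "\<not> p dvd b" using p cop
    by (meson coprime_common_divisor not_prime_unit)
  have pa': "\<not> p dvd a'"
  proof
    assume "p dvd a'"
    hence "p^2 dvd a" using a' by (auto simp: power2_eq_square)
    thus False using sq p by (meson not_prime_unit squarefreeD)
  qed
  have "p dvd norm_form a b W Y Z" using N by (meson dvd_power dvd_trans zero_less_numeral)
  moreover have "norm_form a b W Y Z = W^3 + p * (a' * b^2 * Y^3 + p * a'^2 * b * Z^3 - 3 * a' * b * W * Y * Z)"
    by (simp add: norm_form_def a' algebra_simps power2_eq_square)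
  ultimately have "p dvd W^3" by (metis dvd_add_left_iff dvd_triv_left)
  hence W: "p dvd W" using p prime_dvd_power by blast
  then obtain W' where W': "W = p * W'" by blast
  have "p^2 dvd norm_form a b W Y Z" using N by (meson dvd_trans le_imp_power_dvd numeral_le_iff semiring_norm)
  moreover have "norm_form a b W Y Z = p * (a' * b^2 * Y^3) + p^2 * (p * W'^3 + a'^2 * b * Z^3 - 3 * a' * b * W' * Y * Z)"
    by (simp add: norm_form_def a' W' algebra_simps power2_eq_square power3_eq_cube)
  ultimately have "p^2 dvd p * (a' * b^2 * Y^3)" by (metis dvd_add_left_iff dvd_triv_left)
  hence "p dvd a' * b^2 * Y^3" using p by (auto simp: power2_eq_square)
  hence Y: "p dvd Y" using p pa' pb by (metis prime_dvd_mult_iff prime_dvd_power)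
  then obtain Y' where Y': "Y = p * Y'" by blast
  have "norm_form a b W Y Z = p^2 * (a'^2 * b * Z^3) + p^3 * (W'^3 + p * a' * b^2 * Y'^3 - 3 * a' * b * W' * Y' * Z)"
    by (simp add: norm_form_def a' W' Y' algebra_simps power2_eq_square power3_eq_cube)
  with N have "p^3 dvd p^2 * (a'^2 * b * Z^3)" by (metis dvd_add_left_iff dvd_triv_left)
  moreover have "p^3 = p^2 * p" by (simp add: power3_eq_cube power2_eq_square)
  ultimately have "p dvd a'^2 * b * Z^3" using p by auto
  hence "p dvd Z" using p pa' pb by (metis prime_dvd_mult_iff prime_dvd_power)
  with W Y show ?thesis by blast
qed

lemma norm_form_ramified:
  fixes a b W Y Z p :: int
  assumes p: "nprime p" "p dvd a * b" and "coprime a b" "squarefree a" "squarefree b"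
    and N: "p^3 dvd norm_form a b W Y Z"
  shows "p dvd W \<and> p dvd Y \<and> p dvd Z"
proof -
  have "p dvd a \<or> p dvd b" using p by (simp add: prime_dvd_mult_iff)
  thus ?thesis
    using norm_form_ramified_aux[of p a b W Y Z] norm_form_ramified_aux[of p b a W Z Y]
      norm_form_swap[of a b W Y Z] assms by (auto simp: coprime_commute)
qed

text \<open>Infinite descent: a prime dividing \<open>a * b\<close> divides all three coordinates
  and can be cancelled. This yields the linear independence of 1, \<theta>, \<phi> over the
  rationals without an irreducibility argument.\<close>

lemma norm_form_eq_0_int:
  fixes a b W Y Z :: int
  assumes ab: "coprime a b" "squarefree a" "squarefree b" "a * b > 1"
    and N: "norm_form a b W Y Z = 0"
  shows "W = 0 \<and> Y = 0 \<and> Z = 0"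
  using N
proof (induction "nat (\<bar>W\<bar> + \<bar>Y\<bar> + \<bar>Z\<bar>)" arbitrary: W Y Z rule: less_induct)
  case less
  obtain p where p: "nprime p" "p dvd a * b" using prime_factor_int[of "a * b"] ab(4) by auto
  hence "p dvd W \<and> p dvd Y \<and> p dvd Z" using norm_form_ramified[of p a b W Y Z] ab less.prems by simp
  then obtain W' Y' Z' where e: "W = p * W'" "Y = p * Y'" "Z = p * Z'" by (auto simp: dvd_def)
  have p1: "p > 1" using p(1) by (simp add: prime_gt_1_int)
  have N': "norm_form a b W' Y' Z' = 0" using less.prems norm_form_scale[of a b p W' Y' Z'] e p1 by simp
  show ?case
  proof (rule ccontr)
    assume ne: "\<not> (W = 0 \<and> Y = 0 \<and> Z = 0)"
    let ?s = "\<bar>W'\<bar> + \<bar>Y'\<bar> + \<bar>Z'\<bar>"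
    have eq: "\<bar>W\<bar> + \<bar>Y\<bar> + \<bar>Z\<bar> = p * ?s" using p1 by (simp add: e abs_mult algebra_simps)
    have s: "?s > 0" using ne e by auto
    have "?s < p * ?s" using p1 s by simp
    hence "nat ?s < nat (\<bar>W\<bar> + \<bar>Y\<bar> + \<bar>Z\<bar>)" unfolding eq using s by linarith
    from less.hyps[OF this N'] s show False by simp
  qed
qed

text \<open>\<open>D\<close> is the least positive common denominator; a prime dividing all four
  integers could be cancelled. Primitivity is stated prime by prime because
  \<open>norm_form_ramified\<close> produces common divisors in that form.\<close>

lemma rat_triple_common_denominator:
  fixes x y z :: rat
  obtains W Y Z D :: int where "D > 0" "x = of_int W / of_int D" "y = of_int Y / of_int D"
    "z = of_int Z / of_int D" "\<And>p. nprime p \<Longrightarrow> p dvd W \<Longrightarrow> p dvd Y \<Longrightarrow> p dvd Z \<Longrightarrow> \<not> p dvd D"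
proof -
  define P where "P = (\<lambda>D::nat. D > 0 \<and> of_nat D * x \<in> \<int> \<and> of_nat D * y \<in> \<int> \<and> of_nat D * z \<in> \<int>)"
  have ex: "\<exists>D::nat. D > 0 \<and> of_nat D * r \<in> \<int>" for r :: rat
  proof -
    obtain m n where q: "quotient_of r = (m, n)" by fastforce
    have n: "n > 0" and r: "r = of_int m / of_int n"
      using quotient_of_denom_pos[OF q] quotient_of_div[OF q] by auto
    have "of_nat (nat n) * r = of_int m" using n r by simp
    thus ?thesis using n by (intro exI[of _ "nat n"]) auto
  qed
  obtain d1 d2 d3 where d: "d1 > 0" "of_nat d1 * x \<in> \<int>" "d2 > 0" "of_nat d2 * y \<in> \<int>" "d3 > 0" "of_nat d3 * z \<in> \<int>"
    using ex[of x] ex[of y] ex[of z] by blast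
  have "of_nat (d1*d2*d3) * x = of_nat (d2*d3) * (of_nat d1 * x)"
    "of_nat (d1*d2*d3) * y = of_nat (d1*d3) * (of_nat d2 * y)"
    "of_nat (d1*d2*d3) * z = of_nat (d1*d2) * (of_nat d3 * z)" by simp_all
  with d have "P (d1*d2*d3)" unfolding P_def
    by (metis Ints_mult Ints_of_nat nat_0_less_mult_iff)
  hence PL: "P (Least P)" by (rule LeastI)
  define D where "D = Least P"
  have D: "D > 0" "of_nat D * x \<in> \<int>" "of_nat D * y \<in> \<int>" "of_nat D * z \<in> \<int>"
    using PL unfolding D_def P_def by auto
  then obtain W Y Z where XYZ: "of_nat D * x = of_int W" "of_nat D * y = of_int Y" "of_nat D * z = of_int Z"
    by (auto elim!: Ints_cases)
  show ?thesis
  proof (rule that[of "int D" W Y Z])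
    show "int D > 0" "x = of_int W / of_int (int D)" "y = of_int Y / of_int (int D)" "z = of_int Z / of_int (int D)"
      using D XYZ by (auto simp: field_simps)
    show "\<not> p dvd int D" if p: "nprime p" "p dvd W" "p dvd Y" "p dvd Z" for p
    proof
      assume pD: "p dvd int D"
      obtain D' W' Y' Z' where e: "int D = p * D'" "W = p * W'" "Y = p * Y'" "Z = p * Z'"
        using pD p(2-4) by (auto simp: dvd_def)
      have p1: "p > 1" using p(1) by (simp add: prime_gt_1_int)
      have "p * D' > 0" using e(1) D(1) by linarith
      hence D'0: "D' > 0" using p1 by (simp add: zero_less_mult_iff)
      have rD: "(of_nat D :: rat) = of_int p * of_int D'" using e(1)
        by (metis of_int_mult of_int_of_nat_eq)
      have p0: "(of_int p :: rat) \<noteq> 0" using p1 by simp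
      have c: "of_nat (nat D') * x = of_int W'" "of_nat (nat D') * y = of_int Y'" "of_nat (nat D') * z = of_int Z'"
        using XYZ p0 D'0 unfolding rD e(2-4) by auto
      have "P (nat D')" unfolding P_def c using D'0 by simp
      hence "D \<le> nat D'" unfolding D_def by (rule Least_le)
      moreover have "D' < p * D'" using p1 D'0 by simp
      ultimately show False using e(1) D'0 by linarith
    qed
  qed
qed

lemma norm_form_eq_0_rat:
  fixes a b :: int and x y z :: rat
  assumes ab: "coprime a b" "squarefree a" "squarefree b" "a * b > 1"
    and N: "norm_form (of_int a) (of_int b) x y z = 0"
  shows "x = 0 \<and> y = 0 \<and> z = 0"
proof -
  obtain W Y Z D :: int where D: "D > 0" "x = of_int W / of_int D" "y = of_int Y / of_int D" "z = of_int Z / of_int D"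
    by (rule rat_triple_common_denominator)
  have "of_int D ^3 * norm_form (of_int a) (of_int b) x y z = norm_form (of_int a) (of_int b) (of_int W :: rat) (of_int Y) (of_int Z)"
    using D by (subst norm_form_scale [symmetric]) simp
  also have "\<dots> = of_int (norm_form a b W Y Z)" by (simp add: norm_form_def)
  finally have "norm_form a b W Y Z = 0" using N by simp
  hence "W = 0 \<and> Y = 0 \<and> Z = 0" by (rule norm_form_eq_0_int[OF ab])
  with D show ?thesis by simp
qed

text \<open>The hypotheses express integrality of quantities attached to
  \<open>(W + Y \<theta> + Z \<phi>) / D\<close>: its norm, \<open>3 * a * b\<close> times its
  coordinates, and twice the second coefficient of its characteristic polynomial. Primes dividing
  \<open>a * b\<close> are excluded from \<open>D\<close> by ramification, and 3 is all that the
  coordinates allow besides.\<close>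

lemma norm_form_denominator:
  fixes a b W Y Z D :: int
  assumes ab: "coprime a b" "squarefree a" "squarefree b"
    and D0: "D > 0" and prim: "\<And>p. nprime p \<Longrightarrow> p dvd W \<Longrightarrow> p dvd Y \<Longrightarrow> p dvd Z \<Longrightarrow> \<not> p dvd D"
    and N: "D^3 dvd norm_form a b W Y Z"
    and T: "D dvd 3*a*b*W" "D dvd 3*a*b*Y" "D dvd 3*a*b*Z"
    and S: "D^2 dvd 6 * (W^2 - a*b*Y*Z)"
  shows "D = 1 \<or> (D = 3 \<and> \<not> 3 dvd a * b \<and> 9 dvd a^2 - b^2 \<and> 3 dvd W - a * Y \<and> 3 dvd W - b * Z)"
proof -
  have cop: "coprime D (a * b)"
  proof (rule ccontr)
    assume "\<not> coprime D (a * b)"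
    then obtain p where p: "nprime p" "p dvd D" "p dvd a * b"
      using prime_factor_int[of "gcd D (a * b)"] by (auto simp: coprime_iff_gcd_eq_1)
    have "p^3 dvd norm_form a b W Y Z" using p(2) N by (meson dvd_power_same dvd_trans)
    from norm_form_ramified[OF p(1,3) ab this] prim p show False by blast
  qed
  have T': "D dvd 3 * W" "D dvd 3 * Y" "D dvd 3 * Z"
    using T cop by (metis coprime_dvd_mult_left_iff mult.assoc mult.commute)+
  \<comment> \<open>\<open>D\<close> divides three times each of \<open>W\<close>, \<open>Y\<close>,
    \<open>Z\<close> and \<open>D\<close>, hence three times their gcd, which is 1 by
    primitivity.\<close>
  have "D dvd 3"
  proof -
    have "D dvd gcd (gcd (3*W) (3*Y)) (gcd (3*Z) (3*D))" using T' by simp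
    also have "gcd (gcd (3*W) (3*Y)) (gcd (3*Z) (3*D)) = 3 * gcd (gcd W Y) (gcd Z D)"
      by (simp add: gcd_mult_distrib_int [symmetric])
    also have "gcd (gcd W Y) (gcd Z D) = 1"
    proof (rule ccontr)
      let ?g = "gcd (gcd W Y) (gcd Z D)"
      assume ne: "?g \<noteq> 1"
      have "\<bar>?g\<bar> \<noteq> 1" using ne by simp
      then obtain p where p: "nprime p" "p dvd ?g"
        using prime_factor_int by blast
      have "p dvd W" "p dvd Y" "p dvd Z" "p dvd D" using p(2)
        by (meson dvd_trans gcd_dvd1 gcd_dvd2)+
      with prim p(1) show False by blast
    qed
    finally show ?thesis by simp
  qed
  hence "D \<le> 3" "D \<noteq> 2" using zdvd_imp_le by auto
  hence "D = 1 \<or> D = 3" using D0 by linarith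
  thus ?thesis
  proof
    assume D: "D = 3"
    have "\<not> 3 dvd a * b" using coprime_common_divisor[of 3 "a * b" 3] cop D by auto
    hence n3: "\<not> 3 dvd a" "\<not> 3 dvd b" by (meson dvd_mult dvd_mult2)+
    have "(9::int) dvd 6 * (W^2 - a*b*Y*Z)" using S D by simp
    hence s: "3 dvd W^2 - a*b*Y*Z" by presburger
    have n: "27 dvd norm_form a b W Y Z" using N D by simp
    hence "3 dvd norm_form a b W Y Z" by (rule dvd_trans[rotated]) simp
    \<comment> \<open>Multiplied by \<open>a^2 * b^2\<close> and written in \<open>u\<close> and
      \<open>v\<close>, the norm form depends on \<open>a\<close> and \<open>b\<close> through their
      squares only. The congruences to be proved say that \<open>W\<close>, \<open>u\<close> and
      \<open>v\<close> agree modulo 3.\<close>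
    define u v where "u = a * Y" and "v = b * Z"
    have fermat: "3 dvd t^3 - t" for t :: int
    proof -
      have "t^3 - t = (t-1)*t*(t+1)" by (simp add: algebra_simps power3_eq_cube)
      moreover have "3 dvd t - 1 \<or> 3 dvd t \<or> 3 dvd t + 1" by presburger
      ultimately show ?thesis by auto
    qed
    have sq1: "3 dvd t^2 - 1" if "\<not> 3 dvd t" for t :: int
    proof -
      have "t^2 - 1 = (t-1)*(t+1)" by (simp add: algebra_simps power2_eq_square)
      moreover have "3 dvd t - 1 \<or> 3 dvd t + 1" using that by presburger
      ultimately show ?thesis by auto
    qed
    \<comment> \<open>Modulo 3 the norm form is linear, by Fermat's theorem for the cubes and
      because \<open>a^2\<close> and \<open>b^2\<close> are 1.\<close>
    have "norm_form a b W Y Z - (W + u + v) = (W^3 - W) + a*b^2*(Y^3-Y) + a*Y*(b^2-1) + a^2*b*(Z^3-Z) + b*Z*(a^2-1) - 3*(a*b*W*Y*Z)"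
      by (simp add: norm_form_def u_def v_def algebra_simps)
    moreover have "3 dvd \<dots>" 
      by (rule fermat | rule sq1[OF n3(1)] sq1[OF n3(2)] | rule dvd_triv_left | rule dvd_mult | rule dvd_add | rule dvd_diff)+
    ultimately have "3 dvd W + u + v" using \<open>3 dvd norm_form a b W Y Z\<close> by (metis dvd_diff_right_iff)
    then obtain k where "W + u + v = 3 * k" by blast
    hence k: "W = 3 * k - u - v" by linarith
    \<comment> \<open>Eliminating \<open>W\<close> turns the hypothesis on the second coefficient
      into a statement about a square modulo 3.\<close>
    have "W^2 - a*b*Y*Z = (u - v)^2 + 3 * (3*k^2 - 2*k*u - 2*k * v + u * v)" unfolding k
      by (simp add: u_def v_def algebra_simps power2_eq_square)
    with s have "3 dvd (u - v)^2" by (metis dvd_add_left_iff dvd_triv_left)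
    hence "3 dvd u - v" using prime_dvd_power[of 3 "u-v" 2] by simp
    then obtain t' where t': "u - v = 3 * t'" by blast
    define t where "t = - t'"
    have v: "v = u + 3 * t" using t' by (simp add: t_def)
    define s where "s = k - u - t"
    have W: "W = u + 3 * s" using k v by (simp add: s_def)
    have nu: "\<not> 3 dvd u"
    proof
      assume "3 dvd u"
      hence "3 dvd W" "3 dvd v" using W v by auto
      hence "3 dvd Y" "3 dvd Z" using \<open>3 dvd u\<close> n3 by (auto simp: u_def v_def prime_dvd_mult_iff)
      thus False using prim[of 3] \<open>3 dvd W\<close> D by simp
    qed
    define A B where "A = a^2" and "B = b^2"
    obtain j where j: "A - B = 3 * j"
    proof -
      have "A - B = (a^2 - 1) - (b^2 - 1)" by (simp add: A_def B_def)
      moreover have "3 dvd (a^2 - 1) - (b^2 - 1)" by (intro dvd_diff sq1 n3)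
      ultimately show ?thesis using that by (metis dvdE)
    qed
    \<comment> \<open>After substituting \<open>W = u + 3 s\<close> and \<open>v = u + 3 t\<close>,
      every term except \<open>u^3 * (A - B)^2\<close> is a multiple of 27; one of them uses the
      factor 3 in \<open>A - B = 3 j\<close>. As 3 does not divide \<open>u\<close>, this forces 9
      to divide \<open>A - B\<close>.\<close>
    have "A * B * norm_form a b W Y Z = A*B*W^3 + B^2*u^3 + A^2* v^3 - 3*A*B*W*u * v"
      by (simp add: norm_form_def A_def B_def u_def v_def algebra_simps power2_eq_square power3_eq_cube)
    also have "\<dots> = u^3*(A-B)^2 + 27*(u^2*A*t*j + A*B* s^2*u + A*B* s^3 + A^2*t^2*u + A^2*t^3 - A*B*u* s*t)"
    proof -
      have "u^2*A*t*(A-B) * 9 = 27 * (u^2*A*t*j)" using j by simp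
      thus ?thesis unfolding W v by (simp add: algebra_simps power2_eq_square power3_eq_cube)
    qed
    finally have "27 dvd u^3*(A-B)^2" using n by (metis dvd_add_left_iff dvd_triv_left dvd_mult)
    moreover have "coprime 27 (u^3)" 
    proof -
      have "coprime 3 u" using nu by (simp add: prime_imp_coprime)
      hence "coprime (3^3) (u^3)" by (subst coprime_power_left_iff, subst coprime_power_right_iff) simp
      thus ?thesis by simp
    qed
    ultimately have "27 dvd (A-B)^2" by (metis coprime_dvd_mult_right_iff)
    hence "(27::int) dvd 9 * j^2" using j by (simp add: power_mult_distrib)
    hence "3 dvd j^2" by presburger
    hence "3 dvd j" using prime_dvd_power[of 3 j 2] by simp
    hence "9 dvd A - B" using j by presburger
    moreover have "3 dvd W - u" using W by simp
    moreover have "3 dvd W - v" using W v by simp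
    ultimately show ?thesis using D n3 by (auto simp: A_def B_def u_def v_def prime_dvd_mult_iff)
  qed simp
qed

text \<open>The first expression is \<open>norm_form a b 1 a b\<close>, so its divisibility by 27
  says that \<open>(1 + a \<theta> + b \<phi>) / 3\<close> has integral norm. With
  \<open>a^2 = 1 + 3 s\<close> and \<open>b^2 = 1 + 3 t\<close> it is \<open>9 (s - t)^2\<close>
  modulo 27, and the second hypothesis makes \<open>s - t\<close> a multiple of 3.\<close>

lemma norm_form_type_II:
  fixes a b :: int
  assumes "\<not> 3 dvd a * b" "9 dvd a^2 - b^2"
  shows "27 dvd 1 + a^4 * b^2 + a^2 * b^4 - 3 * a^2 * b^2" and "3 dvd a^2 - 1" and "3 dvd b^2 - 1"
proof -
  have sq1: "3 dvd t^2 - 1" if "\<not> 3 dvd t" for t :: int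
  proof -
    have "t^2 - 1 = (t-1)*(t+1)" by (simp add: algebra_simps power2_eq_square)
    moreover have "3 dvd t - 1 \<or> 3 dvd t + 1" using that by presburger
    ultimately show ?thesis by auto
  qed
  show *: "3 dvd a^2 - 1" "3 dvd b^2 - 1" using assms(1) by (auto intro!: sq1)
  obtain s where s: "a^2 = 1 + 3 * s" 
  proof -
    obtain s where "a^2 - 1 = 3 * s" using *(1) by blast
    thus ?thesis using that[of s] by linarith
  qed
  obtain k where k: "a^2 - b^2 = 9 * k" using assms(2) by blast
  define t where "t = s - 3 * k"
  have t: "b^2 = 1 + 3 * t" using k s by (simp add: t_def)
  have st: "(s - t)^2 = 9 * k^2" by (simp add: t_def power2_eq_square)
  have "1 + a^4 * b^2 + a^2 * b^4 - 3 * a^2 * b^2 = 1 + (a^2)^2 * b^2 + a^2 * (b^2)^2 - 3 * a^2 * b^2" by simp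
  also have "\<dots> = 9 * (s - t)^2 + 27 * (s * t + s * t * (s + t))"
    unfolding s t by (simp add: algebra_simps power2_eq_square)
  also have "\<dots> = 27 * (3 * k^2 + s * t + s * t * (s + t))"
    unfolding st by (simp add: algebra_simps)
  finally show "27 dvd 1 + a^4 * b^2 + a^2 * b^4 - 3 * a^2 * b^2" by simp
qed

section \<open>Pure cubic fields\<close>

text \<open>These two rules would undo \<open>of_rat_mult\<close> and \<open>of_int_mult\<close>.\<close>

declare rat_complex.scale_scale [simp del] int_complex.scale_scale [simp del]

lemma squarefree_int:
  assumes "squarefree (n :: nat)"
  shows "squarefree (int n)"
proof (rule squarefreeI)
  fix x :: int assume "x ^ 2 dvd int n"
  moreover have "x ^ 2 = int (nat \<bar>x\<bar> ^ 2)" by simp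
  ultimately have "nat \<bar>x\<bar> ^ 2 dvd n" by (metis int_dvd_int_iff)
  hence "nat \<bar>x\<bar> dvd 1" by (rule squarefreeD[OF assms])
  thus "x dvd 1" by simp
qed

section \<open>Subfields of the complex numbers and their isomorphisms\<close>

lemma CC_simps [simp]:
  "carrier CC = UNIV" "monoid.mult CC = (*)" "one CC = 1" "ring.zero CC = 0" "ring.add CC = (+)"
  by (simp_all add: ring_of_type_algebra_def fun_eq_iff)

lemma field_CC: "Ring.field CC"
  by (rule field_from_type_algebra)

lemma a_inv_CC [simp]: "a_inv CC x = - x"
proof -
  interpret Ring.field CC by (rule field_CC)
  have "(- x) \<oplus>\<^bsub>CC\<^esub> x = \<zero>\<^bsub>CC\<^esub>" by simp
  thus ?thesis by (metis CC_simps(1) UNIV_I minus_equality)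
qed

lemma m_inv_CC: "x \<noteq> 0 \<Longrightarrow> m_inv CC x = inverse x"
proof -
  interpret Ring.field CC by (rule field_CC)
  assume "x \<noteq> 0"
  hence "inverse x \<otimes>\<^bsub>CC\<^esub> x = \<one>\<^bsub>CC\<^esub>" by simp
  thus ?thesis by (metis CC_simps(1) UNIV_I m_comm comm_inv_char)
qed

lemma subfield_CC_iff:
  "subfield K CC \<longleftrightarrow> 1 \<in> K \<and> (\<forall>x\<in>K. \<forall>y\<in>K. x + y \<in> K) \<and> (\<forall>x\<in>K. \<forall>y\<in>K. x * y \<in> K) \<and>
     (\<forall>x\<in>K. - x \<in> K) \<and> (\<forall>x\<in>K. x \<noteq> 0 \<longrightarrow> inverse x \<in> K)"
proof -
  interpret Ring.field CC by (rule field_CC)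
  show ?thesis
  proof (intro iffI conjI ballI impI)
    assume sf: "subfield K CC"
    note sr = subfieldE(1)[OF sf]
    show "1 \<in> K" using subringE(3)[OF sr] by simp
    show "x + y \<in> K" if "x \<in> K" "y \<in> K" for x y using subringE(7)[OF sr that] by simp
    show "x * y \<in> K" if "x \<in> K" "y \<in> K" for x y using subringE(6)[OF sr that] by simp
    show "- x \<in> K" if "x \<in> K" for x using subringE(5)[OF sr that] by simp
    show "inverse x \<in> K" if "x \<in> K" "x \<noteq> 0" for x
      using subfield_m_inv(1)[OF sf, of x] that by (simp add: m_inv_CC)
  next
    assume *: "1 \<in> K \<and> (\<forall>x\<in>K. \<forall>y\<in>K. x + y \<in> K) \<and> (\<forall>x\<in>K. \<forall>y\<in>K. x * y \<in> K) \<and>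
     (\<forall>x\<in>K. - x \<in> K) \<and> (\<forall>x\<in>K. x \<noteq> 0 \<longrightarrow> inverse x \<in> K)"
    show "subfield K CC"
    proof (rule subfieldI')
      show "subring K CC" using * by (intro subringI) auto
      show "inv\<^bsub>CC\<^esub> k \<in> K" if "k \<in> K - {\<zero>\<^bsub>CC\<^esub>}" for k
        using * that by (simp add: m_inv_CC)
    qed
  qed
qed

lemma subfield_CC_closed:
  assumes "subfield K CC"
  shows "1 \<in> K" "0 \<in> K" "x \<in> K \<Longrightarrow> y \<in> K \<Longrightarrow> x + y \<in> K" "x \<in> K \<Longrightarrow> y \<in> K \<Longrightarrow> x * y \<in> K"
    "x \<in> K \<Longrightarrow> - x \<in> K" "x \<in> K \<Longrightarrow> inverse x \<in> K" "x \<in> K \<Longrightarrow> x ^ n \<in> K" "of_rat q \<in> K"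
    "x \<in> K \<Longrightarrow> y \<in> K \<Longrightarrow> x / y \<in> K" "of_nat m \<in> K"
proof -
  have c: "1 \<in> K" "\<And>x y. x \<in> K \<Longrightarrow> y \<in> K \<Longrightarrow> x + y \<in> K" "\<And>x y. x \<in> K \<Longrightarrow> y \<in> K \<Longrightarrow> x * y \<in> K"
    "\<And>x. x \<in> K \<Longrightarrow> - x \<in> K" "\<And>x. x \<in> K \<Longrightarrow> x \<noteq> 0 \<Longrightarrow> inverse x \<in> K"
    using assms unfolding subfield_CC_iff by auto
  have z: "0 \<in> K" using c(2)[OF c(1) c(4)[OF c(1)]] by simp
  have i: "inverse x \<in> K" if "x \<in> K" for x using c(5)[OF that] z by (cases "x = 0") auto
  have n: "of_nat m \<in> K" for m by (induction m) (auto intro: c z)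
  have int: "of_int k \<in> K" for k
    by (cases k rule: int_cases2) (auto intro: n c(4))
  have q: "of_rat q \<in> K" for q
  proof -
    obtain k l where "quotient_of q = (k, l)" by fastforce
    hence "q = of_int k / of_int l" by (rule quotient_of_div)
    hence "of_rat q = of_int k / (of_int l :: complex)" by (simp add: of_rat_divide)
    thus ?thesis using int c(3) i by (simp add: divide_inverse)
  qed
  show "1 \<in> K" "0 \<in> K" "x \<in> K \<Longrightarrow> y \<in> K \<Longrightarrow> x + y \<in> K" "x \<in> K \<Longrightarrow> y \<in> K \<Longrightarrow> x * y \<in> K"
    "x \<in> K \<Longrightarrow> - x \<in> K" "x \<in> K \<Longrightarrow> inverse x \<in> K" "of_rat q \<in> K" "of_nat m \<in> K"
    using c z i q n by auto
  show "x \<in> K \<Longrightarrow> x ^ n \<in> K" by (induction n) (auto intro: c)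
  show "x \<in> K \<Longrightarrow> y \<in> K \<Longrightarrow> x / y \<in> K" using c(3) i by (simp add: divide_inverse)
qed

lemma generate_field_CC_eqI:
  assumes "subfield K CC" "t \<in> K" "\<And>L. subfield L CC \<Longrightarrow> t \<in> L \<Longrightarrow> K \<subseteq> L"
  shows "generate_field CC {t} = K"
proof -
  interpret Ring.field CC by (rule field_CC)
  show ?thesis
    by (rule generate_fieldI[symmetric]) (use assms in auto)
qed

lemma field_isomorphic_iff:
  "field_isomorphic K L \<longleftrightarrow> (\<exists>h. bij_betw h K L \<and> h 1 = 1 \<and>
     (\<forall>x\<in>K. \<forall>y\<in>K. h (x + y) = h x + h y \<and> h (x * y) = h x * h y))"
proof -
  have "ring_iso (CC\<lparr>carrier := K\<rparr>) (CC\<lparr>carrier := L\<rparr>) = 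
    {h. bij_betw h K L \<and> h 1 = 1 \<and> (\<forall>x\<in>K. \<forall>y\<in>K. h (x + y) = h x + h y \<and> h (x * y) = h x * h y)}"
    by (auto simp: ring_iso_def Ring.ring_hom_def bij_betw_def)
  thus ?thesis unfolding field_isomorphic_def is_ring_iso_def by auto
qed

lemma field_isomorphic_refl: "field_isomorphic K K"
  unfolding field_isomorphic_iff by (rule exI[of _ id]) auto

lemma field_isomorphic_trans:
  assumes "field_isomorphic K L" "field_isomorphic L M"
  shows "field_isomorphic K M"
proof -
  obtain f g where f: "bij_betw f K L" "f 1 = 1" "\<forall>x\<in>K. \<forall>y\<in>K. f (x + y) = f x + f y \<and> f (x * y) = f x * f y"
    and g: "bij_betw g L M" "g 1 = 1" "\<forall>x\<in>L. \<forall>y\<in>L. g (x + y) = g x + g y \<and> g (x * y) = g x * g y"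
    using assms unfolding field_isomorphic_iff by blast
  have "f x \<in> L" if "x \<in> K" for x using f(1) that by (auto simp: bij_betw_def)
  thus ?thesis unfolding field_isomorphic_iff using f g
    by (intro exI[of _ "g \<circ> f"]) (auto intro: bij_betw_trans)
qed

text \<open>Closure of \<open>K\<close> under sums and products is what allows the inverse map to be
  checked on \<open>L\<close>.\<close>

lemma field_isomorphic_sym:
  assumes "subfield K CC" "field_isomorphic K L"
  shows "field_isomorphic L K"
proof -
  obtain f where f: "bij_betw f K L" "f 1 = 1" "\<forall>x\<in>K. \<forall>y\<in>K. f (x + y) = f x + f y \<and> f (x * y) = f x * f y"
    using assms unfolding field_isomorphic_iff by blast
  define g where "g = inv_into K f"
  have g: "bij_betw g L K" unfolding g_def using f(1) by (rule bij_betw_inv_into)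
  have gf: "g (f x) = x" if "x \<in> K" for x using f(1) that by (simp add: g_def bij_betw_inv_into_left)
  have fg: "f (g y) = y" if "y \<in> L" for y using f(1) that by (simp add: g_def bij_betw_inv_into_right)
  have gK: "g y \<in> K" if "y \<in> L" for y using g that by (auto simp: bij_betw_def)
  note c = subfield_CC_closed[OF assms(1)]
  have "g 1 = 1" using gf[OF c(1)] f(2) by simp
  moreover have "g (x + y) = g x + g y \<and> g (x * y) = g x * g y" if "x \<in> L" "y \<in> L" for x y
  proof
    have "f (g x + g y) = x + y" "f (g x * g y) = x * y" using f(3) gK fg that by auto
    thus "g (x + y) = g x + g y" "g (x * y) = g x * g y"
      using gf[OF c(3)[OF gK[OF that(1)] gK[OF that(2)]]] gf[OF c(4)[OF gK[OF that(1)] gK[OF that(2)]]] by auto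
  qed
  ultimately show ?thesis unfolding field_isomorphic_iff using g by blast
qed

lemma field_hom_of_rat:
  fixes h :: "complex \<Rightarrow> complex"
  assumes "subfield K CC" "h 1 = 1" "\<And>x y. x \<in> K \<Longrightarrow> y \<in> K \<Longrightarrow> h (x + y) = h x + h y"
    "\<And>x y. x \<in> K \<Longrightarrow> y \<in> K \<Longrightarrow> h (x * y) = h x * h y"
  shows "h (of_rat q) = of_rat q"
proof -
  note c = subfield_CC_closed[OF assms(1)]
  have z: "h 0 = 0" using assms(3)[OF c(2) c(2)] by simp
  have n: "h (of_nat m) = of_nat m" for m
    by (induction m) (auto simp: z assms(2,3) c)
  have i: "h (of_int k) = of_int k" for k
  proof (cases k rule: int_cases2)
    case (nonpos m)
    have "h (of_nat m) + h (- of_nat m) = 0" using assms(3)[OF c(10) c(5)[OF c(10)], of m m] z by simp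
    thus ?thesis using nonpos n by (simp add: add_eq_0_iff)
  qed (use n in auto)
  obtain k l where kl: "quotient_of q = (k, l)" by fastforce
  hence q: "q = of_int k / of_int l" "l > 0" by (auto intro: quotient_of_div quotient_of_denom_pos)
  have "of_int l * of_rat q = (of_int k :: complex)" using q by (simp add: of_rat_divide)
  moreover have "of_int l \<in> K" using c(8)[of "of_int l"] by simp
  ultimately have "of_int l * h (of_rat q) = of_int k" using assms(4)[OF _ c(8), of "of_int l" q] i by metis
  hence "h (of_rat q) = of_int k / of_int l" using q(2) by (simp add: nonzero_eq_divide_eq mult.commute)
  thus ?thesis using q by (simp add: of_rat_divide)
qed

section \<open>The field generated by a cube root, in coordinates\<close>

locale pure_cubic =
  fixes a b :: nat and \<theta> :: complex
  assumes pos: "0 < a" "0 < b" and nontrivial: "a * b > 1"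
    and coprime_ab: "coprime a b" and squarefree_ab: "squarefree a" "squarefree b"
    and cube: "\<theta> ^ 3 = of_nat (a * b ^ 2)"
begin

definition \<phi> :: complex where "\<phi> = \<theta> ^ 2 / of_nat b"

definition el :: "rat \<Rightarrow> rat \<Rightarrow> rat \<Rightarrow> complex" where
  "el x y z = of_rat x + of_rat y * \<theta> + of_rat z * \<phi>"

definition K :: "complex set" where "K = {el x y z | x y z. True}"

definition nm :: "rat \<Rightarrow> rat \<Rightarrow> rat \<Rightarrow> rat" where "nm = norm_form (of_nat a) (of_nat b)"

lemma products: "\<theta> * \<theta> = of_nat b * \<phi>" "\<theta> * \<phi> = of_nat (a * b)" "\<phi> * \<theta> = of_nat (a * b)" "\<phi> * \<phi> = of_nat a * \<theta>"
proof -
  show "\<theta> * \<theta> = of_nat b * \<phi>" using pos by (simp add: \<phi>_def power2_eq_square)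
  have "\<theta> * \<phi> = \<theta> ^ 3 / of_nat b" by (simp add: \<phi>_def power2_eq_square power3_eq_cube)
  thus *: "\<theta> * \<phi> = of_nat (a * b)" using pos by (simp add: cube power2_eq_square)
  thus "\<phi> * \<theta> = of_nat (a * b)" by (simp add: mult.commute)
  have "\<phi> * \<phi> = (\<theta> * \<phi>) * \<theta> / of_nat b" by (simp add: \<phi>_def power2_eq_square)
  thus "\<phi> * \<phi> = of_nat a * \<theta>" using pos by (simp add: *)
qed

lemma el_add: "el x y z + el x' y' z' = el (x + x') (y + y') (z + z')"
  by (simp add: el_def of_rat_add algebra_simps)

lemma el_uminus: "- el x y z = el (- x) (- y) (- z)"
  by (simp add: el_def of_rat_minus algebra_simps)

lemma el_diff: "el x y z - el x' y' z' = el (x - x') (y - y') (z - z')"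
  by (simp add: el_def of_rat_diff algebra_simps)

lemma el_scale: "of_rat q * el x y z = el (q * x) (q * y) (q * z)"
  by (simp add: el_def of_rat_mult algebra_simps)

lemma el_mult: "el x y z * el x' y' z' =
    el (x * x' + of_nat (a * b) * (y * z' + z * y'))
       (x * y' + y * x' + of_nat a * z * z') (x * z' + z * x' + of_nat b * y * y')"
proof -
  have "el x y z * el x' y' z' = of_rat x * of_rat x' + (of_rat x * of_rat y' + of_rat y * of_rat x') * \<theta>
     + (of_rat x * of_rat z' + of_rat z * of_rat x') * \<phi> + of_rat y * of_rat y' * (\<theta> * \<theta>)
     + of_rat y * of_rat z' * (\<theta> * \<phi>) + of_rat z * of_rat y' * (\<phi> * \<theta>) + of_rat z * of_rat z' * (\<phi> * \<phi>)"
    by (simp add: el_def algebra_simps)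
  thus ?thesis unfolding products
    by (simp add: el_def of_rat_mult of_rat_add algebra_simps)
qed

lemma el_rat: "el x 0 0 = of_rat x" and el_\<theta>: "el 0 1 0 = \<theta>" and el_\<phi>: "el 0 0 1 = \<phi>"
  by (simp_all add: el_def)

text \<open>The second factor is the product of the two other conjugates of the first, written out
  in the basis 1, \<theta>, \<phi>. It identifies the norm form as a norm and provides inverses
  inside \<open>K\<close>.\<close>

lemma el_norm: "el x y z * el (x^2 - of_nat (a * b) * y * z) (of_nat a * z^2 - x * y) (of_nat b * y^2 - x * z)
    = of_rat (nm x y z)"
  unfolding el_mult el_rat[symmetric]
  by (intro arg_cong3[where f = el]) (simp_all add: nm_def norm_form_def algebra_simps power2_eq_square power3_eq_cube)

lemma nm_eq_0: "nm x y z = 0 \<Longrightarrow> x = 0 \<and> y = 0 \<and> z = 0"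
proof -
  assume "nm x y z = 0"
  moreover have "coprime (int a) (int b)" "squarefree (int a)" "squarefree (int b)" "int a * int b > 1"
    using coprime_ab squarefree_ab nontrivial
    by (auto simp: squarefree_int simp flip: of_nat_mult)
  ultimately show ?thesis using norm_form_eq_0_rat[of "int a" "int b" x y z] by (simp add: nm_def)
qed

lemma el_eq_0 [simp]: "el x y z = 0 \<longleftrightarrow> x = 0 \<and> y = 0 \<and> z = 0"
proof
  assume "el x y z = 0"
  hence "of_rat (nm x y z) = (0 :: complex)" using el_norm[of x y z] by simp
  hence "nm x y z = 0" by simp
  thus "x = 0 \<and> y = 0 \<and> z = 0" by (rule nm_eq_0)
qed (simp add: el_def)

lemma el_eq_iff [simp]: "el x y z = el x' y' z' \<longleftrightarrow> x = x' \<and> y = y' \<and> z = z'"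
  using el_eq_0[of "x - x'" "y - y'" "z - z'"] by (simp flip: el_diff)

lemma el_in_K [simp]: "el x y z \<in> K" by (auto simp: K_def)

lemma \<theta>_in_K: "\<theta> \<in> K" and \<phi>_in_K: "\<phi> \<in> K" and of_rat_in_K: "of_rat q \<in> K"
  using el_in_K el_\<theta> el_\<phi> el_rat by metis+

lemma subfield_K: "subfield K CC"
  unfolding subfield_CC_iff
proof (intro conjI ballI impI)
  show "1 \<in> K" using of_rat_in_K[of 1] by simp
  show "x + y \<in> K" "x * y \<in> K" if "x \<in> K" "y \<in> K" for x y
    using that by (auto simp: K_def el_add el_mult)
  show "- x \<in> K" if "x \<in> K" for x
    using that by (auto simp: K_def el_uminus)
  show "inverse x \<in> K" if "x \<in> K" and "x \<noteq> 0" for x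
  proof -
    obtain u v w where x: "x = el u v w" using \<open>x \<in> K\<close> by (auto simp: K_def)
    define y where "y = el (u^2 - of_nat (a * b) * v * w) (of_nat a * w^2 - u * v) (of_nat b * v^2 - u * w)"
    have "nm u v w \<noteq> 0" using \<open>x \<noteq> 0\<close> nm_eq_0[of u v w] unfolding x by auto
    moreover have "x * y = of_rat (nm u v w)" unfolding x y_def by (rule el_norm)
    ultimately have "x * (of_rat (inverse (nm u v w)) * y) = 1"
      by (simp add: of_rat_inverse mult.left_commute[of x])
    hence "inverse x = of_rat (inverse (nm u v w)) * y" by (rule inverse_unique)
    thus ?thesis by (simp add: y_def el_scale)
  qed
qed

lemma K_minimal:
  assumes "subfield L CC" "\<theta> \<in> L"
  shows "K \<subseteq> L"
proof -
  note c = subfield_CC_closed[OF assms(1)]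
  have "\<phi> \<in> L" unfolding \<phi>_def by (intro c assms)
  thus ?thesis unfolding K_def el_def by (auto intro!: c assms)
qed

lemma generate_field_eq_K:
  assumes "q \<noteq> 0"
  shows "generate_field CC {of_rat q * \<theta>} = K"
proof (rule generate_field_CC_eqI[OF subfield_K])
  show "of_rat q * \<theta> \<in> K" by (rule subfield_CC_closed(4)[OF subfield_K of_rat_in_K \<theta>_in_K])
  fix L assume L: "subfield L CC" "of_rat q * \<theta> \<in> L"
  note c = subfield_CC_closed[OF L(1)]
  have "of_rat (inverse q) * (of_rat q * \<theta>) \<in> L" by (rule c(4)[OF c(8) L(2)])
  also have "of_rat (inverse q) * (of_rat q * \<theta>) = \<theta>" using assms by (simp add: of_rat_inverse)
  finally show "K \<subseteq> L" by (rule K_minimal[OF L(1)])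
qed

text \<open>Possible because the locale fixes no order between \<open>a\<close> and
  \<open>b\<close>. The same field is thus parametrised by \<open>(a, b)\<close> and by
  \<open>(b, a)\<close>, which is why unique parameters require \<open>b < a\<close>.\<close>

lemma swapped: "pure_cubic b a \<phi>"
proof
  have "\<phi> ^ 3 = \<phi> * \<phi> * \<phi>" by (simp add: power3_eq_cube)
  also have "\<dots> = of_nat a * (\<theta> * \<phi>)" by (simp add: products)
  finally show "\<phi> ^ 3 = of_nat (b * a^2)" by (simp add: products power2_eq_square)
qed (use pos nontrivial coprime_ab squarefree_ab in \<open>auto simp: coprime_commute mult.commute\<close>)

lemma swapped_\<phi>: "pure_cubic.\<phi> a \<phi> = \<theta>"
  using pos by (simp add: pure_cubic.\<phi>_def[OF swapped] power2_eq_square products)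

lemma swapped_K: "pure_cubic.K a \<phi> = K"
proof -
  have "pure_cubic.el a \<phi> x y z = el x z y" for x y z
    by (simp add: pure_cubic.el_def[OF swapped] swapped_\<phi> el_def)
  hence "pure_cubic.K a \<phi> = {el x z y | x y z. True}"
    unfolding pure_cubic.K_def[OF swapped] by simp
  thus ?thesis unfolding K_def by blast
qed

text \<open>If \<open>a * b^2 = c^3\<close>, then \<open>\<theta> - c\<close> would have norm 0
  although its \<theta>-coordinate is 1.\<close>

lemma not_cube: "\<not> is_nth_power 3 (a * b ^ 2)"
proof
  assume "is_nth_power 3 (a * b ^ 2)"
  then obtain c where c: "a * b ^ 2 = c ^ 3" by (auto simp: is_nth_power_def)
  have "nm (- of_nat c) 1 0 = of_nat (a * b^2) - of_nat (c^3)" by (simp add: nm_def norm_form_def power3_eq_cube)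
  hence "nm (- of_nat c) 1 0 = 0" using c by simp
  from nm_eq_0[OF this] show False by simp
qed

text \<open>The \<theta>- and \<phi>-coordinates of \<open>w^3\<close> must vanish, which gives two
  cubic equations in \<open>x\<close>, \<open>y\<close>, \<open>z\<close>. Eliminating between them
  leaves \<open>x * (a z^3 - b y^3) = 0\<close>, and the norm form settles the second
  factor.\<close>

lemma rational_cube:
  assumes "w \<in> K" "w ^ 3 = of_rat M"
  obtains q where "w = of_rat q" | q where "w = of_rat q * \<theta>" | q where "w = of_rat q * \<phi>"
proof -
  obtain x y z where w: "w = el x y z" using assms by (auto simp: K_def)
  have "w ^ 3 = w * w * w" by (simp add: power3_eq_cube)
  also have "\<dots> = el (x * x * x + of_nat (a * b) * (6 * x * y * z) + of_nat a * of_nat a * of_nat b * z^3 + of_nat a * of_nat b * of_nat b * y^3)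
     (3 * (x^2 * y + of_nat a * x * z^2 + of_nat (a * b) * y^2 * z))
     (3 * (x^2 * z + of_nat b * x * y^2 + of_nat (a * b) * y * z^2))"
    unfolding w el_mult by (simp add: algebra_simps power2_eq_square power3_eq_cube)
  finally have "el (x * x * x + of_nat (a * b) * (6 * x * y * z) + of_nat a * of_nat a * of_nat b * z^3 + of_nat a * of_nat b * of_nat b * y^3)
     (3 * (x^2 * y + of_nat a * x * z^2 + of_nat (a * b) * y^2 * z))
     (3 * (x^2 * z + of_nat b * x * y^2 + of_nat (a * b) * y * z^2)) = el M 0 0"
    using assms(2) by (simp only: el_rat)
  hence e1: "x^2 * y + of_nat a * x * z^2 + of_nat (a * b) * y^2 * z = 0"
    and e2: "x^2 * z + of_nat b * x * y^2 + of_nat (a * b) * y * z^2 = 0" by simp_all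
  have "x * (of_nat a * z^3 - of_nat b * y^3) =
     z * (x^2 * y + of_nat a * x * z^2 + of_nat (a * b) * y^2 * z) - y * (x^2 * z + of_nat b * x * y^2 + of_nat (a * b) * y * z^2)"
    by (simp add: algebra_simps power2_eq_square power3_eq_cube)
  hence "x = 0 \<or> of_nat a * z^3 = of_nat b * y^3" unfolding e1 e2 by simp
  thus ?thesis
  proof
    assume "of_nat a * z^3 = of_nat b * y^3"
    \<comment> \<open>This norm equals \<open>b^2 * (a z^3 - b y^3)\<close>.\<close>
    hence "nm (- of_nat b * y) z 0 = 0"
      by (simp add: nm_def norm_form_def power_mult_distrib) (simp add: power2_eq_square power3_eq_cube)
    hence "- of_nat b * y = 0 \<and> z = 0" by (auto dest: nm_eq_0)
    hence "y = 0 \<and> z = 0" using pos by simp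
    thus ?thesis using that(1)[of x] w by (simp add: el_def)
  next
    assume x: "x = 0"
    hence "y = 0 \<or> z = 0" using e1 pos by auto
    thus ?thesis using that(2)[of y] that(3)[of z] w x by (auto simp: el_def)
  qed
qed

end

lemma pure_cubic_real_root:
  assumes "0 < a" "0 < b" "a * b > 1" "coprime a b" "squarefree a" "squarefree b"
  shows "pure_cubic a b (complex_of_real (root 3 (real (a * b ^ 2))))"
proof
  have "root 3 (real (a * b^2)) ^ 3 = real (a * b^2)" by (rule real_root_pow_pos2) simp_all
  thus "complex_of_real (root 3 (real (a * b ^ 2))) ^ 3 = of_nat (a * b^2)"
    by (metis of_real_of_nat_eq of_real_power)
qed (use assms in auto)

lemma (in pure_cubic) cbrt_field_eq:
  assumes "c > 0" "\<theta> = complex_of_real (root 3 (real (a * b ^ 2)))"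
  shows "cbrt_field (c ^ 3 * (a * b ^ 2)) = K"
proof -
  have "root 3 (real (c ^ 3 * (a * b ^ 2))) = real c * root 3 (real (a * b^2))"
    by (simp add: real_root_mult real_root_power)
  hence "complex_of_real (root 3 (real (c ^ 3 * (a * b ^ 2)))) = of_rat (of_nat c) * \<theta>"
    using assms by simp
  thus ?thesis unfolding cbrt_field_def using generate_field_eq_K[of "of_nat c"] assms by simp
qed

section \<open>Isomorphism classes\<close>

text \<open>Multiplying by a prime \<open>p\<close> raises its exponent by one, read modulo 3:
  \<open>p\<close> joins \<open>a\<close>, or moves from \<open>a\<close> to \<open>b\<close>, or
  moves from \<open>b\<close> to \<open>c\<close>.\<close>

lemma cube_decomposition:
  assumes "m > 0"
  shows "\<exists>a b c. 0 < a \<and> 0 < b \<and> 0 < c \<and> coprime a b \<and> squarefree a \<and> squarefree b \<and> m = c ^ 3 * (a * b ^ 2 :: nat)"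
  using assms
proof (induction m rule: less_induct)
  case (less m)
  show ?case
  proof (cases "m = 1")
    case True
    thus ?thesis by (intro exI[of _ 1]) auto
  next
    case False
    then obtain p where p: "nprime p" "p dvd m" using prime_factor_nat by blast
    then obtain n where m: "m = p * n" by blast
    have p1: "p > 1" using p(1) by (rule prime_gt_1_nat)
    have n: "n > 0" "n < m" using less.prems m p1 by auto
    then obtain a b c where abc: "0 < a" "0 < b" "0 < c" "coprime a b" "squarefree a" "squarefree b"
      "n = c ^ 3 * (a * b ^ 2)" using less.IH by blast
    show ?thesis
    proof (cases "p dvd a")
      case pa: True
      then obtain a' where a': "a = p * a'" by blast
      have "squarefree a'" "coprime a' b" using abc a' by (auto intro: squarefree_multD)
      moreover have "coprime p b" using abc a' by simp
      moreover have "\<not> p dvd a'"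
      proof
        assume "p dvd a'"
        hence "p ^ 2 dvd a" using a' by (simp add: power2_eq_square)
        hence "p dvd 1" using squarefreeD[OF abc(5)] by blast
        thus False using p1 by simp
      qed
      hence "coprime p a'" using p(1) by (simp add: prime_imp_coprime)
      ultimately have "coprime a' (p * b)" "squarefree (p * b)"
        using p(1) abc by (auto simp: coprime_commute squarefree_mult_coprime squarefree_prime)
      moreover have "m = c ^ 3 * (a' * (p * b) ^ 2)" unfolding m abc(7) a'
        by (simp add: power2_eq_square)
      ultimately show ?thesis using abc p1 a' \<open>squarefree a'\<close>
        by (intro exI[of _ a'] exI[of _ "p * b"] exI[of _ c]) auto
    next
      case pa: False
      show ?thesis
      proof (cases "p dvd b")
        case True
        then obtain b' where b': "b = p * b'" by blast
        have "squarefree b'" "coprime a b'" using abc b' by (auto intro: squarefree_multD)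
        moreover have "m = (p * c) ^ 3 * (a * b' ^ 2)" unfolding m abc(7) b'
          by (simp add: power2_eq_square power3_eq_cube)
        ultimately show ?thesis using abc p1 b'
          by (intro exI[of _ a] exI[of _ b'] exI[of _ "p * c"]) auto
      next
        case pb: False
        have "coprime p a" "coprime p b" using pa pb p(1) by (simp_all add: prime_imp_coprime)
        hence "coprime (p * a) b" "squarefree (p * a)"
          using p(1) abc by (auto simp: squarefree_mult_coprime squarefree_prime)
        moreover have "m = c ^ 3 * ((p * a) * b ^ 2)" unfolding m abc(7) by simp
        ultimately show ?thesis using abc p1
          by (intro exI[of _ "p * a"] exI[of _ b] exI[of _ c]) auto
      qed
    qed
  qed
qed

lemma cubefree:
  fixes a b p :: nat
  assumes "coprime a b" "squarefree a" "squarefree b" "nprime p"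
  shows "\<not> p ^ 3 dvd a * b ^ 2"
proof
  assume d: "p ^ 3 dvd a * b ^ 2"
  have p1: "\<not> p dvd 1" using assms(4) not_prime_unit by blast
  show False
  proof (cases "p dvd a")
    case True
    hence "\<not> p dvd b" using assms(1) p1 coprime_common_divisor by blast
    hence "coprime p b" using assms(4) by (simp add: prime_imp_coprime)
    hence "coprime (p ^ 3) (b ^ 2)" by simp
    hence "p ^ 3 dvd a" using d by (simp add: coprime_dvd_mult_left_iff)
    hence "p ^ 2 dvd a" by (rule power_le_dvd) simp
    thus False using squarefreeD[OF assms(2)] p1 by blast
  next
    case False
    hence "coprime p a" using assms(4) by (simp add: prime_imp_coprime)
    hence "coprime (p ^ 3) a" by simp
    hence d: "p ^ 3 dvd b ^ 2" using d by (simp add: coprime_dvd_mult_right_iff)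
    hence "p dvd b ^ 2" by (rule dvd_trans[rotated]) simp
    hence "p dvd b" using assms(4) by (rule prime_dvd_power[rotated])
    then obtain c where c: "b = p * c" by blast
    have p0: "p > 0" using assms(4) by (simp add: prime_gt_0_nat)
    have "p ^ 2 * p dvd p ^ 2 * c ^ 2" using d c by (simp add: power2_eq_square power3_eq_cube mult_ac)
    hence "p dvd c ^ 2" using p0 by simp
    hence "p dvd c" using assms(4) by (rule prime_dvd_power[rotated])
    hence "p ^ 2 dvd b" using c by (simp add: power2_eq_square)
    thus False using squarefreeD[OF assms(3)] p1 by blast
  qed
qed

lemma squarefree_dvdI:
  fixes m n :: nat
  assumes "squarefree m" "\<And>p. nprime p \<Longrightarrow> p dvd m \<Longrightarrow> p dvd n"
  shows "m dvd n"
  using assms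
proof (induction m rule: less_induct)
  case (less m)
  show ?case
  proof (cases "m = 1 \<or> m = 0")
    case True
    thus ?thesis using less.prems by auto
  next
    case False
    then obtain p where p: "nprime p" "p dvd m" using prime_factor_nat by blast
    then obtain k where m: "m = p * k" by blast
    have p1: "p > 1" using p(1) by (rule prime_gt_1_nat)
    have "k < m" using False m p1 by auto
    have "\<not> p dvd k"
    proof
      assume "p dvd k"
      hence "p ^ 2 dvd m" using m by (simp add: power2_eq_square)
      thus False using squarefreeD[OF less.prems(1)] p1 by force
    qed
    hence "coprime p k" using p(1) by (simp add: prime_imp_coprime)
    moreover have "squarefree k" using less.prems(1) unfolding m by (rule squarefree_multD)
    hence "k dvd n" using less.IH[OF \<open>k < m\<close>] less.prems(2) m by simp
    moreover have "p dvd n" using less.prems(2) p by blast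
    ultimately show ?thesis unfolding m by (simp add: divides_mult)
  qed
qed

text \<open>The primes of \<open>b\<close> are exactly those whose square divides
  \<open>a * b^2\<close>, so the product determines \<open>b\<close>.\<close>

lemma squarefree_pair_unique:
  fixes a b c d :: nat
  assumes ab: "coprime a b" "squarefree a" "squarefree b" and cd: "coprime c d" "squarefree c" "squarefree d"
    and "b > 0" and eq: "a * b ^ 2 = c * d ^ 2"
  shows "a = c \<and> b = d"
proof -
  have *: "b dvd d" if "coprime a b" "squarefree a" "squarefree b" "coprime c d" "squarefree c" "squarefree d"
     "a * b ^ 2 = c * d ^ 2" for a b c d :: nat
  proof (rule squarefree_dvdI[OF that(3)])
    fix p assume p: "nprime p" "p dvd b"
    show "p dvd d"
    proof (rule ccontr)
      assume "\<not> p dvd d"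
      hence "coprime (p ^ 2) (d ^ 2)" using p(1) by (simp add: prime_imp_coprime)
      moreover have "p ^ 2 dvd c * d ^ 2" using p(2) by (simp flip: that(7))
      ultimately have "p ^ 2 dvd c" by (simp add: coprime_dvd_mult_left_iff)
      thus False using squarefreeD[OF that(5)] p(1) not_prime_unit by blast
    qed
  qed
  have "b = d" using *[OF ab cd eq] *[OF cd ab eq[symmetric]] by (simp add: dvd_antisym)
  thus ?thesis using eq \<open>b > 0\<close> by simp
qed

text \<open>With \<open>q = u / v\<close> in lowest terms,
  \<open>v^3 * (c * d^2) = u^3 * (a * b^2)\<close>. The cube of a prime of \<open>u\<close> would
  divide \<open>c * d^2\<close>, the cube of a prime of \<open>v\<close> would divide
  \<open>a * b^2\<close>, and both numbers are cube-free.\<close>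

lemma cube_class_unique:
  fixes a b c d :: nat and q :: rat
  assumes ab: "coprime a b" "squarefree a" "squarefree b" and cd: "coprime c d" "squarefree c" "squarefree d"
    and pos: "a > 0" "b > 0" "c > 0" "d > 0" and eq: "of_nat (c * d ^ 2) = q ^ 3 * of_nat (a * b ^ 2)"
  shows "a = c \<and> b = d"
proof -
  obtain k l where kl: "quotient_of q = (k, l)" by fastforce
  hence q: "q = of_int k / of_int l" "l > 0" "coprime k l"
    by (auto intro: quotient_of_div quotient_of_denom_pos quotient_of_coprime)
  have "q ^ 3 * of_nat (a * b ^ 2) > 0" unfolding eq[symmetric] using pos by simp
  moreover have "of_nat (a * b ^ 2) > (0 :: rat)" using pos by simp
  ultimately have "q ^ 3 > 0" by (rule zero_less_mult_pos2)
  hence "q > 0" by (simp add: zero_less_power_eq)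
  hence "k > 0" using q by (simp add: zero_less_divide_iff)
  define u v where "u = nat k" and "v = nat l"
  have uv: "k = int u" "l = int v" "u > 0" "v > 0" "coprime u v"
    using \<open>k > 0\<close> q by (auto simp: u_def v_def coprime_nat_abs_left_iff simp flip: coprime_int_iff)
  have "of_nat v ^ 3 * of_nat (c * d ^ 2) = (of_nat u ^ 3 * of_nat (a * b ^ 2) :: rat)"
    unfolding eq q(1) using uv by (simp add: power_divide)
  hence e: "v ^ 3 * (c * d ^ 2) = u ^ 3 * (a * b ^ 2)"
    by (metis (mono_tags, lifting) of_nat_eq_iff of_nat_mult of_nat_power)
  have "u = 1"
  proof (rule ccontr)
    assume "u \<noteq> 1"
    then obtain p where p: "nprime p" "p dvd u" using prime_factor_nat by blast
    hence "\<not> p dvd v" using uv(5) coprime_common_divisor not_prime_unit by blast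
    hence "coprime (p ^ 3) (v ^ 3)" using p(1) by (simp add: prime_imp_coprime)
    moreover have "p ^ 3 dvd v ^ 3 * (c * d ^ 2)" unfolding e using p(2) by simp
    ultimately have "p ^ 3 dvd c * d ^ 2" by (simp add: coprime_dvd_mult_right_iff)
    thus False using cubefree[OF cd p(1)] by blast
  qed
  moreover have "v = 1"
  proof (rule ccontr)
    assume "v \<noteq> 1"
    then obtain p where p: "nprime p" "p dvd v" using prime_factor_nat by blast
    hence "\<not> p dvd u" using uv(5) coprime_common_divisor not_prime_unit by blast
    hence "coprime (p ^ 3) (u ^ 3)" using p(1) by (simp add: prime_imp_coprime)
    moreover have "p ^ 3 dvd u ^ 3 * (a * b ^ 2)" unfolding e[symmetric] using p(2) by simp
    ultimately have "p ^ 3 dvd a * b ^ 2" by (simp add: coprime_dvd_mult_right_iff)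
    thus False using cubefree[OF ab p(1)] by blast
  qed
  ultimately have "a * b ^ 2 = c * d ^ 2" using e by simp
  thus ?thesis using squarefree_pair_unique[OF ab cd pos(2)] by blast
qed

section \<open>Admissible pairs and the fields they generate\<close>

definition admissible_pair :: "nat \<Rightarrow> nat \<Rightarrow> bool" where
  "admissible_pair a b \<longleftrightarrow> 0 < b \<and> b < a \<and> coprime a b \<and> squarefree a \<and> squarefree b"

lemma admissible_pair_pure_cubic:
  assumes "admissible_pair a b"
  shows "pure_cubic a b (complex_of_real (root 3 (real (a * b ^ 2))))"
proof (rule pure_cubic_real_root)
  have "1 < a" using assms by (auto simp: admissible_pair_def)
  also have "a \<le> a * b" using assms by (simp add: admissible_pair_def)
  finally show "a * b > 1" .
qed (use assms in \<open>auto simp: admissible_pair_def\<close>)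

lemma admissible_pair_cbrt_field:
  assumes "admissible_pair a b"
  shows "cbrt_field (a * b ^ 2) = pure_cubic.K b (complex_of_real (root 3 (real (a * b ^ 2))))"
  using pure_cubic.cbrt_field_eq[OF admissible_pair_pure_cubic[OF assms], of 1] by simp

lemma subfield_cbrt_field:
  assumes "admissible_pair a b"
  shows "subfield (cbrt_field (a * b ^ 2)) CC"
  unfolding admissible_pair_cbrt_field[OF assms]
  by (rule pure_cubic.subfield_K[OF admissible_pair_pure_cubic[OF assms]])

text \<open>If the decomposition of \<open>m\<close> comes with \<open>b > a\<close>, the pair is
  exchanged: \<phi> is then the real cube root of \<open>b * a^2\<close> and generates the same
  field.\<close>

lemma cbrt_field_admissible:
  assumes "m > 0" "\<not> is_nth_power 3 m"
  obtains a b where "admissible_pair a b" "cbrt_field m = cbrt_field (a * b ^ 2)"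
proof -
  obtain a b c where abc: "0 < a" "0 < b" "0 < c" "coprime a b" "squarefree a" "squarefree b" "m = c ^ 3 * (a * b ^ 2)"
    using cube_decomposition[OF assms(1)] by blast
  have ne: "a * b \<noteq> 1" using assms(2) abc(7) by (auto simp: is_nth_power_def)
  hence "a * b > 1" using abc by (metis less_one linorder_neqE_nat mult_is_0 not_gr_zero)
  then interpret pure_cubic a b "complex_of_real (root 3 (real (a * b ^ 2)))"
    using abc by (intro pure_cubic_real_root) auto
  have m: "cbrt_field m = K" unfolding abc(7) using abc(3) by (intro cbrt_field_eq) auto
  show ?thesis
  proof (cases "b < a")
    case True
    hence "admissible_pair a b" using abc by (simp add: admissible_pair_def)
    moreover have "cbrt_field (a * b ^ 2) = K" using cbrt_field_eq[of 1] by simp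
    ultimately show ?thesis using m that by simp
  next
    case False
    have "a \<noteq> b" using ne abc(4) by auto
    hence ba: "admissible_pair b a" using abc False by (auto simp: admissible_pair_def coprime_commute)
    have "\<phi> = complex_of_real (root 3 (real (b * a ^ 2)))"
    proof -
      have "root 3 (real (a * b ^ 2)) ^ 2 / real b = root 3 (real (b * a ^ 2))"
      proof (rule real_root_pos_unique[symmetric])
        define r where "r = root 3 (real (a * b ^ 2))"
        have r3: "r ^ 3 = real (a * b ^ 2)" unfolding r_def by (rule real_root_pow_pos2) simp_all
        have "(r ^ 2 / real b) ^ 3 = (r ^ 3) ^ 2 / real b ^ 3"
          by (simp add: power_divide flip: power_mult)
        also have "\<dots> = real (b * a ^ 2)" unfolding r3
          using abc(2) by (simp add: field_simps power2_eq_square power3_eq_cube)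
        finally show "(root 3 (real (a * b ^ 2)) ^ 2 / real b) ^ 3 = real (b * a ^ 2)" unfolding r_def .
      qed auto
      thus ?thesis unfolding \<phi>_def by (metis of_real_divide of_real_of_nat_eq of_real_power)
    qed
    hence "cbrt_field (b * a ^ 2) = K"
      using pure_cubic.cbrt_field_eq[OF swapped, of 1] swapped_K by simp
    with m ba that show ?thesis by simp
  qed
qed

text \<open>An isomorphism fixes the rationals, so the image of \<theta> is again a cube root of
  \<open>a * b^2\<close>, possibly a non-real one.\<close>

lemma (in pure_cubic) isomorphic_copy:
  assumes L: "subfield L CC" "field_isomorphic L K"
  obtains \<theta>' where "pure_cubic a b \<theta>'" "pure_cubic.K b \<theta>' = L"
proof -
  obtain g where g: "bij_betw g K L" "g 1 = 1"
    and hom: "\<And>x y. x \<in> K \<Longrightarrow> y \<in> K \<Longrightarrow> g (x + y) = g x + g y" "\<And>x y. x \<in> K \<Longrightarrow> y \<in> K \<Longrightarrow> g (x * y) = g x * g y"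
    using field_isomorphic_sym[OF L] unfolding field_isomorphic_iff by blast
  note c = subfield_CC_closed[OF subfield_K]
  have g_rat: "g (of_rat q) = of_rat q" for q
    by (rule field_hom_of_rat[OF subfield_K g(2) hom])
  define \<theta>' where "\<theta>' = g \<theta>"
  have "\<theta>' ^ 3 = g (\<theta> ^ 3)"
    by (simp add: \<theta>'_def power3_eq_cube hom c \<theta>_in_K)
  also have "\<dots> = of_nat (a * b ^ 2)"
    unfolding cube using g_rat[of "of_nat (a * b^2)"] by (simp del: of_nat_mult of_nat_power)
  finally have pc: "pure_cubic a b \<theta>'"
    by unfold_locales (use pos nontrivial coprime_ab squarefree_ab in auto)
  have "g \<theta> * g \<theta> = g (of_rat (of_nat b) * \<phi>)"
    using hom(2)[OF \<theta>_in_K \<theta>_in_K] by (simp add: products)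
  also have "\<dots> = of_nat b * g \<phi>" unfolding hom(2)[OF c(8) \<phi>_in_K] g_rat by simp
  finally have \<phi>': "pure_cubic.\<phi> b \<theta>' = g \<phi>"
    using pos unfolding pure_cubic.\<phi>_def[OF pc] by (simp add: \<theta>'_def power2_eq_square)
  have "g (el x y z) = pure_cubic.el b \<theta>' x y z" for x y z
    unfolding el_def pure_cubic.el_def[OF pc] \<phi>'
    by (simp add: hom c \<theta>_in_K \<phi>_in_K g_rat \<theta>'_def)
  moreover have "L = {g (el x y z) | x y z. True}"
    using bij_betw_imp_surj_on[OF g(1)] unfolding K_def by blast
  ultimately have "pure_cubic.K b \<theta>' = L"
    unfolding pure_cubic.K_def[OF pc] by simp
  with pc show ?thesis by (rule that)
qed

text \<open>The field of \<open>(a, b)\<close> contains a cube root of \<open>c * d^2\<close>, so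
  \<open>rational_cube\<close> leaves three cases. A rational root contradicts its independence from
  1, a multiple of \<theta> gives equal pairs, and a multiple of \<phi> gives the exchanged pair,
  which \<open>b < a\<close> and \<open>d < c\<close> exclude.\<close>

lemma cbrt_field_isomorphic_imp_eq:
  assumes ab: "admissible_pair a b" and cd: "admissible_pair c d"
    and iso: "field_isomorphic (cbrt_field (c * d ^ 2)) (cbrt_field (a * b ^ 2))"
  shows "a = c \<and> b = d"
proof -
  interpret L: pure_cubic c d "complex_of_real (root 3 (real (c * d ^ 2)))"
    by (rule admissible_pair_pure_cubic[OF cd])
  interpret pure_cubic a b "complex_of_real (root 3 (real (a * b ^ 2)))"
    by (rule admissible_pair_pure_cubic[OF ab])
  obtain \<theta>' where "pure_cubic c d \<theta>'" "pure_cubic.K d \<theta>' = K"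
    using field_isomorphic_sym[OF subfield_cbrt_field[OF cd] iso] L.isomorphic_copy[of K] subfield_K
    unfolding admissible_pair_cbrt_field[OF ab] admissible_pair_cbrt_field[OF cd] by blast
  then interpret M: pure_cubic c d \<theta>' by simp
  have w: "\<theta>' \<in> K" "\<theta>' ^ 3 = of_rat (of_nat (c * d ^ 2))"
    using M.\<theta>_in_K M.cube \<open>M.K = K\<close> by (simp_all del: of_nat_mult of_nat_power)
  have A: "coprime a b" "squarefree a" "squarefree b" "a > 0" "b > 0" "b < a"
    and C: "coprime c d" "squarefree c" "squarefree d" "c > 0" "d > 0" "d < c"
    using ab cd by (auto simp: admissible_pair_def)
  have inj: "q * r = s" if "of_rat q * of_rat r = (of_rat s :: complex)" for q r s
    using that by (metis of_rat_eq_iff of_rat_mult)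
  show ?thesis
  proof (rule rational_cube[OF w])
    fix q assume e: "\<theta>' = of_rat q"
    have "M.el 0 1 0 = M.el q 0 0" unfolding M.el_rat M.el_\<theta> by (rule e)
    thus ?thesis by (simp only: M.el_eq_iff) simp
  next
    fix q assume e: "\<theta>' = of_rat q * complex_of_real (root 3 (real (a * b ^ 2)))"
    have "of_rat (q ^ 3) * of_rat (of_nat (a * b ^ 2)) = (of_rat (of_nat (c * d ^ 2)) :: complex)"
      unfolding w(2)[symmetric] unfolding e power_mult_distrib cube by (simp add: of_rat_power of_rat_mult)
    from inj[OF this] have "of_nat (c * d ^ 2) = q ^ 3 * of_nat (a * b ^ 2)" by simp
    thus ?thesis by (rule cube_class_unique[OF A(1-3) C(1-3) A(4,5) C(4,5)])
  next
    fix q assume e: "\<theta>' = of_rat q * \<phi>"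
    have "of_rat (q ^ 3) * of_rat (of_nat (b * a ^ 2)) = (of_rat (of_nat (c * d ^ 2)) :: complex)"
      unfolding w(2)[symmetric] unfolding e power_mult_distrib pure_cubic.cube[OF swapped] by (simp add: of_rat_power of_rat_mult)
    from inj[OF this] have "of_nat (c * d ^ 2) = q ^ 3 * of_nat (b * a ^ 2)" by simp
    hence "b = c \<and> a = d"
      using A C by (intro cube_class_unique) (auto simp: coprime_commute)
    with A C show ?thesis by simp
  qed
qed

lemma cubic_params_iff:
  "cubic_params K a b \<longleftrightarrow> admissible_pair a b \<and> field_isomorphic K (cbrt_field (a * b ^ 2))"
  by (auto simp: cubic_params_def admissible_pair_def)

lemma pure_cubic_field_iff: "pure_cubic_field K \<longleftrightarrow> subfield K CC \<and> (\<exists>a b. cubic_params K a b)"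
proof
  assume "pure_cubic_field K"
  thus "subfield K CC \<and> (\<exists>a b. cubic_params K a b)"
    unfolding pure_cubic_field_def cubic_params_iff by (metis cbrt_field_admissible)
next
  assume *: "subfield K CC \<and> (\<exists>a b. cubic_params K a b)"
  then obtain a b where ab: "admissible_pair a b" "field_isomorphic K (cbrt_field (a * b ^ 2))"
    by (auto simp: cubic_params_iff)
  have "\<not> is_nth_power 3 (a * b ^ 2)" by (rule pure_cubic.not_cube[OF admissible_pair_pure_cubic[OF ab(1)]])
  moreover have "a * b ^ 2 > 0" using ab(1) by (simp add: admissible_pair_def)
  ultimately show "pure_cubic_field K" using * ab(2) unfolding pure_cubic_field_def by blast
qed

lemma cubic_params_unique:
  assumes "subfield K CC" "cubic_params K a b" "cubic_params K c d"
  shows "a = c \<and> b = d"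
proof (rule cbrt_field_isomorphic_imp_eq)
  show "field_isomorphic (cbrt_field (c * d ^ 2)) (cbrt_field (a * b ^ 2))"
    using assms field_isomorphic_sym field_isomorphic_trans unfolding cubic_params_iff by meson
qed (use assms in \<open>auto simp: cubic_params_iff\<close>)

lemma ratio_eq:
  assumes "subfield K CC" "cubic_params K a b"
  shows "ratio K = of_nat a / of_nat b"
  unfolding ratio_def
  by (rule the_equality) (use assms cubic_params_unique in blast)+

section \<open>The type in terms of the pair\<close>

lemma rat_cong_9_iff:
  fixes a b :: nat and e :: int
  assumes "b > 0" "\<not> 3 dvd b"
  shows "rat_cong (of_nat a / of_nat b) (of_int e) 9 \<longleftrightarrow> 9 dvd int a - e * int b"
proof
  assume "rat_cong (of_nat a / of_nat b) (of_int e) 9"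
  then obtain u v where uv: "v \<noteq> 0" "coprime v 9" "(of_nat a / of_nat b :: rat) - of_int e = of_int 9 * (of_int u / of_int v)"
    unfolding rat_cong_def by blast
  have "(of_int ((int a - e * int b) * v) :: rat) = of_int (9 * u * int b)"
    using uv assms(1) by (simp add: field_simps)
  hence "(int a - e * int b) * v = 9 * u * int b" by (simp only: of_int_eq_iff)
  hence "9 dvd (int a - e * int b) * v" by simp
  thus "9 dvd int a - e * int b" using uv(2) by (simp add: coprime_dvd_mult_left_iff coprime_commute)
next
  assume "9 dvd int a - e * int b"
  then obtain u where u: "int a - e * int b = 9 * u" by blast
  have r: "of_nat a - of_int e * of_nat b = (9 * of_int u :: rat)"
    using arg_cong[OF u, of "of_int :: int \<Rightarrow> rat"] by simp
  have "(of_nat a / of_nat b :: rat) - of_int e = (of_nat a - of_int e * of_nat b) / of_nat b"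
    using assms(1) by (simp add: diff_divide_distrib)
  hence "(of_nat a / of_nat b :: rat) - of_int e = of_int 9 * (of_int u / of_int (int b))"
    by (simp add: r)
  moreover have "coprime (int b) 9"
  proof -
    have "\<not> 3 dvd int b" using assms(2) by presburger
    hence "coprime 3 (int b)" by (simp add: prime_imp_coprime)
    hence "coprime (3 ^ 2) (int b)" by (subst coprime_power_left_iff) simp
    thus ?thesis by (simp add: coprime_commute)
  qed
  ultimately show "rat_cong (of_nat a / of_nat b) (of_int e) 9"
    unfolding rat_cong_def using assms(1) by (intro exI[of _ u] exI[of _ "int b"]) auto
qed

definition type_II_pair :: "nat \<Rightarrow> nat \<Rightarrow> bool" where
  "type_II_pair a b \<longleftrightarrow> \<not> 3 dvd a * b \<and> (9 dvd int a - int b \<or> 9 dvd int a + int b)"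

lemma type_II_iff:
  assumes K: "subfield K CC" "cubic_params K a b"
  shows "type_II K \<longleftrightarrow> type_II_pair a b"
proof -
  have "(\<exists>a b. cubic_params K a b \<and> \<not> 3 dvd a * b ^ 2) \<longleftrightarrow> \<not> 3 dvd a * b ^ 2"
    using cubic_params_unique[OF K] K(2) by blast
  moreover have "3 dvd a * b ^ 2 \<longleftrightarrow> 3 dvd a * b"
    by (simp add: prime_dvd_mult_iff prime_dvd_power_iff)
  moreover have "rat_cong (ratio K) 1 9 \<longleftrightarrow> 9 dvd int a - int b"
    "rat_cong (ratio K) (- 1) 9 \<longleftrightarrow> 9 dvd int a + int b" if "\<not> 3 dvd a * b"

  proof -
    have b: "b > 0" "\<not> 3 dvd b" using that K(2) by (auto simp: cubic_params_def)
    show "rat_cong (ratio K) 1 9 \<longleftrightarrow> 9 dvd int a - int b"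
      "rat_cong (ratio K) (- 1) 9 \<longleftrightarrow> 9 dvd int a + int b"
      using rat_cong_9_iff[OF b, of a 1] rat_cong_9_iff[OF b, of a "-1"] by (simp_all add: ratio_eq[OF K])
  qed
  ultimately show ?thesis unfolding type_II_def type_II_pair_def by blast
qed

text \<open>Each class that meets \<open>S\<close> contains exactly one field
  \<open>cbrt_field (a * b ^ 2)\<close> with an admissible pair. The hypothesis says that membership
  of a subfield in \<open>S\<close> depends on its parameters only.\<close>

lemma card_quotient_pure_cubic_iso:
  assumes S: "\<And>K. K \<in> S \<longleftrightarrow> subfield K CC \<and> (\<exists>a b. cubic_params K a b \<and> P a b)"
  shows "card (S // pure_cubic_iso) = card {(a, b). admissible_pair a b \<and> P a b}"
proof -
  define f where "f = (\<lambda>(a, b). pure_cubic_iso `` {cbrt_field (a * b ^ 2)})"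
  have params: "cubic_params (cbrt_field (a * b ^ 2)) a b" if "admissible_pair a b" for a b
    using that by (simp add: cubic_params_iff field_isomorphic_refl)
  have pc: "pure_cubic_field (cbrt_field (a * b ^ 2))" if "admissible_pair a b" for a b
    using that params subfield_cbrt_field unfolding pure_cubic_field_iff by blast
  have "S // pure_cubic_iso = f ` {(a, b). admissible_pair a b \<and> P a b}"
  proof (intro equalityI subsetI)
    fix c assume "c \<in> S // pure_cubic_iso"
    then obtain K where K: "K \<in> S" "c = pure_cubic_iso `` {K}" by (auto elim: quotientE)
    then obtain a b where ab: "subfield K CC" "cubic_params K a b" "P a b" using S by blast
    hence adm: "admissible_pair a b" and iso: "field_isomorphic K (cbrt_field (a * b ^ 2))"
      by (auto simp: cubic_params_iff)
    have "pure_cubic_field K" using ab unfolding pure_cubic_field_iff by blast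
    hence "pure_cubic_iso `` {K} = pure_cubic_iso `` {cbrt_field (a * b ^ 2)}"
      using pc[OF adm] field_isomorphic_sym[OF ab(1) iso] iso field_isomorphic_trans
      unfolding pure_cubic_iso_def by blast
    thus "c \<in> f ` {(a, b). admissible_pair a b \<and> P a b}"
      using K ab adm by (intro image_eqI[of _ _ "(a, b)"]) (auto simp: f_def)
  next
    fix c assume "c \<in> f ` {(a, b). admissible_pair a b \<and> P a b}"
    then obtain a b where ab: "admissible_pair a b" "P a b" "c = pure_cubic_iso `` {cbrt_field (a * b ^ 2)}"
      by (auto simp: f_def)
    have "cbrt_field (a * b ^ 2) \<in> S" using S params subfield_cbrt_field ab by blast
    thus "c \<in> S // pure_cubic_iso" unfolding ab(3) by (rule quotientI)
  qed
  moreover have "inj_on f {(a, b). admissible_pair a b \<and> P a b}"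
  proof (rule inj_onI, clarify)
    fix a b c d assume *: "admissible_pair a b" "admissible_pair c d" "f (a, b) = f (c, d)"
    have "cbrt_field (a * b ^ 2) \<in> f (a, b)"
      using pc[OF *(1)] field_isomorphic_refl by (auto simp: f_def pure_cubic_iso_def)
    hence "field_isomorphic (cbrt_field (c * d ^ 2)) (cbrt_field (a * b ^ 2))"
      unfolding *(3) by (auto simp: f_def pure_cubic_iso_def)
    thus "a = c \<and> b = d" by (rule cbrt_field_isomorphic_imp_eq[OF *(1,2)])
  qed
  ultimately show ?thesis by (simp add: card_image)
qed

section \<open>Algebraic integers\<close>

text \<open>If \<open>n\<close> is the denominator of \<open>r\<close>, all powers
  \<open>n ^ k\<close> divide \<open>D\<close>; for \<open>n \<ge> 2\<close> the choice
  \<open>k = D\<close> would give \<open>2 ^ D \<le> D\<close>.\<close>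

lemma Ints_if_bounded_denominators:
  fixes r :: rat
  assumes D: "D > 0" and int: "\<And>k. of_nat D * r ^ k \<in> \<int>"
  shows "r \<in> \<int>"
proof -
  obtain m n where q: "quotient_of r = (m, n)" by fastforce
  hence r: "r = of_int m / of_int n" "n > 0" "coprime m n"
    by (auto intro: quotient_of_div quotient_of_denom_pos quotient_of_coprime)
  have dvd: "n ^ k dvd int D" for k
  proof -
    obtain t where t: "of_nat D * r ^ k = of_int t" using int[of k] by (auto elim: Ints_cases)
    have "(of_int (int D * m ^ k) :: rat) = of_int (t * n ^ k)"
      using t r(2) unfolding r(1) by (simp add: power_divide divide_eq_eq)
    hence "int D * m ^ k = t * n ^ k" by (simp only: of_int_eq_iff)
    hence "n ^ k dvd int D * m ^ k" by simp
    moreover have "coprime (n ^ k) (m ^ k)" using r(3) by (simp add: coprime_commute)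
    ultimately show ?thesis by (simp add: coprime_dvd_mult_left_iff)
  qed
  have "n = 1"
  proof (rule ccontr)
    assume "n \<noteq> 1"
    hence "2 \<le> n" using r(2) by simp
    hence "2 ^ D \<le> n ^ D" by (intro power_mono) auto
    also have "\<dots> \<le> int D" using dvd[of D] D by (intro zdvd_imp_le) auto
    also have "int D < 2 ^ D" by (metis of_nat_less_two_power)
    finally show False by simp
  qed
  thus ?thesis using r(1) by simp
qed

section \<open>Integral norms from denominators of powers\<close>

context pure_cubic
begin

definition lattice_el :: "complex \<Rightarrow> bool" where
  "lattice_el w \<longleftrightarrow> (\<exists>i j l. w = el (of_int i) (of_int j) (of_int l))"

lemma lattice_el_el [intro, simp]: "lattice_el (el (of_int i) (of_int j) (of_int l))"
  by (auto simp: lattice_el_def)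

lemma lattice_el_closed:
  "lattice_el w \<Longrightarrow> lattice_el w' \<Longrightarrow> lattice_el (w + w')"
  "lattice_el w \<Longrightarrow> lattice_el w' \<Longrightarrow> lattice_el (w * w')"
  "lattice_el w \<Longrightarrow> lattice_el (- w)" "lattice_el (of_int k)" "lattice_el (of_nat m)" "lattice_el 0" "lattice_el 1"
  "lattice_el w \<Longrightarrow> lattice_el (w ^ n)"
proof -
  show add: "lattice_el (w + w')" if "lattice_el w" "lattice_el w'" for w w'
    using that by (auto simp: lattice_el_def el_add simp flip: of_int_add)
  show mult: "lattice_el (w * w')" if w: "lattice_el w" "lattice_el w'" for w w'
  proof -
    obtain i j l i' j' l' where e: "w = el (of_int i) (of_int j) (of_int l)" "w' = el (of_int i') (of_int j') (of_int l')"
      using w by (auto simp: lattice_el_def)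
    have "w * w' = el (of_int (i * i' + int (a * b) * (j * l' + l * j')))
       (of_int (i * j' + j * i' + int a * l * l')) (of_int (i * l' + l * i' + int b * j * j'))"
      unfolding e el_mult by simp
    thus ?thesis by (simp only: lattice_el_el)
  qed
  show "lattice_el (- w)" if "lattice_el w"
    using that by (auto simp: lattice_el_def el_uminus simp flip: of_int_minus)
  have c: "lattice_el (of_int k)" for k
    using lattice_el_el[of k 0 0] by (simp add: el_rat)
  show "lattice_el (of_int k)" by (rule c)
  show "lattice_el (of_nat m)" "lattice_el 0" and one: "lattice_el 1" using c[of "int m"] c[of 0] c[of 1] by simp_all
  show "lattice_el (w ^ n)" if "lattice_el w"
    by (induction n) (auto intro: mult that one)
qed

lemma lattice_el_sum: "(\<And>i. i \<in> A \<Longrightarrow> lattice_el (f i)) \<Longrightarrow> lattice_el (sum f A)"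
  by (induction A rule: infinite_finite_induct) (auto intro: lattice_el_closed)

text \<open>
  A workable substitute for integrality: the powers of \<open>w\<close> have a common denominator. Unlike
  integrality, this is visibly stable under adding lattice elements.
\<close>

definition bounded_powers :: "complex \<Rightarrow> bool" where
  "bounded_powers w \<longleftrightarrow> (\<exists>D::nat. D > 0 \<and> (\<forall>k. lattice_el (of_nat D * w ^ k)))"

text \<open>A monic integral equation of degree \<open>n\<close> expresses higher powers of
  \<open>w\<close> through the first \<open>n\<close>, so a common denominator of those serves for
  all. If \<open>D\<close> clears \<open>w\<close>, then \<open>D ^ n\<close> does this.\<close>

lemma algebraic_int_bounded_powers:
  assumes "w \<in> K" "algebraic_int w"
  shows "bounded_powers w"
proof -
  obtain p :: "complex poly" where p: "Polynomial.lead_coeff p = 1" "\<And>i. poly.coeff p i \<in> \<int>" "poly p w = 0"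
    using assms(2) by (auto simp: algebraic_int.simps)
  define n where "n = Polynomial.degree p"
  define c where "c = (\<lambda>i. \<lfloor>Re (poly.coeff p i)\<rfloor>)"
  have c: "poly.coeff p i = of_int (c i)" for i using p(2)[of i] by (auto simp: c_def elim!: Ints_cases)
  have "w ^ n + (\<Sum>i<n. of_int (c i) * w ^ i) = poly p w"
    unfolding poly_altdef n_def lessThan_Suc_atMost[symmetric] sum.lessThan_Suc p(1)
    by (simp add: c)
  hence wn: "w ^ n = - (\<Sum>i<n. of_int (c i) * w ^ i)" using p(3) by (simp add: eq_neg_iff_add_eq_0)
  obtain x y z where w: "w = el x y z" using assms(1) by (auto simp: K_def)
  obtain i j l d where d: "d > 0" "x = of_int i / of_int d" "y = of_int j / of_int d" "z = of_int l / of_int d"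
    by (rule rat_triple_common_denominator[of x y z], rule that) blast+
  define D where "D = nat d"
  have D: "D > 0" "of_int d = (of_nat D :: rat)" using d(1) by (simp_all add: D_def)
  have "of_nat D * w = of_rat (of_nat D) * w" by simp
  also have "\<dots> = el (of_int i) (of_int j) (of_int l)"
    unfolding w el_scale d(2-4) D(2) using D(1) by simp
  finally have Dw: "lattice_el (of_nat D * w)" by simp
  have "lattice_el (of_nat (D ^ n) * w ^ k)" for k
  proof (induction k rule: less_induct)
    case (less k)
    show ?case
    proof (cases "k < n")
      case True
      hence "of_nat (D ^ n) * w ^ k = of_nat (D ^ (n - k)) * (of_nat D * w) ^ k"
        by (simp add: power_mult_distrib flip: power_add mult.assoc)
      thus ?thesis using lattice_el_closed Dw by simp
    next
      case False
      have "of_nat (D ^ n) * w ^ k = of_nat (D ^ n) * (w ^ (k - n) * w ^ n)"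
        using False by (simp flip: power_add)
      also have "\<dots> = - (\<Sum>i<n. of_int (c i) * (of_nat (D ^ n) * w ^ (k - n + i)))"
        unfolding wn by (simp add: sum_distrib_left power_add mult_ac)
      also have "lattice_el \<dots>"
        using False by (intro lattice_el_closed(3) lattice_el_sum lattice_el_closed(2)[OF lattice_el_closed(4)] less.IH) auto
      finally show ?thesis .
    qed
  qed
  thus ?thesis unfolding bounded_powers_def using D(1) by (intro exI[of _ "D ^ n"]) auto
qed

lemma bounded_powers_add_lattice:
  assumes "bounded_powers w" "lattice_el v"
  shows "bounded_powers (w + v)"
proof -
  obtain D where D: "D > 0" "\<And>k. lattice_el (of_nat D * w ^ k)" using assms(1) by (auto simp: bounded_powers_def)
  have "lattice_el (of_nat D * (w + v) ^ k)" for k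
  proof -
    have "of_nat D * (w + v) ^ k = (\<Sum>i\<le>k. of_nat (k choose i) * ((of_nat D * w ^ i) * v ^ (k - i)))"
      by (simp add: binomial_ring sum_distrib_left mult_ac)
    also have "lattice_el \<dots>"
      by (intro lattice_el_sum lattice_el_closed(2) lattice_el_closed(5) D(2) lattice_el_closed(8) assms(2))
    finally show ?thesis .
  qed
  with D(1) show ?thesis unfolding bounded_powers_def by blast
qed

lemma nm_mult:
  "nm (x * x' + of_nat (a * b) * (y * z' + z * y')) (x * y' + y * x' + of_nat a * z * z') (x * z' + z * x' + of_nat b * y * y')
    = nm x y z * nm x' y' z'"
  unfolding nm_def norm_form_def by (simp add: algebra_simps power2_eq_square power3_eq_cube)

lemma el_power: "\<exists>x' y' z'. el x y z ^ k = el x' y' z' \<and> nm x' y' z' = nm x y z ^ k"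
proof (induction k)
  case 0
  have "nm 1 0 0 = 1" by (simp add: nm_def norm_form_def)
  moreover have "el 1 0 0 = 1" by (simp add: el_rat)
  ultimately show ?case by (metis power_0)
next
  case (Suc k)
  then obtain x' y' z' where *: "el x y z ^ k = el x' y' z'" "nm x' y' z' = nm x y z ^ k" by blast
  show ?case unfolding power_Suc * el_mult using nm_mult *(2) by metis
qed

text \<open>If \<open>D\<close> clears the coordinates of every power of an element, then
  \<open>D ^ 3\<close> clears every power of its norm, because the norm form is multiplicative and
  homogeneous of degree 3.\<close>

lemma bounded_powers_norm:
  assumes "bounded_powers (el x y z)"
  shows "nm x y z \<in> \<int>"
proof -
  obtain D where D: "D > 0" "\<And>k. lattice_el (of_nat D * el x y z ^ k)" using assms by (auto simp: bounded_powers_def)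
  have "of_nat (D ^ 3) * nm x y z ^ k \<in> \<int>" for k
  proof -
    obtain x' y' z' where *: "el x y z ^ k = el x' y' z'" "nm x' y' z' = nm x y z ^ k" using el_power by blast
    obtain i j l where "of_nat D * el x y z ^ k = el (of_int i) (of_int j) (of_int l)"
      using D(2)[of k] by (auto simp: lattice_el_def)
    hence "el (of_nat D * x') (of_nat D * y') (of_nat D * z') = el (of_int i) (of_int j) (of_int l)"
      unfolding * by (simp flip: el_scale)
    hence e: "of_nat D * x' = of_int i" "of_nat D * y' = of_int j" "of_nat D * z' = of_int l" by simp_all
    have "of_nat (D ^ 3) * nm x y z ^ k = nm (of_nat D * x') (of_nat D * y') (of_nat D * z')"
      unfolding *(2)[symmetric] by (simp add: nm_def norm_form_scale)
    also have "\<dots> = of_int (norm_form (int a) (int b) i j l)"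
      unfolding e by (simp add: nm_def norm_form_def)
    finally show ?thesis by simp
  qed
  thus ?thesis by (rule Ints_if_bounded_denominators[rotated]) (use D(1) in simp)
qed

text \<open>Up to sign, the three numbers are the coefficients of the characteristic polynomial:
  trace, second symmetric function and norm.\<close>

lemma algebraic_int_elI:
  assumes "3 * x \<in> \<int>" "3 * (x^2 - of_nat (a * b) * y * z) \<in> \<int>" "nm x y z \<in> \<int>"
  shows "algebraic_int (el x y z)"
proof -
  obtain s t n where stn: "3 * x = of_int s" "3 * (x^2 - of_nat (a * b) * y * z) = of_int t" "nm x y z = of_int n"
    using assms by (auto elim!: Ints_cases)
  define w where "w = el x y z"
  have "w * (w * w) + (of_rat (- (3 * x)) * (w * w) + (of_rat (3 * (x^2 - of_nat (a * b) * y * z)) * w + el (- nm x y z) 0 0)) = el 0 0 0"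
    unfolding w_def el_mult el_add el_scale
    by (intro arg_cong3[where f = el]) (simp_all add: nm_def norm_form_def algebra_simps power2_eq_square power3_eq_cube)
  hence "w * (w * w) - of_int s * (w * w) + of_int t * w - of_int n = 0"
    unfolding stn el_rat by (simp add: of_rat_minus algebra_simps)
  hence "poly [: - of_int n, of_int t, - of_int s, 1 :] w = 0" by (simp add: algebra_simps)
  moreover have "poly.coeff [: - of_int n, of_int t, - of_int s, 1 :] i \<in> (\<int> :: complex set)" for i
    by (simp add: coeff_pCons split: nat.split)
  ultimately show ?thesis unfolding algebraic_int.simps w_def[symmetric]
    by (intro exI[of _ "[: - of_int n, of_int t, - of_int s, 1 :]"] exI[of _ w]) auto
qed

section \<open>Integers of denominator 3 and an integral basis\<close>

definition wild :: bool where "wild \<longleftrightarrow> \<not> 3 dvd int a * int b \<and> 9 dvd int a ^ 2 - int b ^ 2"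

text \<open>Under \<open>wild\<close>, which \<open>wild_iff\<close> identifies with Type II,
  \<open>(1 + a \<theta> + b \<phi>) / 3\<close> is an additional integer. The value 1 in the other
  case lets \<beta>, \<theta>, \<phi> be an integral basis for both types.\<close>

definition \<beta> :: complex where
  "\<beta> = (if wild then el (1/3) (of_nat a / 3) (of_nat b / 3) else 1)"

text \<open>Adding a lattice element preserves bounded powers, so the norm form takes integral
  values at every integral translate of \<open>(x, y, z)\<close>. Combining these values supplies
  the hypotheses of \<open>norm_form_denominator\<close>.\<close>

lemma algebraic_int_el_cases:
  assumes "algebraic_int (el x y z)"
  shows "(x \<in> \<int> \<and> y \<in> \<int> \<and> z \<in> \<int>) \<or>
    wild \<and> (\<exists>i j l. x = of_int i / 3 \<and> y = of_int j / 3 \<and> z = of_int l / 3 \<and> 3 dvd i - int a * j \<and> 3 dvd i - int b * l)"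
proof -
  have bp: "bounded_powers (el x y z)" by (rule algebraic_int_bounded_powers) (use assms in auto)
  define A B :: rat where "A = of_nat a" and "B = of_nat b"
  have N: "norm_form A B (x + of_int i) (y + of_int j) (z + of_int l) \<in> \<int>" for i j l
    using bounded_powers_norm[of "x + of_int i" "y + of_int j" "z + of_int l"]
      bounded_powers_add_lattice[OF bp lattice_el_el[of i j l]]
    by (simp add: el_add nm_def A_def B_def)
  define f where "f = (\<lambda>i j l. norm_form A B (x + of_int i) (y + of_int j) (z + of_int l))"
  have f: "f i j l \<in> \<int>" for i j l unfolding f_def by (rule N)
  \<comment> \<open>mixed second differences of the norm form recover its coefficients without using conjugates\<close>
  have "f 1 0 0 + f 0 0 1 - f 1 0 1 - f 0 0 0 = 3 * A * B * y"
    "f 1 0 0 + f 0 1 0 - f 1 1 0 - f 0 0 0 = 3 * A * B * z"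
    "f 0 1 0 + f 0 0 1 - f 0 1 1 - f 0 0 0 = 3 * A * B * x"
    "f 1 0 0 - f (-1) 0 0 - 2 = 6 * (x^2 - A * B * y * z)"
    "f 0 0 0 = norm_form A B x y z"
    by (simp_all add: f_def norm_form_def algebra_simps power2_eq_square power3_eq_cube)
  hence I: "3 * A * B * y \<in> \<int>" "3 * A * B * z \<in> \<int>" "3 * A * B * x \<in> \<int>" "6 * (x^2 - A * B * y * z) \<in> \<int>" "norm_form A B x y z \<in> \<int>"
    using f by (metis Ints_add Ints_diff Ints_numeral)+
  obtain i j l d where d: "d > 0" "x = of_int i / of_int d" "y = of_int j / of_int d" "z = of_int l / of_int d"
    and prim: "\<And>p. nprime p \<Longrightarrow> p dvd i \<Longrightarrow> p dvd j \<Longrightarrow> p dvd l \<Longrightarrow> \<not> p dvd d"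
    by (rule rat_triple_common_denominator[of x y z], rule that) blast+
  have dvdI: "m dvd n" if "of_int n = of_int m * t" "t \<in> \<int>" for m n :: int and t :: rat
    using that by (metis Ints_cases dvd_triv_left of_int_eq_iff of_int_mult)
  have d0: "d \<noteq> 0" using d(1) by simp
  have "d dvd 3 * int a * int b * i" by (rule dvdI[OF _ I(3)]) (simp add: d A_def B_def d0)
  moreover have "d dvd 3 * int a * int b * j" by (rule dvdI[OF _ I(1)]) (simp add: d A_def B_def d0)
  moreover have "d dvd 3 * int a * int b * l" by (rule dvdI[OF _ I(2)]) (simp add: d A_def B_def d0)
  moreover have "d ^ 2 dvd 6 * (i ^ 2 - int a * int b * j * l)"
    by (rule dvdI[OF _ I(4)]) (simp add: d A_def B_def d0 field_simps power2_eq_square)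
  moreover have "d ^ 3 dvd norm_form (int a) (int b) i j l"
  proof (rule dvdI[OF _ I(5)])
    have "of_int (d ^ 3) * norm_form A B x y z = norm_form A B (of_int d * x) (of_int d * y) (of_int d * z)"
      by (simp add: norm_form_scale)
    thus "of_int (norm_form (int a) (int b) i j l) = of_int (d ^ 3) * norm_form A B x y z"
      using d0 by (simp add: d A_def B_def norm_form_def)
  qed
  ultimately have "d = 1 \<or> d = 3 \<and> \<not> 3 dvd int a * int b \<and> 9 dvd int a ^ 2 - int b ^ 2 \<and>
      3 dvd i - int a * j \<and> 3 dvd i - int b * l"
    using norm_form_denominator[of "int a" "int b" d i j l] prim d(1) coprime_ab squarefree_ab squarefree_int by simp
  thus ?thesis
  proof
    assume "d = 1"
    thus ?thesis using d by simp
  next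
    assume "d = 3 \<and> \<not> 3 dvd int a * int b \<and> 9 dvd int a ^ 2 - int b ^ 2 \<and>
      3 dvd i - int a * j \<and> 3 dvd i - int b * l"
    thus ?thesis using d unfolding wild_def by (metis of_int_numeral)
  qed
qed

lemma combination_el:
  "of_int u * \<beta> + of_int v * \<theta> + of_int w * \<phi> =
    (if wild then el (of_int u / 3) (of_int u * of_nat a / 3 + of_int v) (of_int u * of_nat b / 3 + of_int w)
     else el (of_int u) (of_int v) (of_int w))"
  by (simp add: \<beta>_def el_def of_rat_add of_rat_mult of_rat_divide algebra_simps)

lemma ring_of_integers_K:
  "ring_of_integers K = {of_int u * \<beta> + of_int v * \<theta> + of_int w * \<phi> | u v w. True}"
proof (intro equalityI subsetI)
  fix \<alpha> assume "\<alpha> \<in> ring_of_integers K"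
  then obtain x y z where \<alpha>: "\<alpha> = el x y z" "algebraic_int (el x y z)"
    by (auto simp: ring_of_integers_def K_def)
  from algebraic_int_el_cases[OF \<alpha>(2)]
  have "\<exists>u v w. el x y z = of_int u * \<beta> + of_int v * \<theta> + of_int w * \<phi>"
  proof
    assume "x \<in> \<int> \<and> y \<in> \<int> \<and> z \<in> \<int>"
    then obtain i j l where e: "x = of_int i" "y = of_int j" "z = of_int l" by (auto elim!: Ints_cases)
    show ?thesis
    proof (cases wild)
      case True
      \<comment> \<open>\<beta> has rational part 1/3, so its coefficient must be three times the
        rational part of the element. The other two coefficients compensate for what
        \<open>3 i \<beta>\<close> contributes at \<theta> and \<phi>.\<close>
      thus ?thesis unfolding combination_el e
        by (intro exI[of _ "3 * i"] exI[of _ "j - i * int a"] exI[of _ "l - i * int b"]) simp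
    next
      case False
      thus ?thesis unfolding combination_el e by auto
    qed
  next
    assume "wild \<and> (\<exists>i j l. x = of_int i / 3 \<and> y = of_int j / 3 \<and> z = of_int l / 3 \<and> 3 dvd i - int a * j \<and> 3 dvd i - int b * l)"
    then obtain i j l where wild and e: "x = of_int i / 3" "y = of_int j / 3" "z = of_int l / 3"
      and d: "3 dvd i - int a * j" "3 dvd i - int b * l" by blast
    \<comment> \<open>As \<open>a^2\<close> and \<open>b^2\<close> are 1 modulo 3, the congruences
      of \<open>i\<close> with \<open>a j\<close> and \<open>b l\<close> can be inverted:
      \<open>j\<close> is congruent to \<open>a i\<close> and \<open>l\<close> to
      \<open>b i\<close>.\<close>
    have "3 dvd int a ^ 2 - 1" "3 dvd int b ^ 2 - 1"
      using norm_form_type_II[of "int a" "int b"] \<open>wild\<close> by (simp_all add: wild_def)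
    have "j - i * int a = - (j * (int a ^ 2 - 1)) - int a * (i - int a * j)" "l - i * int b = - (l * (int b ^ 2 - 1)) - int b * (i - int b * l)"
      by (simp_all add: algebra_simps power2_eq_square)
    moreover have "3 dvd - (j * (int a ^ 2 - 1)) - int a * (i - int a * j)" "3 dvd - (l * (int b ^ 2 - 1)) - int b * (i - int b * l)"
      using d \<open>3 dvd int a ^ 2 - 1\<close> \<open>3 dvd int b ^ 2 - 1\<close> by (meson dvd_diff dvd_minus_iff dvd_mult)+
    ultimately obtain v w where vw: "j - i * int a = 3 * v" "l - i * int b = 3 * w" by (metis dvdE)
    have "(of_int j :: rat) = of_int i * of_nat a + 3 * of_int v" "(of_int l :: rat) = of_int i * of_nat b + 3 * of_int w"
      using arg_cong[OF vw(1), of "of_int :: _ \<Rightarrow> rat"] arg_cong[OF vw(2), of "of_int :: _ \<Rightarrow> rat"] by simp_all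
    thus ?thesis unfolding combination_el e using \<open>wild\<close>
      by (intro exI[of _ i] exI[of _ v] exI[of _ w]) (simp add: add_divide_distrib)
  qed
  thus "\<alpha> \<in> {of_int u * \<beta> + of_int v * \<theta> + of_int w * \<phi> | u v w. True}" using \<alpha>(1) by blast
next
  fix \<alpha> assume "\<alpha> \<in> {of_int u * \<beta> + of_int v * \<theta> + of_int w * \<phi> | u v w. True}"
  then obtain u v w where \<alpha>: "\<alpha> = of_int u * \<beta> + of_int v * \<theta> + of_int w * \<phi>" by blast
  have "algebraic_int \<alpha>"
  proof (cases wild)
    case False
    have "algebraic_int (el (of_int u) (of_int v) (of_int w))"
    proof (rule algebraic_int_elI)
      show "nm (of_int u) (of_int v) (of_int w) \<in> \<int>" by (simp add: nm_def norm_form_def)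
    qed auto
    thus ?thesis using False unfolding \<alpha> combination_el by simp
  next
    case True
    have "27 dvd 1 + int a^4 * int b^2 + int a^2 * int b^4 - 3 * int a^2 * int b^2" "3 dvd int a^2 - 1" "3 dvd int b^2 - 1"
      using norm_form_type_II[of "int a" "int b"] True by (simp_all add: wild_def)
    then obtain n s t where nst: "1 + int a^4 * int b^2 + int a^2 * int b^4 - 3 * int a^2 * int b^2 = 27 * n"
      "int a^2 - 1 = 3 * s" "int b^2 - 1 = 3 * t" by (metis dvdE)
    define A B :: rat where "A = of_nat a" and "B = of_nat b"
    define U V W :: rat where "U = of_int u" and "V = of_int v" and "W = of_int w"
    define x where "x = U / 3"
    have U: "U = 3 * x" by (simp add: x_def)
    have n: "1 + A^4 * B^2 + A^2 * B^4 - 3 * A^2 * B^2 = 27 * of_int n" and s: "A^2 = 1 + 3 * of_int s" and t: "B^2 = 1 + 3 * of_int t"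
      using arg_cong[OF nst(1), of "of_int :: _ \<Rightarrow> rat"] arg_cong[OF nst(2), of "of_int :: _ \<Rightarrow> rat"]
        arg_cong[OF nst(3), of "of_int :: _ \<Rightarrow> rat"] by (simp_all add: A_def B_def)
    have ints: "A \<in> \<int>" "B \<in> \<int>" "U \<in> \<int>" "V \<in> \<int>" "W \<in> \<int>" by (simp_all add: A_def B_def U_def V_def W_def)
    have "algebraic_int (el x (x * A + V) (x * B + W))"
    proof (rule algebraic_int_elI)
      \<comment> \<open>The only fraction that survives is \<open>3 * x^2 = U^2 / 3\<close>, and its
        cofactor \<open>1 - A^2 * B^2\<close> is a multiple of 3.\<close>
      have "3 * (x^2 - A * B * (x * A + V) * (x * B + W))
        = 3 * x^2 * (1 - A^2 * B^2) - A * B * (3 * x * A * W + 3 * x * B * V + 3 * V * W)"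
        by (simp add: algebra_simps power2_eq_square)
      also have "1 - A^2 * B^2 = 3 * (- of_int s - of_int t - 3 * of_int s * of_int t)" unfolding s t by (simp add: algebra_simps)
      also have "3 * x^2 * (3 * (- of_int s - of_int t - 3 * of_int s * of_int t)) - A * B * (3 * x * A * W + 3 * x * B * V + 3 * V * W)
        = U^2 * (- of_int s - of_int t - 3 * of_int s * of_int t) - A * B * (U * A * W + U * B * V + 3 * V * W)"
        unfolding U by (simp add: power2_eq_square)
      also have "\<dots> \<in> \<int>"
        using ints by (intro Ints_diff Ints_mult Ints_add Ints_power Ints_minus Ints_of_int Ints_numeral)
      finally show "3 * (x^2 - of_nat (a * b) * (x * A + V) * (x * B + W)) \<in> \<int>" by (simp add: A_def B_def)
      \<comment> \<open>Sorted by powers of \<open>x = U / 3\<close>: the coefficient of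
        \<open>x^3\<close> is the norm of \<open>3 \<beta>\<close>, a multiple of 27, and at
        \<open>x^2\<close> the factors \<open>A^2 - 1\<close> and \<open>B^2 - 1\<close> supply the
        missing 3.\<close>
      have "nm x (x * A + V) (x * B + W) = x^3 * (1 + A^4 * B^2 + A^2 * B^4 - 3 * A^2 * B^2)
         + 3 * x^2 * (A * B^2 * V * (A^2 - 1) + A^2 * B * W * (B^2 - 1)) + 3 * x * (A^2 * B^2 * V^2 + A^2 * B^2 * W^2 - A * B * V * W)
         + A * B^2 * V^3 + A^2 * B * W^3"
        unfolding nm_def norm_form_def A_def[symmetric] B_def[symmetric]
        by (simp add: algebra_simps power2_eq_square power3_eq_cube power4_eq_xxxx)
      also have "A^2 - 1 = 3 * of_int s" by (simp add: s)
      also have "B^2 - 1 = 3 * of_int t" by (simp add: t)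
      also have "x^3 * (1 + A^4 * B^2 + A^2 * B^4 - 3 * A^2 * B^2)
         + 3 * x^2 * (A * B^2 * V * (3 * of_int s) + A^2 * B * W * (3 * of_int t)) + 3 * x * (A^2 * B^2 * V^2 + A^2 * B^2 * W^2 - A * B * V * W)
         + A * B^2 * V^3 + A^2 * B * W^3 = U^3 * of_int n + U^2 * (A * B^2 * V * of_int s + A^2 * B * W * of_int t)
         + U * (A^2 * B^2 * V^2 + A^2 * B^2 * W^2 - A * B * V * W) + A * B^2 * V^3 + A^2 * B * W^3"
        unfolding n U by (simp add: algebra_simps power2_eq_square power3_eq_cube)
      also have "\<dots> \<in> \<int>" using ints by (intro Ints_diff Ints_mult Ints_add Ints_power Ints_of_int)
      finally show "nm x (x * A + V) (x * B + W) \<in> \<int>" .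
    qed (use ints U in simp)
    thus ?thesis using True unfolding \<alpha> combination_el by (simp add: A_def B_def U_def V_def W_def x_def)
  qed
  moreover have "\<alpha> \<in> K" unfolding \<alpha> combination_el by simp
  ultimately show "\<alpha> \<in> ring_of_integers K" by (simp add: ring_of_integers_def)
qed

end

section \<open>The discriminant\<close>

text \<open>This is \<open>tr (P Q) = tr (Q P)\<close> for multiplication by \<open>w\<close>, taken
  from \<open>B\<close>-coordinates to \<open>C\<close>-coordinates, and the change of basis back.
  It is needed because \<open>field_trace\<close> leaves the choice of basis open.\<close>

lemma trace_basis_independent:
  assumes B: "rat_complex.independent B" "finite B" and C: "rat_complex.independent C" "finite C"
    and span: "rat_complex.span B = V" "rat_complex.span C = V" and w: "\<And>x. x \<in> V \<Longrightarrow> w * x \<in> V"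
  shows "(\<Sum>b\<in>B. rat_complex.representation B (w * b) b) = (\<Sum>c\<in>C. rat_complex.representation C (w * c) c)"
proof -
  let ?rB = "rat_complex.representation B" and ?rC = "rat_complex.representation C"
  have BV: "b \<in> V" if "b \<in> B" for b using that rat_complex.span_base[of b B] span(1) by simp
  have CV: "c \<in> V" if "c \<in> C" for c using that rat_complex.span_base[of c C] span(2) by simp
  have repB: "(\<Sum>b\<in>B. of_rat (?rB x b) * b) = x" if "x \<in> V" for x
    using rat_complex.sum_representation_eq[OF B(1) _ B(2) subset_refl, of x] that span(1) by simp
  have repC: "(\<Sum>c\<in>C. of_rat (?rC x c) * c) = x" if "x \<in> V" for x
    using rat_complex.sum_representation_eq[OF C(1) _ C(2) subset_refl, of x] that span(2) by simp
  have scaleV: "of_rat q * x \<in> V" if "x \<in> V" for q x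
    using rat_complex.span_scale[of x B q] that span(1) by simp
  have linB: "?rB (\<Sum>i\<in>I. of_rat (g i) * h i) d = (\<Sum>i\<in>I. g i * ?rB (h i) d)" if "\<And>i. i \<in> I \<Longrightarrow> h i \<in> V" for I :: "complex set" and g h d
  proof -
    have "?rB (\<Sum>i\<in>I. of_rat (g i) * h i) = (\<lambda>b. \<Sum>i\<in>I. ?rB (of_rat (g i) * h i) b)"
      using that scaleV span(1) by (intro rat_complex.representation_sum[OF B(1)]) auto
    hence "?rB (\<Sum>i\<in>I. of_rat (g i) * h i) d = (\<Sum>i\<in>I. ?rB (of_rat (g i) * h i) d)" by simp
    also have "(\<Sum>i\<in>I. ?rB (of_rat (g i) * h i) d) = (\<Sum>i\<in>I. g i * ?rB (h i) d)"
      using that span(1) by (intro sum.cong) (simp_all add: rat_complex.representation_scale[OF B(1)])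
    finally show ?thesis .
  qed
  have linC: "?rC (\<Sum>i\<in>I. of_rat (g i) * h i) d = (\<Sum>i\<in>I. g i * ?rC (h i) d)" if "\<And>i. i \<in> I \<Longrightarrow> h i \<in> V" for I :: "complex set" and g h d
  proof -
    have "?rC (\<Sum>i\<in>I. of_rat (g i) * h i) = (\<lambda>b. \<Sum>i\<in>I. ?rC (of_rat (g i) * h i) b)"
      using that scaleV span by (intro rat_complex.representation_sum[OF C(1)]) auto
    hence "?rC (\<Sum>i\<in>I. of_rat (g i) * h i) d = (\<Sum>i\<in>I. ?rC (of_rat (g i) * h i) d)" by simp
    also have "(\<Sum>i\<in>I. ?rC (of_rat (g i) * h i) d) = (\<Sum>i\<in>I. g i * ?rC (h i) d)"
      using that span by (intro sum.cong) (simp_all add: rat_complex.representation_scale[OF C(1)])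
    finally show ?thesis .
  qed
  have "(\<Sum>b\<in>B. ?rB (w * b) b) = (\<Sum>b\<in>B. \<Sum>c\<in>C. ?rC (w * b) c * ?rB c b)"
  proof (rule sum.cong)
    fix b assume "b \<in> B"
    thus "?rB (w * b) b = (\<Sum>c\<in>C. ?rC (w * b) c * ?rB c b)"
      using linB[of C "\<lambda>c. c" "?rC (w * b)" b] CV repC[OF w[OF BV]] by simp
  qed simp
  also have "\<dots> = (\<Sum>c\<in>C. \<Sum>b\<in>B. ?rC (w * b) c * ?rB c b)" by (rule sum.swap)
  also have "\<dots> = (\<Sum>c\<in>C. ?rC (w * c) c)"
  proof (rule sum.cong)
    fix c assume c: "c \<in> C"
    have "w * c = w * (\<Sum>b\<in>B. of_rat (?rB c b) * b)" using repB[OF CV[OF c]] by simp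
    also have "\<dots> = (\<Sum>b\<in>B. of_rat (?rB c b) * (w * b))" by (simp add: sum_distrib_left mult.left_commute)
    finally have "?rC (w * c) c = (\<Sum>b\<in>B. ?rB c b * ?rC (w * b) c)"
      using linC[of B "\<lambda>b. w * b" "?rB c" c] w BV by simp
    thus "(\<Sum>b\<in>B. ?rC (w * b) c * ?rB c b) = ?rC (w * c) c" by (simp add: mult.commute)
  qed simp
  finally show ?thesis .
qed

lemma det_mat_2: "Determinant.det (Matrix.mat 2 2 f) = f (0, 0) * f (1, 1) - f (0, 1) * f (1, 0 :: nat)"
  for f :: "nat \<times> nat \<Rightarrow> rat"
proof -
  let ?A = "Matrix.mat 2 2 f"
  have d: "mat_delete ?A 0 j = Matrix.mat 1 1 (\<lambda>_. f (1, 1 - j))" if "j < 2" for j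
    using that by (intro eq_matI) (auto simp: mat_delete_def)
  have "Determinant.det ?A = (\<Sum>j<2. ?A $$ (0, j) * cofactor ?A 0 j)"
    by (rule laplace_expansion_row) auto
  also have "{..<2} = {0, 1 :: nat}" by auto
  finally show ?thesis by (simp add: cofactor_def d det_single)
qed

lemma det_mat_3:
  fixes f :: "nat \<times> nat \<Rightarrow> rat"
  shows "Determinant.det (Matrix.mat 3 3 f) =
    f (0, 0) * (f (1, 1) * f (2, 2) - f (1, 2) * f (2, 1)) - f (0, 1) * (f (1, 0) * f (2, 2) - f (1, 2) * f (2, 0))
    + f (0, 2) * (f (1, 0) * f (2, 1) - f (1, 1) * f (2, 0))"
proof -
  let ?A = "Matrix.mat 3 3 f"
  have d: "mat_delete ?A 0 j = Matrix.mat 2 2 (\<lambda>(i, k). f (Suc i, if k < j then k else Suc k))" if "j < 3" for j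
    using that by (intro eq_matI) (auto simp: mat_delete_def)
  have "Determinant.det ?A = (\<Sum>j<3. ?A $$ (0, j) * cofactor ?A 0 j)"
    by (rule laplace_expansion_row) auto
  also have "{..<3} = {0, 1, 2 :: nat}" by auto
  finally show ?thesis by (simp add: cofactor_def d det_mat_2) (simp add: numeral_2_eq_2 algebra_simps)
qed

section \<open>The trace form and its determinant on an integral basis\<close>

context pure_cubic
begin

lemma rational_basis_distinct: "1 \<noteq> \<theta>" "1 \<noteq> \<phi>" "\<theta> \<noteq> \<phi>"
proof -
  have 1: "el 1 0 0 = 1" by (simp add: el_rat)
  have "el 1 0 0 \<noteq> el 0 1 0" "el 1 0 0 \<noteq> el 0 0 1" "el 0 1 0 \<noteq> el 0 0 1" by simp_all
  thus "1 \<noteq> \<theta>" "1 \<noteq> \<phi>" "\<theta> \<noteq> \<phi>" unfolding 1 el_\<theta> el_\<phi> .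
qed

lemma sum_rational_basis: "(\<Sum>v\<in>{1, \<theta>, \<phi>}. of_rat (u v) * v) = el (u 1) (u \<theta>) (u \<phi>)"
  using rational_basis_distinct by (simp add: el_def)

lemma rational_basis:
  "rat_complex.independent {1, \<theta>, \<phi>}" "rat_complex.span {1, \<theta>, \<phi>} = K"
proof -
  show "rat_complex.independent {1, \<theta>, \<phi>}"
    by (subst rat_complex.dependent_finite) (auto simp: sum_rational_basis)
  have "rat_complex.span {1, \<theta>, \<phi>} = range (\<lambda>u. el (u 1) (u \<theta>) (u \<phi>))"
    by (subst rat_complex.span_finite) (simp_all add: sum_rational_basis)
  also have "\<dots> = K"
  proof (intro equalityI subsetI)
    fix w assume "w \<in> K"
    then obtain x y z where w: "w = el x y z" by (auto simp: K_def)
    show "w \<in> range (\<lambda>u. el (u 1) (u \<theta>) (u \<phi>))"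
      by (rule range_eqI[of _ _ "\<lambda>v. if v = 1 then x else if v = \<theta> then y else z"])
        (use rational_basis_distinct in \<open>auto simp: w\<close>)
  qed auto
  finally show "rat_complex.span {1, \<theta>, \<phi>} = K" .
qed

lemma representation_rational_basis:
  "rat_complex.representation {1, \<theta>, \<phi>} (el x y z) 1 = x"
  "rat_complex.representation {1, \<theta>, \<phi>} (el x y z) \<theta> = y"
  "rat_complex.representation {1, \<theta>, \<phi>} (el x y z) \<phi> = z"
proof -
  let ?r = "rat_complex.representation {1, \<theta>, \<phi>} (el x y z)"
  have "(\<Sum>v\<in>{1, \<theta>, \<phi>}. of_rat (?r v) * v) = el x y z"
    using rational_basis by (intro rat_complex.sum_representation_eq) auto
  thus "?r 1 = x" "?r \<theta> = y" "?r \<phi> = z" unfolding sum_rational_basis by simp_all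
qed

lemma field_trace_el: "field_trace K (el x y z) = 3 * x"
proof -
  let ?C = "{1, \<theta>, \<phi>}"
  define B where "B = (SOME B. rat_complex.independent B \<and> rat_complex.span B = K)"
  have B: "rat_complex.independent B" "rat_complex.span B = K"
    unfolding B_def using someI_ex[of "\<lambda>B. rat_complex.independent B \<and> rat_complex.span B = K"] rational_basis by blast+
  \<comment> \<open>Nothing is known of the basis behind \<open>SOME\<close> beyond its defining
    property; its finiteness comes from comparison with a spanning set of three elements.\<close>
  have "B \<subseteq> rat_complex.span ?C" unfolding rational_basis(2) B(2)[symmetric] by (rule rat_complex.span_superset)
  hence "finite B" using rat_complex.independent_span_bound[of ?C B] B(1) by simp
  have "field_trace K (el x y z) = (\<Sum>b\<in>B. rat_complex.representation B (el x y z * b) b)"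
    by (simp add: field_trace_def Let_def flip: B_def)
  also have "\<dots> = (\<Sum>c\<in>?C. rat_complex.representation ?C (el x y z * c) c)"
    by (rule trace_basis_independent[OF B(1) \<open>finite B\<close> rational_basis(1) _ B(2) rational_basis(2)])
      (auto simp: K_def el_mult)
  also have "\<dots> = rat_complex.representation ?C (el x y z * el 1 0 0) 1 + rat_complex.representation ?C (el x y z * el 0 1 0) \<theta>
     + rat_complex.representation ?C (el x y z * el 0 0 1) \<phi>"
    using rational_basis_distinct by (simp add: el_rat el_\<theta> el_\<phi>)
  also have "\<dots> = 3 * x" unfolding el_mult representation_rational_basis by simp
  finally show ?thesis .
qed

lemma field_trace_linear:
  assumes "finite I" "\<And>i. i \<in> I \<Longrightarrow> g i \<in> K"
  shows "(\<Sum>i\<in>I. of_rat (c i) * g i) \<in> K \<and>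
    field_trace K (\<Sum>i\<in>I. of_rat (c i) * g i) = (\<Sum>i\<in>I. c i * field_trace K (g i))"
  using assms
proof (induction I rule: finite_induct)
  case empty
  show ?case using field_trace_el[of 0 0 0] of_rat_in_K[of 0] by (simp add: el_def)
next
  case (insert j I)
  obtain x y z where 1: "g j = el x y z" using insert.prems[of j] by (auto simp: K_def)
  obtain x' y' z' where 2: "(\<Sum>i\<in>I. of_rat (c i) * g i) = el x' y' z'" using insert by (auto simp: K_def)
  have "field_trace K (el x' y' z') = (\<Sum>i\<in>I. c i * field_trace K (g i))" using insert 2 by auto
  thus ?case using insert.hyps by (simp add: 1 2 el_scale el_add field_trace_el)
qed

definition Z_basis :: "nat \<Rightarrow> complex" where
  "Z_basis k = (if k = 0 then \<beta> else if k = 1 then \<theta> else \<phi>)"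

lemma sum_Z_basis: "(\<Sum>k<3. of_int (u k) * Z_basis k) = of_int (u 0) * \<beta> + of_int (u 1) * \<theta> + of_int (u 2) * \<phi>"
proof -
  have "{..<3} = {0, 1, 2 :: nat}" by auto
  thus ?thesis by (simp add: Z_basis_def)
qed

lemma Z_basis_in_K: "Z_basis k \<in> K"
  using el_in_K[of 1 0 0] by (simp add: Z_basis_def \<beta>_def \<theta>_in_K \<phi>_in_K el_rat)

lemma Z_basis_unique:
  assumes "(\<Sum>k<3. of_int (u k) * Z_basis k) = (\<Sum>k<3. of_int (v k) * Z_basis k)" "k < 3"
  shows "u k = v k"
proof -
  have "u 0 = v 0 \<and> u 1 = v 1 \<and> u 2 = v 2"
    using assms(1) unfolding sum_Z_basis combination_el by (auto split: if_splits)
  moreover have "k = 0 \<or> k = 1 \<or> k = 2" using assms(2) by auto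
  ultimately show ?thesis by blast
qed

lemma ring_of_integers_Z_basis:
  "w \<in> ring_of_integers K \<longleftrightarrow> (\<exists>u. w = (\<Sum>k<3. of_int (u k) * Z_basis k))"
proof
  assume "w \<in> ring_of_integers K"
  then obtain i j l where w: "w = of_int i * \<beta> + of_int j * \<theta> + of_int l * \<phi>" unfolding ring_of_integers_K by blast
  show "\<exists>u. w = (\<Sum>k<3. of_int (u k) * Z_basis k)"
    by (rule exI[of _ "\<lambda>k. if k = 0 then i else if k = 1 then j else l"]) (simp add: sum_Z_basis w)
next
  assume "\<exists>u. w = (\<Sum>k<3. of_int (u k) * Z_basis k)"
  thus "w \<in> ring_of_integers K" unfolding ring_of_integers_K sum_Z_basis by blast
qed

lemma sum_set_nth:
  assumes "distinct bs"
  shows "(\<Sum>v\<in>set bs. f v) = (\<Sum>i<length bs. f (bs ! i))"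
  using sum.reindex_bij_betw[OF bij_betw_nth[OF assms refl refl], of f] by simp

lemma integral_basis_Z_basis: "integral_basis K (map Z_basis [0..<3])"
proof -
  let ?bs = "map Z_basis [0..<3]"
  have inj: "Z_basis j = Z_basis k \<Longrightarrow> j = k" if "j < 3" "k < 3" for j k
  proof -
    assume e: "Z_basis j = Z_basis k"
    have Zd: "Z_basis i = (\<Sum>k<3. of_int (if k = i then 1 else 0) * Z_basis k)" if "i < 3" for i
      using that by (simp add: if_distrib[of of_int] if_distrib[of "\<lambda>x. x * _"] sum.delta cong: if_cong)
    have "(\<Sum>i<3. of_int (if i = j then 1 else 0) * Z_basis i) = (\<Sum>i<3. of_int (if i = k then 1 else 0) * Z_basis i)"
      by (rule trans[OF Zd[OF that(1), symmetric] trans[OF e Zd[OF that(2)]]])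
    from Z_basis_unique[OF this that(1)] show "j = k" by (simp split: if_splits)
  qed
  have dist: "distinct ?bs" using inj by (auto simp: distinct_map inj_on_def)
  have sum: "(\<Sum>v\<in>set ?bs. of_int (u v) * v) = (\<Sum>k<3. of_int (u (Z_basis k)) * Z_basis k)" for u
    by (subst sum_set_nth[OF dist]) (auto intro!: sum.cong)
  show ?thesis unfolding integral_basis_def
  proof (intro conjI dist)
    show "int_complex.independent (set ?bs)"
    proof
      assume "int_complex.dependent (set ?bs)"
      then obtain u v where v: "v \<in> set ?bs" "u v \<noteq> 0" "(\<Sum>v\<in>set ?bs. of_int (u v) * v) = 0"
        by (subst (asm) int_complex.dependent_finite) auto
      obtain k where k: "k < 3" "v = Z_basis k" using v(1) by auto
      have "(\<Sum>k<3. of_int (u (Z_basis k)) * Z_basis k) = (\<Sum>k<3. of_int ((\<lambda>_. 0) k) * Z_basis k)"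
        using v(3) unfolding sum by simp
      from Z_basis_unique[OF this k(1)] show False using v(2) k(2) by simp
    qed
    have "int_complex.span (set ?bs) = range (\<lambda>u. \<Sum>v\<in>set ?bs. of_int (u v) * v)"
      by (rule int_complex.span_finite) (rule finite_set)
    also have "\<dots> = range (\<lambda>u. \<Sum>k<3. of_int (u (Z_basis k)) * Z_basis k)"
      by (simp only: sum)
    also have "\<dots> = ring_of_integers K"
    proof (intro equalityI subsetI)
      fix w assume "w \<in> ring_of_integers K"
      then obtain u where u: "w = (\<Sum>k<3. of_int (u k) * Z_basis k)" unfolding ring_of_integers_Z_basis by blast
      define u' where "u' = (\<lambda>v. u (THE k. k < 3 \<and> Z_basis k = v))"
      have "u' (Z_basis k) = u k" if "k < 3" for k
      proof -
        have "(THE j. j < 3 \<and> Z_basis j = Z_basis k) = k" using that inj by (intro the_equality) auto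
        thus ?thesis by (simp add: u'_def)
      qed
      hence "w = (\<Sum>k<3. of_int (u' (Z_basis k)) * Z_basis k)" unfolding u by (intro sum.cong) auto
      thus "w \<in> range (\<lambda>u. \<Sum>k<3. of_int (u (Z_basis k)) * Z_basis k)" by blast
    next
      fix w assume "w \<in> range (\<lambda>u. \<Sum>k<3. of_int (u (Z_basis k)) * Z_basis k)"
      then obtain u where "w = (\<Sum>k<3. of_int (u (Z_basis k)) * Z_basis k)" by blast
      thus "w \<in> ring_of_integers K" unfolding ring_of_integers_Z_basis by (rule exI[of _ "\<lambda>k. u (Z_basis k)"])
    qed
    finally show "int_complex.span (set ?bs) = ring_of_integers K" .
  qed
qed

text \<open>Two integral bases differ by an integer matrix \<open>P\<close> with an integer inverse,
  so the Gram matrix \<open>M\<close> of the trace form becomes \<open>P M P^T\<close> with the same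
  determinant.\<close>

lemma discriminant_of_integral_basis:
  assumes "integral_basis K bs"
  shows "Determinant.det (Matrix.mat (length bs) (length bs) (\<lambda>(i, j). field_trace K (bs ! i * bs ! j)))
    = Determinant.det (Matrix.mat 3 3 (\<lambda>(i, j). field_trace K (Z_basis i * Z_basis j)))"
proof -
  define n where "n = length bs"
  have bs: "distinct bs" "int_complex.independent (set bs)" "int_complex.span (set bs) = ring_of_integers K"
    using assms by (auto simp: integral_basis_def)
  have "\<forall>i. \<exists>u. i < n \<longrightarrow> bs ! i = (\<Sum>k<3. of_int (u k) * Z_basis k)"
    using int_complex.span_base[of _ "set bs"] nth_mem[of _ bs] unfolding bs(3) ring_of_integers_Z_basis n_def by blast
  then obtain P where P: "\<And>i. i < n \<Longrightarrow> bs ! i = (\<Sum>k<3. of_int (P i k) * Z_basis k)" by metis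
  have "\<exists>u. k < 3 \<longrightarrow> Z_basis k = (\<Sum>i<n. of_int (u i) * bs ! i)" for k
  proof (cases "k < 3")
    case True
    have "Z_basis k = (\<Sum>j<3. of_int (if j = k then 1 else 0) * Z_basis j)"
      using True by (simp add: if_distrib[of of_int] if_distrib[of "\<lambda>x. x * _"] sum.delta cong: if_cong)
    hence "Z_basis k \<in> int_complex.span (set bs)" unfolding bs(3) ring_of_integers_Z_basis
      by (rule exI[of _ "\<lambda>j. if j = k then 1 else 0"])
    then obtain u where "Z_basis k = (\<Sum>v\<in>set bs. of_int (u v) * v)"
      by (subst (asm) int_complex.span_finite) auto
    hence "Z_basis k = (\<Sum>i<n. of_int (u (bs ! i)) * bs ! i)" by (simp add: sum_set_nth[OF bs(1)] n_def)
    thus ?thesis by (intro exI[of _ "\<lambda>i. u (bs ! i)"]) simp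
  qed simp
  then obtain Q where Q: "\<And>k. k < 3 \<Longrightarrow> Z_basis k = (\<Sum>i<n. of_int (Q k i) * bs ! i)" by metis
  have bs_unique: "u i = v i" if e: "(\<Sum>i<n. of_int (u i) * bs ! i) = (\<Sum>i<n. of_int (v i) * bs ! i)" and i: "i < n" for u v i
  proof (rule ccontr)
    assume ne: "u i \<noteq> v i"
    \<comment> \<open>Independence speaks of coefficients attached to elements of
      \<open>set bs\<close>; as \<open>bs\<close> is distinct, coefficients attached to positions
      can be turned into such a function.\<close>
    define w where "w = (\<lambda>x. let j = (THE j. j < n \<and> bs ! j = x) in u j - v j)"
    have w: "w (bs ! j) = u j - v j" if "j < n" for j
    proof -
      have "(THE j'. j' < n \<and> bs ! j' = bs ! j) = j"
        using that bs(1) by (intro the_equality) (auto simp: n_def nth_eq_iff_index_eq)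
      thus ?thesis by (simp add: w_def Let_def)
    qed
    have "(\<Sum>x\<in>set bs. of_int (w x) * x) = (\<Sum>j<n. of_int (u j - v j) * bs ! j)"
      unfolding sum_set_nth[OF bs(1)] n_def[symmetric] by (intro sum.cong) (auto simp: w)
    also have "\<dots> = 0" using e by (simp add: left_diff_distrib sum_subtractf)
    finally have "int_complex.dependent (set bs)"
      using w[OF i] ne i nth_mem[of i bs] by (subst int_complex.dependent_finite) (auto simp: n_def intro!: exI[of _ w] bexI[of _ "bs ! i"])
    thus False using bs(2) by blast
  qed
  have QP: "(\<Sum>i<n. Q j i * P i k) = (if k = j then 1 else 0)" if "j < 3" "k < 3" for j k
  proof -
    have "(\<Sum>k<3. of_int (\<Sum>i<n. Q j i * P i k) * Z_basis k) = (\<Sum>i<n. of_int (Q j i) * (\<Sum>k<3. of_int (P i k) * Z_basis k))"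
      by (subst sum_distrib_left, subst sum.swap) (simp add: sum_distrib_right mult.assoc)
    also have "\<dots> = (\<Sum>i<n. of_int (Q j i) * bs ! i)" by (intro sum.cong) (simp_all add: P)
    also have "\<dots> = (\<Sum>k<3. of_int (if k = j then 1 else 0) * Z_basis k)"
      using Q that by (simp add: if_distrib[of of_int] if_distrib[of "\<lambda>x. x * _"] sum.delta cong: if_cong)
    finally show ?thesis by (rule Z_basis_unique[OF _ that(2)])
  qed
  have PQ: "(\<Sum>k<3. P i k * Q k j) = (if j = i then 1 else 0)" if "i < n" "j < n" for i j
  proof -
    have "(\<Sum>j<n. of_int (\<Sum>k<3. P i k * Q k j) * bs ! j) = (\<Sum>k<3. of_int (P i k) * (\<Sum>j<n. of_int (Q k j) * bs ! j))"
      by (subst sum_distrib_left, subst sum.swap) (simp add: sum_distrib_right mult.assoc)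
    also have "\<dots> = (\<Sum>k<3. of_int (P i k) * Z_basis k)" by (intro sum.cong) (simp_all add: Q)
    also have "\<dots> = (\<Sum>j<n. of_int (if j = i then 1 else 0) * bs ! j)"
      using P that by (simp add: if_distrib[of of_int] if_distrib[of "\<lambda>x. x * _"] sum.delta cong: if_cong)
    finally show ?thesis by (rule bs_unique[OF _ that(2)])
  qed
  \<comment> \<open>the traces of \<open>P Q = 1\<close> and \<open>Q P = 1\<close> agree, whence \<open>n = 3\<close>\<close>
  have "int n = (\<Sum>i<n. \<Sum>k<3. P i k * Q k i)" by (simp add: PQ)
  also have "\<dots> = (\<Sum>k<3. \<Sum>i<n. Q k i * P i k)" by (subst sum.swap) (simp add: mult.commute)
  also have "\<dots> = 3" by (simp add: QP)
  finally have n: "n = 3" by simp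
  define PM where "PM = Matrix.mat 3 3 (\<lambda>(i, k). P i k)"
  define QM where "QM = Matrix.mat 3 3 (\<lambda>(k, i). Q k i)"
  have "PM * QM = 1\<^sub>m 3"
    by (rule eq_matI) (use PQ n in \<open>auto simp: PM_def QM_def scalar_prod_def lessThan_atLeast0\<close>)
  hence "Determinant.det PM * Determinant.det QM = 1"
    using det_mult[of PM 3 QM] by (simp add: PM_def QM_def)
  \<comment> \<open>The determinant is a unit of the integers, and only its square enters the Gram
    determinant.\<close>
  hence "Determinant.det PM = 1 \<or> Determinant.det PM = -1" using pos_zmult_eq_1_iff_lemma zmult_eq_1_iff by metis
  hence detP: "Determinant.det PM * Determinant.det PM = 1" by auto
  define PR where "PR = Matrix.mat 3 3 (\<lambda>(i, k). of_int (P i k) :: rat)"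
  have "PR = map_mat of_int PM" by (rule eq_matI) (auto simp: PR_def PM_def)
  hence detPR: "Determinant.det PR * Determinant.det PR = 1"
    using detP by (metis of_int_hom.hom_det of_int_1 of_int_mult)
  let ?M = "Matrix.mat 3 3 (\<lambda>(i, j). field_trace K (Z_basis i * Z_basis j))"
  let ?N = "Matrix.mat 3 3 (\<lambda>(i, j). field_trace K (bs ! i * bs ! j))"
  have "?N = PR * (?M * transpose_mat PR)"
  proof (rule eq_matI)
    fix i j assume "i < dim_row (PR * (?M * transpose_mat PR))" "j < dim_col (PR * (?M * transpose_mat PR))"
    hence ij: "i < 3" "j < 3" by (simp_all add: PR_def)
    have "bs ! i * bs ! j = (\<Sum>k<3. of_rat (of_int (P i k)) * Z_basis k) * (\<Sum>l<3. of_rat (of_int (P j l)) * Z_basis l)"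
      using P ij n by simp
    also have "\<dots> = (\<Sum>k<3. \<Sum>l<3. (of_rat (of_int (P i k)) * Z_basis k) * (of_rat (of_int (P j l)) * Z_basis l))"
      by (rule sum_product)
    also have "\<dots> = (\<Sum>k<3. of_rat (of_int (P i k)) * (\<Sum>l<3. of_rat (of_int (P j l)) * (Z_basis k * Z_basis l)))"
      unfolding sum_distrib_left by (intro sum.cong refl) (simp add: mult_ac)
    finally have e: "bs ! i * bs ! j = \<dots>" .
    have ZK: "Z_basis k * Z_basis l \<in> K" for k l using Z_basis_in_K subfield_CC_closed(4)[OF subfield_K] by blast
    have inner: "(\<Sum>l<3. of_rat (of_int (P j l)) * (Z_basis k * Z_basis l)) \<in> K \<and>
        field_trace K (\<Sum>l<3. of_rat (of_int (P j l)) * (Z_basis k * Z_basis l))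
        = (\<Sum>l<3. of_int (P j l) * field_trace K (Z_basis k * Z_basis l))" for k
      by (rule field_trace_linear) (use ZK in auto)
    have "field_trace K (bs ! i * bs ! j) = (\<Sum>k<3. of_int (P i k) *
        field_trace K (\<Sum>l<3. of_rat (of_int (P j l)) * (Z_basis k * Z_basis l)))"
      unfolding e by (rule conjunct2[OF field_trace_linear]) (use inner in auto)
    also have "\<dots> = (\<Sum>k<3. of_int (P i k) * (\<Sum>l<3. of_int (P j l) * field_trace K (Z_basis k * Z_basis l)))"
      by (intro sum.cong refl) (simp only: conjunct2[OF inner])
    finally have tr: "field_trace K (bs ! i * bs ! j) = (\<Sum>k<3. of_int (P i k) * (\<Sum>l<3. of_int (P j l) * field_trace K (Z_basis k * Z_basis l)))" .
    thus "?N $$ (i, j) = (PR * (?M * transpose_mat PR)) $$ (i, j)"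
      using ij tr by (simp add: PR_def scalar_prod_def lessThan_atLeast0 mult.commute)
  qed (simp_all add: PR_def)
  moreover have car: "PR \<in> carrier_mat 3 3" "?M \<in> carrier_mat 3 3" "transpose_mat PR \<in> carrier_mat 3 3"
    by (simp_all add: PR_def)
  ultimately have "Determinant.det ?N = Determinant.det PR * (Determinant.det ?M * Determinant.det PR)"
    using det_mult[OF car(1) mult_carrier_mat[OF car(2,3)]] det_mult[OF car(2,3)] det_transpose[OF car(1)] by metis
  also have "\<dots> = Determinant.det ?M" using detPR by (simp add: mult.left_commute)
  finally show ?thesis using n by (simp add: n_def)
qed

text \<open>Among the products of 1, \<theta>, \<phi> only \<open>1\<close> and
  \<open>\<theta> * \<phi> = a * b\<close> have non-zero trace, which gives
  \<open>-27 (a b)^2\<close> for the lattice they span. Under \<open>wild\<close> the integers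
  contain this lattice with index 3, so the determinant is divided by 9.\<close>

theorem discriminant_K: "discriminant K = (if wild then - 3 * of_nat (a * b) ^ 2 else - 27 * of_nat (a * b) ^ 2)"
proof -
  define bs where "bs = (SOME bs. integral_basis K bs)"
  have "integral_basis K bs" unfolding bs_def using integral_basis_Z_basis by (rule someI)
  hence "discriminant K = Determinant.det (Matrix.mat 3 3 (\<lambda>(i, j). field_trace K (Z_basis i * Z_basis j)))"
    using discriminant_of_integral_basis by (simp add: discriminant_def Let_def flip: bs_def)
  also have "\<dots> = (if wild then - 3 * of_nat (a * b) ^ 2 else - 27 * of_nat (a * b) ^ 2)"
  proof -
    have \<beta>: "\<beta> = (if wild then el (1/3) (of_nat a / 3) (of_nat b / 3) else el 1 0 0)" by (simp add: \<beta>_def el_rat)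
    have Z: "Z_basis 0 = \<beta>" "Z_basis 1 = el 0 1 0" "Z_basis (Suc 0) = el 0 1 0" "Z_basis 2 = el 0 0 1"
      by (simp_all add: Z_basis_def el_\<theta> el_\<phi>)
    show ?thesis unfolding det_mat_3 prod.case Z \<beta>
      by (cases wild) (simp_all add: el_mult field_trace_el field_simps power2_eq_square)
  qed
  finally show ?thesis .
qed

end

text \<open>3 cannot divide both \<open>a - b\<close> and \<open>a + b\<close> without dividing
  \<open>a\<close>, so 9 divides their product only by dividing one of them.\<close>

lemma (in pure_cubic) wild_iff: "wild \<longleftrightarrow> type_II_pair a b"
proof
  assume w: wild
  hence n: "\<not> 3 dvd int a * int b" and "9 dvd int a ^ 2 - int b ^ 2" by (auto simp: wild_def)
  moreover have "int a ^ 2 - int b ^ 2 = (int a - int b) * (int a + int b)" by (simp add: power2_eq_square algebra_simps)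
  ultimately have d: "9 dvd (int a - int b) * (int a + int b)" by simp
  have "\<not> (3 dvd int a - int b \<and> 3 dvd int a + int b)"
  proof
    assume "3 dvd int a - int b \<and> 3 dvd int a + int b"
    hence "3 dvd int a" by presburger
    with n show False by simp
  qed
  hence "9 dvd int a - int b \<or> 9 dvd int a + int b"
  proof -
    assume *: "\<not> (3 dvd int a - int b \<and> 3 dvd int a + int b)"
    have co: "coprime 9 x" if "\<not> 3 dvd x" for x :: int
    proof -
      have "coprime (3 ^ 2) x" using that by (subst coprime_power_left_iff) (simp add: prime_imp_coprime)
      thus ?thesis by simp
    qed
    show ?thesis using * d co coprime_dvd_mult_left_iff coprime_dvd_mult_right_iff by metis
  qed
  moreover have "\<not> 3 dvd a * b" using n by (metis int_dvd_int_iff of_nat_mult of_nat_numeral)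
  ultimately show "type_II_pair a b" by (simp add: type_II_pair_def)
next
  assume "type_II_pair a b"
  hence n: "\<not> 3 dvd a * b" and "9 dvd int a - int b \<or> 9 dvd int a + int b" by (auto simp: type_II_pair_def)
  moreover have "int a ^ 2 - int b ^ 2 = (int a - int b) * (int a + int b)" by (simp add: power2_eq_square algebra_simps)
  moreover have "\<not> 3 dvd int a * int b" using n by (metis int_dvd_int_iff of_nat_mult of_nat_numeral)
  ultimately show wild unfolding wild_def by auto
qed

theorem discriminant_eq:
  assumes K: "subfield K CC" "cubic_params K a b"
  shows "discriminant K = (if type_II_pair a b then - 3 * of_nat (a * b) ^ 2 else - 27 * of_nat (a * b) ^ 2)"
proof -
  have ab: "admissible_pair a b" and iso: "field_isomorphic K (cbrt_field (a * b ^ 2))"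
    using K(2) by (auto simp: cubic_params_iff)
  interpret R: pure_cubic a b "complex_of_real (root 3 (real (a * b ^ 2)))"
    by (rule admissible_pair_pure_cubic[OF ab])
  obtain \<theta>' where "pure_cubic a b \<theta>'" and K': "pure_cubic.K b \<theta>' = K"
    using R.isomorphic_copy[OF K(1)] iso unfolding admissible_pair_cbrt_field[OF ab] by blast
  then interpret M: pure_cubic a b \<theta>' by simp
  show ?thesis using M.discriminant_K M.wild_iff K' by simp
qed

section \<open>Lattice points in residue classes\<close>

lemma card_int_open_interval:
  fixes u v :: real
  assumes "u \<le> v"
  shows "\<bar>real (card {k::int. u < k \<and> k < v}) - (v - u)\<bar> \<le> 1"
proof -
  have "{k::int. u < k \<and> k < v} = {\<lfloor>u\<rfloor> + 1..\<lceil>v\<rceil> - 1}"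
    by (auto simp: floor_less_iff less_ceiling_iff) linarith+
  \<comment> \<open>The value -1 occurs when \<open>u = v\<close> is an integer; \<open>nat\<close>
    truncates it to 0, so this case is kept apart.\<close>
  moreover have "0 \<le> \<lceil>v\<rceil> - 1 - \<lfloor>u\<rfloor> \<or> \<lceil>v\<rceil> - 1 - \<lfloor>u\<rfloor> = -1"
    using assms by linarith
  moreover have "card {\<lfloor>u\<rfloor> + 1..\<lceil>v\<rceil> - 1} = nat (\<lceil>v\<rceil> - 1 - \<lfloor>u\<rfloor>)" by simp
  ultimately have "real (card {k::int. u < k \<and> k < v}) = \<lceil>v\<rceil> - 1 - \<lfloor>u\<rfloor>
    \<or> real (card {k::int. u < k \<and> k < v}) = 0 \<and> \<lceil>v\<rceil> - 1 - \<lfloor>u\<rfloor> = -1" by auto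
  thus ?thesis using assms by linarith
qed

lemma card_residue_open_interval:
  fixes u v :: real and q r :: nat
  assumes "0 \<le> u" "u \<le> v" "r < q"
  shows "\<bar>real (card {a::nat. u < real a \<and> real a < v \<and> a mod q = r}) - (v - u) / q\<bar> \<le> 1"
proof -
  define S where "S = {k::int. (u - r) / q < k \<and> k < (v - r) / q}"
  have q: "q > 0" using assms by simp
  have eq: "(u - r) / q < real_of_int k \<longleftrightarrow> u < r + q * real_of_int k"
    "real_of_int k < (v - r) / q \<longleftrightarrow> r + q * real_of_int k < v" for k
    using q by (auto simp: divide_less_eq less_divide_eq mult.commute)
  have "bij_betw (\<lambda>a. int (a div q)) {a::nat. u < real a \<and> real a < v \<and> a mod q = r} S"
  proof (rule bij_betwI[of _ _ _ "\<lambda>k. r + q * nat k"])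
    show "(\<lambda>a. int (a div q)) \<in> {a::nat. u < real a \<and> real a < v \<and> a mod q = r} \<rightarrow> S"
    proof
      fix a :: nat assume a: "a \<in> {a::nat. u < real a \<and> real a < v \<and> a mod q = r}"
      have "a = r + q * (a div q)" using a mult_div_mod_eq[of q a] by auto
      hence "real a = r + q * real_of_int (int (a div q))"
        by (metis of_int_of_nat_eq of_nat_add of_nat_mult)
      thus "int (a div q) \<in> S" using a unfolding S_def mem_Collect_eq eq by simp
    qed
    \<comment> \<open>The residue class consists of all \<open>r + q k\<close> with \<open>k\<close>
      an integer. As \<open>u\<close> is non-negative and \<open>r < q\<close>, only
      \<open>k > -1\<close> can occur, so nothing is lost by passing to natural numbers.\<close>
    have nn: "0 \<le> k" if "k \<in> S" for k
    proof -
      have "0 < r + q * real_of_int k" using that assms(1) unfolding S_def mem_Collect_eq eq by linarith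
      hence "0 < int r + int q * k" by (metis of_int_0_less_iff of_int_add of_int_mult of_int_of_nat_eq)
      hence "int q * (-1) < int q * k" using assms(3) by linarith
      thus ?thesis using q by (simp only: mult_less_cancel_left_pos of_nat_0_less_iff)
    qed
    show "(\<lambda>k. r + q * nat k) \<in> S \<rightarrow> {a::nat. u < real a \<and> real a < v \<and> a mod q = r}"
    proof
      fix k assume k: "k \<in> S"
      have "real (r + q * nat k) = r + q * real_of_int k" using nn[OF k] by simp
      thus "r + q * nat k \<in> {a::nat. u < real a \<and> real a < v \<and> a mod q = r}"
        using k assms(3) unfolding S_def mem_Collect_eq eq by simp
    qed
    show "r + q * nat (int (a div q)) = a" if "a \<in> {a::nat. u < real a \<and> real a < v \<and> a mod q = r}" for a
      using that mult_div_mod_eq[of q a] by auto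
    show "int ((r + q * nat k) div q) = k" if "k \<in> S" for k
      using nn[OF that] assms(3) q by simp
  qed
  hence "card {a::nat. u < real a \<and> real a < v \<and> a mod q = r} = card S" by (rule bij_betw_same_card)
  moreover have "(v - r) / q - (u - r) / q = (v - u) / q" by (simp add: diff_divide_distrib)
  moreover have "(u - r) / q \<le> (v - r) / q" using assms by (simp add: divide_right_mono)
  ultimately show ?thesis using card_int_open_interval[of "(u - r) / q" "(v - r) / q"] by (simp add: S_def)
qed

section \<open>Riemann sums of the fibre length\<close>

lemma lipschitz_riemann_sum:
  fixes f :: "real \<Rightarrow> real" and n :: nat and L c h :: real
  assumes lip: "\<And>x y. \<bar>f x - f y\<bar> \<le> L * \<bar>x - y\<bar>" and h: "h > 0"
  shows "\<bar>h * (\<Sum>k<n. f (c + k * h)) - integral {c..c + n * h} f\<bar> \<le> n * (L * h^2)"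
proof (induction n)
  case 0
  show ?case by simp
next
  case (Suc n)
  have "continuous_on UNIV f"
  proof (rule continuous_onI)
    fix x e :: real assume "e > 0"
    have L: "0 \<le> L" using lip[of 0 1] by simp
    show "\<exists>d>0. \<forall>y\<in>UNIV. dist y x < d \<longrightarrow> dist (f y) (f x) \<le> e"
    proof (intro exI[of _ "e / (L + 1)"] conjI ballI impI)
      show "0 < e / (L + 1)" using L \<open>e > 0\<close> by simp
      fix y assume "dist y x < e / (L + 1)"
      hence "(L + 1) * \<bar>y - x\<bar> < e" using L by (simp add: dist_real_def less_divide_eq mult.commute)
      moreover have "L * \<bar>y - x\<bar> \<le> (L + 1) * \<bar>y - x\<bar>" by (intro mult_right_mono) auto
      ultimately show "dist (f y) (f x) \<le> e" using lip[of y x] by (simp add: dist_real_def)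
    qed
  qed
  hence int: "f integrable_on {x..y}" for x y
    by (meson integrable_continuous_real continuous_on_subset subset_UNIV)
  define x where "x = c + n * h"
  have e: "c + Suc n * h = x + h" by (simp add: x_def algebra_simps)
  have "integral {c..x} f + integral {x..x + h} f = integral {c..x + h} f"
    using h by (intro Henstock_Kurzweil_Integration.integral_combine int) (auto simp: x_def)
  moreover have "\<bar>h * f x - integral {x..x + h} f\<bar> \<le> L * h^2"
  proof -
    have "((\<lambda>y. f x - f y) has_integral (h * f x - integral {x..x + h} f)) {x..x + h}"
      using has_integral_diff[OF has_integral_const_real[of "f x" x "x + h"] integrable_integral[OF int]] h by simp
    moreover have "0 \<le> L" using lip[of 0 1] by simp
    moreover have "norm (f x - f y) \<le> L * h" if "y \<in> {x..x + h}" for y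
    proof -
      have "L * \<bar>x - y\<bar> \<le> L * h" using that \<open>0 \<le> L\<close> by (intro mult_left_mono) auto
      thus ?thesis using lip[of x y] by simp
    qed
    ultimately have "norm (h * f x - integral {x..x + h} f) \<le> L * h * Henstock_Kurzweil_Integration.content {x..x + h}"
      using h by (intro has_integral_bound_real[of "L * h" "{}" "\<lambda>y. f x - f y"]) auto
    thus ?thesis using h by (simp add: power2_eq_square mult.assoc)
  qed
  ultimately show ?case using Suc unfolding e by (simp add: x_def algebra_simps)
qed

text \<open>
  The length of \<open>{s. R1 t < s < R2 t, s t < 1}\<close>. Since \<open>R2 t \<le> 1 / t\<close> up to \<open>t = 1 / sqrt R2\<close>, replacing
  \<open>1 / t\<close> below that point changes nothing and makes the function Lipschitz on the whole line.
\<close>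

definition fibre_length :: "real \<Rightarrow> real \<Rightarrow> real \<Rightarrow> real" where
  "fibre_length R1 R2 t = max 0 (min (R2 * t) (1 / max t (1 / sqrt R2)) - R1 * t)"

lemma fibre_length_lipschitz:
  assumes "1 \<le> R1" "R1 < R2"
  shows "\<bar>fibre_length R1 R2 x - fibre_length R1 R2 y\<bar> \<le> (R1 + R2) * \<bar>x - y\<bar>"
proof -
  let ?c = "1 / sqrt R2"
  have R2: "R2 > 0" using assms by simp
  have m: "\<bar>min u v - min u' v'\<bar> \<le> B" if "\<bar>u - u'\<bar> \<le> B" "\<bar>v - v'\<bar> \<le> B" for u v u' v' B :: real
    using that by linarith
  have "\<bar>R2 * x - R2 * y\<bar> \<le> R2 * \<bar>x - y\<bar>"
    using R2 by (simp add: abs_mult flip: right_diff_distrib)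
  moreover have "\<bar>1 / max x ?c - 1 / max y ?c\<bar> \<le> R2 * \<bar>x - y\<bar>"
  proof -
    define u v where "u = max x ?c" and "v = max y ?c"
    have c0: "?c > 0" using R2 by simp
    have uv: "u \<ge> ?c" "v \<ge> ?c" by (auto simp: u_def v_def)
    \<comment> \<open>Because of the cap only arguments of at least \<open>1 / sqrt R2\<close> are
      inverted, and there the slope of \<open>1 / t\<close> is at most \<open>R2\<close> in absolute
      value.\<close>
    have "1 / R2 = ?c * ?c" using R2 by simp
    also have "\<dots> \<le> u * v" using uv c0 by (intro mult_mono) linarith+
    finally have uv': "1 \<le> R2 * (u * v)" using R2 by (simp add: divide_le_eq mult.commute)
    have "u > 0" "v > 0" using uv c0 by linarith+
    hence "\<bar>1 / u - 1 / v\<bar> = \<bar>u - v\<bar> / (u * v)"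
      by (simp add: divide_simps abs_minus_commute abs_mult)
    also have "\<dots> \<le> R2 * \<bar>u - v\<bar>"
    proof -
      have "\<bar>u - v\<bar> * 1 \<le> \<bar>u - v\<bar> * (R2 * (u * v))" using uv' by (intro mult_left_mono) auto
      thus ?thesis using \<open>u > 0\<close> \<open>v > 0\<close> by (simp add: divide_le_eq mult_ac)
    qed
    also have "\<dots> \<le> R2 * \<bar>x - y\<bar>" using R2 by (intro mult_left_mono) (auto simp: u_def v_def)
    finally show ?thesis by (simp add: u_def v_def)
  qed
  ultimately have "\<bar>min (R2 * x) (1 / max x ?c) - min (R2 * y) (1 / max y ?c)\<bar> \<le> R2 * \<bar>x - y\<bar>"
    by (rule m)
  moreover have "\<bar>R1 * x - R1 * y\<bar> \<le> R1 * \<bar>x - y\<bar>"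
    using assms by (simp add: abs_mult flip: right_diff_distrib)
  moreover have "(R1 + R2) * \<bar>x - y\<bar> = R1 * \<bar>x - y\<bar> + R2 * \<bar>x - y\<bar>" by (simp add: algebra_simps)
  moreover have "\<bar>max 0 (u - v) - max 0 (u' - v')\<bar> \<le> A + B"
    if "\<bar>u - u'\<bar> \<le> B" "\<bar>v - v'\<bar> \<le> A" for u v u' v' A B :: real
    using that by linarith
  ultimately show ?thesis unfolding fibre_length_def by metis
qed

text \<open>The lines of slope \<open>R2\<close> and \<open>R1\<close> meet the hyperbola at
  \<open>c = 1 / sqrt R2\<close> and \<open>d = 1 / sqrt R1\<close>. Between these points the
  function is \<open>(R2 - R1) t\<close>, then \<open>1 / t - R1 t\<close>, then 0. The quadratic
  terms cancel because \<open>R2 c^2 = R1 d^2 = 1\<close>, leaving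
  \<open>ln d - ln c\<close>.\<close>

lemma integral_fibre_length:
  assumes "1 \<le> R1" "R1 < R2"
  shows "integral {0..1} (fibre_length R1 R2) = ln (R2 / R1) / 2"
proof -
  define c d where "c = 1 / sqrt R2" and "d = 1 / sqrt R1"
  have pos: "R1 > 0" "R2 > 0" using assms by auto
  have cd: "0 < c" "c < d" "d \<le> 1" using assms by (auto simp: c_def d_def frac_less2)
  have c2: "c^2 = 1 / R2" and d2: "d^2 = 1 / R1" using pos by (simp_all add: c_def d_def power_divide)
  have 1: "((\<lambda>t. (R2 - R1) * t) has_integral (R2 - R1) * c^2 / 2 - (R2 - R1) * 0^2 / 2) {0..c}"
    using cd by (intro fundamental_theorem_of_calculus)
      (auto intro!: derivative_eq_intros simp flip: has_real_derivative_iff_has_vector_derivative)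
  have 2: "((\<lambda>t. 1 / t - R1 * t) has_integral (ln d - R1 * d^2 / 2) - (ln c - R1 * c^2 / 2)) {c..d}"
    using cd by (intro fundamental_theorem_of_calculus)
      (auto intro!: derivative_eq_intros simp flip: has_real_derivative_iff_has_vector_derivative)
  have 3: "((\<lambda>t. 0 :: real) has_integral 0) {d..1}" by simp
  have fc: "fibre_length R1 R2 t = (R2 - R1) * t" if "t \<in> {0..c}" for t
  proof -
    have "R2 * t \<le> R2 * c" using that pos by (intro mult_left_mono) auto
    also have "R2 * c = 1 / c" using c2 cd pos by (simp add: field_simps power2_eq_square)
    finally have "min (R2 * t) (1 / max t c) = R2 * t" using that by (simp add: max_def)
    moreover have "R1 * t \<le> R2 * t" using that assms by (intro mult_right_mono) auto
    ultimately show ?thesis by (simp add: fibre_length_def algebra_simps flip: c_def)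
  qed
  have *: "min (R2 * t) (1 / max t c) = 1 / t" if "t \<ge> c" for t
  proof -
    have "1 / R2 = c * c" using c2 by (simp add: power2_eq_square)
    also have "\<dots> \<le> t * t" using that cd by (intro mult_mono) auto
    finally have "1 / t \<le> R2 * t" using pos that cd by (simp add: field_simps)
    thus ?thesis using that by (simp add: max_def)
  qed
  have sq: "1 / t - R1 * t \<ge> 0 \<longleftrightarrow> t \<le> d" if "t \<ge> c" for t
  proof -
    have t: "t > 0" using that cd by simp
    have "1 / t - R1 * t \<ge> 0 \<longleftrightarrow> t^2 \<le> d^2" unfolding d2 using t pos by (simp add: field_simps power2_eq_square)
    also have "\<dots> \<longleftrightarrow> t \<le> d" using t cd by (intro power_mono_iff) auto
    finally show ?thesis .
  qed
  have fd: "fibre_length R1 R2 t = 1 / t - R1 * t" if "t \<in> {c..d}" for t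
    using *[of t] sq[of t] that by (simp add: fibre_length_def flip: c_def)
  have f1: "fibre_length R1 R2 t = 0" if "t \<in> {d..1}" for t
  proof -
    have "1 / t - R1 * t \<le> 0"
    proof (cases "t = d")
      case True
      thus ?thesis using d2 cd pos by (simp add: field_simps power2_eq_square)
    next
      case False
      thus ?thesis using sq[of t] that cd by auto
    qed
    thus ?thesis using *[of t] that cd by (simp add: fibre_length_def flip: c_def)
  qed
  have "(fibre_length R1 R2 has_integral (R2 - R1) * c^2 / 2 - (R2 - R1) * 0^2 / 2) {0..c}"
    using 1 by (rule has_integral_eq[rotated]) (simp add: fc)
  moreover have "(fibre_length R1 R2 has_integral (ln d - R1 * d^2 / 2) - (ln c - R1 * c^2 / 2)) {c..d}"
    using 2 by (rule has_integral_eq[rotated]) (simp add: fd)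
  ultimately have "(fibre_length R1 R2 has_integral ((R2 - R1) * c^2 / 2 - (R2 - R1) * 0^2 / 2)
     + ((ln d - R1 * d^2 / 2) - (ln c - R1 * c^2 / 2))) {0..d}"
    using cd by (intro has_integral_combine[of 0 c d]) auto
  moreover have "(fibre_length R1 R2 has_integral 0) {d..1}"
    using 3 by (rule has_integral_eq[rotated]) (simp add: f1)
  ultimately have "(fibre_length R1 R2 has_integral (((R2 - R1) * c^2 / 2 - (R2 - R1) * 0^2 / 2)
     + ((ln d - R1 * d^2 / 2) - (ln c - R1 * c^2 / 2))) + 0) {0..1}"
    using cd by (intro has_integral_combine[of 0 d 1]) auto
  moreover have "(((R2 - R1) * c^2 / 2 - (R2 - R1) * 0^2 / 2) + ((ln d - R1 * d^2 / 2) - (ln c - R1 * c^2 / 2))) + 0 = ln d - ln c"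
    unfolding c2 d2 using pos by (simp add: field_simps)
  moreover have "ln d - ln c = ln (R2 / R1) / 2"
    using pos by (simp add: c_def d_def ln_div ln_sqrt field_simps)
  ultimately show ?thesis by (metis integral_unique)
qed

lemma fibre_length_eq_0:
  assumes "1 \<le> R1" "R1 < R2" "1 \<le> t"
  shows "fibre_length R1 R2 t = 0"
proof -
  have "1 / max t (1 / sqrt R2) \<le> 1" using assms by simp
  moreover have "1 * 1 \<le> R1 * t" using assms by (intro mult_mono) auto
  ultimately show ?thesis by (simp add: fibre_length_def)
qed

text \<open>The points \<open>b / T\<close> of the class form a progression of step
  \<open>q / T\<close> that starts at \<open>s / T\<close>. The Riemann sum contributes an error of
  at most \<open>2 (R1 + R2) q^2 / T\<close>, and the initial interval from 0 to
  \<open>s / T\<close> another \<open>(R1 + R2) q^2 / T\<close>.\<close>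

lemma fibre_length_riemann:
  fixes s q :: nat and R1 R2 T :: real
  assumes R: "1 \<le> R1" "R1 < R2" and s: "s < q" and T: "T \<ge> 1"
  shows "\<bar>q / T * (\<Sum>b | b \<le> nat \<lfloor>T\<rfloor> \<and> b mod q = s. fibre_length R1 R2 (b / T)) - ln (R2 / R1) / 2\<bar>
    \<le> 3 * (R1 + R2) * q^2 / T"
proof -
  let ?f = "fibre_length R1 R2" and ?L = "R1 + R2"
  note lip = fibre_length_lipschitz[OF R]
  \<comment> \<open>\<open>n\<close> is chosen so that the cells reach 1. Sample points and cells
    beyond 1 change neither the sum nor the integral, since the function vanishes there.\<close>
  define h c n where "h = q / T" and "c = s / T" and "n = nat \<lfloor>T\<rfloor> div q + 1"
  have q: "q \<ge> 1" and h: "h > 0" using s T by (auto simp: h_def)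
  have arg: "c + k * h = real (s + q * k) / T" for k :: nat by (simp add: c_def h_def add_divide_distrib)
  have L: "?L \<ge> 0" using R by simp
  have "(\<Sum>b | b \<le> nat \<lfloor>T\<rfloor> \<and> b mod q = s. ?f (b / T)) = (\<Sum>b\<in>(\<lambda>k. s + q * k) ` {..<n}. ?f (b / T))"
  proof (rule sum.mono_neutral_left)
    show "{b. b \<le> nat \<lfloor>T\<rfloor> \<and> b mod q = s} \<subseteq> (\<lambda>k. s + q * k) ` {..<n}"
    proof
      fix b assume b: "b \<in> {b. b \<le> nat \<lfloor>T\<rfloor> \<and> b mod q = s}"
      have "b = s + q * (b div q)" using b mult_div_mod_eq[of q b] by auto
      moreover have "b div q < n" using b by (simp add: n_def div_le_mono le_imp_less_Suc)
      ultimately show "b \<in> (\<lambda>k. s + q * k) ` {..<n}" by blast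
    qed
    show "\<forall>b\<in>(\<lambda>k. s + q * k) ` {..<n} - {b. b \<le> nat \<lfloor>T\<rfloor> \<and> b mod q = s}. ?f (b / T) = 0"
    proof
      fix b assume "b \<in> (\<lambda>k. s + q * k) ` {..<n} - {b. b \<le> nat \<lfloor>T\<rfloor> \<and> b mod q = s}"
      hence "b > nat \<lfloor>T\<rfloor>" using s by auto
      hence "real b \<ge> T" by linarith
      thus "?f (b / T) = 0" using T by (intro fibre_length_eq_0 R) simp
    qed
  qed simp
  also have "\<dots> = (\<Sum>k<n. ?f (c + k * h))"
    unfolding arg using q by (subst sum.reindex) (auto simp: inj_on_def)
  finally have sum: "(\<Sum>b | b \<le> nat \<lfloor>T\<rfloor> \<and> b mod q = s. ?f (b / T)) = (\<Sum>k<n. ?f (c + k * h))" .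
  have cont: "continuous_on UNIV ?f"
    unfolding fibre_length_def using R by (intro continuous_intros) (auto simp: max_def split: if_splits)
  hence int: "?f integrable_on {x..y}" for x y
    by (meson integrable_continuous_real continuous_on_subset subset_UNIV)
  have "nat \<lfloor>T\<rfloor> < q * n" using dividend_less_times_div[of q "nat \<lfloor>T\<rfloor>"] q by (simp add: n_def)
  hence "T \<le> real (s + q * n)" by linarith
  hence cn: "1 \<le> c + n * h" unfolding arg using T by simp
  have "q * n \<le> nat \<lfloor>T\<rfloor> + q" by (simp add: n_def)
  hence "real (q * n) \<le> T + q" using T by linarith
  hence "real q * real (q * n) \<le> q * (T + q)" by (intro mult_left_mono) auto
  also have "\<dots> \<le> 2 * q^2 * T"
  proof -
    have "q * T \<le> q^2 * T" "real q^2 \<le> q^2 * T" using q T by (auto simp: power2_eq_square)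
    thus ?thesis by (simp add: algebra_simps power2_eq_square)
  qed
  finally have "n * h^2 \<le> 2 * q^2 / T"
    unfolding h_def using T by (simp add: field_simps power2_eq_square)
  hence nh: "n * (?L * h^2) \<le> ?L * (2 * q^2 / T)"
    using mult_left_mono[OF \<open>n * h^2 \<le> 2 * q^2 / T\<close> L] by (simp add: mult_ac)
  have cle: "0 \<le> c" "c \<le> q^2 / T"
  proof -
    have "real s \<le> real q * 1" using s by simp
    also have "\<dots> \<le> real q * real q" using q by (intro mult_left_mono) auto
    finally show "c \<le> q^2 / T" using T by (simp add: c_def divide_right_mono power2_eq_square)
  qed (use T in \<open>simp add: c_def\<close>)
  have "integral {0..c + n * h} ?f = integral {0..1} ?f + integral {1..c + n * h} ?f"
    using cn by (intro Henstock_Kurzweil_Integration.integral_combine[symmetric] int) auto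
  also have "integral {1..c + n * h} ?f = integral {1..c + n * h} (\<lambda>_. 0)"
    by (intro Henstock_Kurzweil_Integration.integral_cong fibre_length_eq_0 R) simp
  finally have i1: "integral {0..c + n * h} ?f = ln (R2 / R1) / 2" using integral_fibre_length[OF R] by simp
  have i2: "integral {0..c} ?f + integral {c..c + n * h} ?f = integral {0..c + n * h} ?f"
    using cle h by (intro Henstock_Kurzweil_Integration.integral_combine int) auto
  have i3: "\<bar>integral {0..c} ?f\<bar> \<le> ?L * c"
  proof -
    have b: "norm (?f x) \<le> ?L" for x
    proof (cases "0 \<le> x \<and> x \<le> 1")
      case True
      have "\<bar>?f x - ?f 0\<bar> \<le> ?L * \<bar>x - 0\<bar>" by (rule lip)
      also have "\<dots> \<le> ?L * 1" using True L by (intro mult_left_mono) auto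
      finally show ?thesis by (simp add: fibre_length_def)
    next
      case False
      thus ?thesis
      proof (cases "x < 0")
        case True
        have "R2 * x \<le> R1 * x" using True R by (intro mult_right_mono_neg) auto
        thus ?thesis using L by (simp add: fibre_length_def)
      qed (use fibre_length_eq_0[OF R] L in auto)
    qed
    have "norm (integral {0..c} ?f) \<le> ?L * Henstock_Kurzweil_Integration.content {0..c}"
      using b L by (intro has_integral_bound_real[of ?L "{}", OF _ _ integrable_integral[OF int]]) auto
    thus ?thesis using cle by simp
  qed
  have "\<bar>h * (\<Sum>k<n. ?f (c + k * h)) - integral {c..c + n * h} ?f\<bar> \<le> n * (?L * h^2)"
    by (rule lipschitz_riemann_sum[OF lip h])
  moreover have "?L * c \<le> ?L * (q^2 / T)" using cle L by (intro mult_left_mono) auto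
  ultimately have "\<bar>h * (\<Sum>k<n. ?f (c + k * h)) - ln (R2 / R1) / 2\<bar> \<le> ?L * (2 * q^2 / T) + ?L * (q^2 / T)"
    using i1 i2 i3 nh by linarith
  also have "\<dots> = 3 * ?L * q^2 / T" by (simp add: divide_inverse algebra_simps)
  finally show ?thesis unfolding sum h_def .
qed

text \<open>\<open>T\<close> is a length: dividing both coordinates by \<open>T\<close> maps the
  region to a fixed one, of area \<open>ln (R2 / R1) / 2\<close>.\<close>

definition cone_pairs :: "real \<Rightarrow> real \<Rightarrow> real \<Rightarrow> (nat \<Rightarrow> nat \<Rightarrow> bool) \<Rightarrow> (nat \<times> nat) set" where
  "cone_pairs R1 R2 T P =
    {(a, b). 0 < b \<and> R1 * real b < real a \<and> real a < R2 * real b \<and> real a * real b < T ^ 2 \<and> P a b}"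

text \<open>\<open>R1 \<ge> 1\<close> gives \<open>b < a\<close>, hence
  \<open>b^2 < a b < T^2\<close>. The upper slope \<open>R2\<close> then bounds
  \<open>a\<close>.\<close>

lemma cone_pairs_bounds:
  fixes R1 R2 T :: real and a b :: nat
  assumes "1 \<le> R1" "R1 < R2" "T \<ge> 1" "(a, b) \<in> cone_pairs R1 R2 T P"
  shows "0 < a" "0 < b" "real b < T" "real a < R2 * T"
proof -
  have ab: "0 < b" "R1 * real b < real a" "real a < R2 * real b" "real a * real b < T ^ 2" using assms(4) by (auto simp: cone_pairs_def)
  have "1 * real b \<le> R1 * b" using assms(1) by (intro mult_right_mono) auto
  hence ba: "real b < a" using ab by linarith
  have "real b * real b < real a * real b" using ba ab by (intro mult_strict_right_mono) auto
  hence "real b ^ 2 < T ^ 2" unfolding power2_eq_square[of "real b"] using ab(4) by linarith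
  thus b: "real b < T" using assms(3) by (intro power_less_imp_less_base[of "real b" 2 T]) auto
  have "R2 * b \<le> R2 * T" using assms b by (intro mult_left_mono) auto
  thus "real a < R2 * T" using ab by linarith
  show "0 < a" "0 < b" using ab ba by auto
qed

lemma cone_pairs_subset:
  fixes R1 R2 T :: real
  assumes "1 \<le> R1" "R1 < R2" "T \<ge> 1"
  shows "cone_pairs R1 R2 T P \<subseteq> {1..nat \<lfloor>R2 * T\<rfloor>} \<times> {1..nat \<lfloor>T\<rfloor>}"
proof
  fix x assume x: "x \<in> cone_pairs R1 R2 T P"
  obtain a b where e: "x = (a, b)" by fastforce
  note b = cone_pairs_bounds[OF assms x[unfolded e]]
  have "a \<le> nat \<lfloor>R2 * T\<rfloor>" "b \<le> nat \<lfloor>T\<rfloor>" using b by linarith+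
  thus "x \<in> {1..nat \<lfloor>R2 * T\<rfloor>} \<times> {1..nat \<lfloor>T\<rfloor>}" using b e by simp
qed

lemma finite_cone_pairs:
  fixes R1 R2 T :: real
  assumes "1 \<le> R1" "R1 < R2" "T \<ge> 1"
  shows "finite (cone_pairs R1 R2 T P)"
  by (rule finite_subset[OF cone_pairs_subset[OF assms]]) simp

text \<open>At positive arguments the cap in \<open>fibre_length\<close> has no effect, since
  \<open>R2 t\<close> is the smaller term wherever the cap applies. The outer \<open>max\<close>
  keeps the right endpoint from falling below the left one when the fibre is empty.\<close>

lemma scaled_fibre_length:
  fixes b :: nat and R1 R2 T :: real
  assumes "1 \<le> R1" "R1 < R2" "T \<ge> 1" "b > 0"
  shows "T * fibre_length R1 R2 (b / T) = max (R1 * b) (min (R2 * b) (T ^ 2 / b)) - R1 * b"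
proof -
  define t where "t = b / T"
  define c where "c = 1 / sqrt R2"
  have t: "t > 0" using assms by (simp add: t_def)
  have R2: "R2 > 0" and c: "c > 0" using assms by (auto simp: c_def)
  have "min (R2 * t) (1 / max t c) = min (R2 * t) (1 / t)"
  proof (cases "t < c")
    case True
    have "R2 * t \<le> R2 * c" using True R2 by (intro mult_left_mono) auto
    also have "R2 * c = 1 / c" using R2 by (simp add: c_def real_div_sqrt)
    finally have "R2 * t \<le> 1 / c" .
    moreover have "1 / c \<le> 1 / t" using True t by (simp add: frac_le)
    ultimately show ?thesis using True by (simp add: max_def)
  qed (simp add: max_def)
  hence "T * fibre_length R1 R2 t = T * max 0 (min (R2 * t) (1 / t) - R1 * t)"
    by (simp add: fibre_length_def c_def)
  also have "\<dots> = max 0 (min (T * (R2 * t)) (T * (1 / t)) - T * (R1 * t))"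
    using assms(3) by (simp add: max_mult_distrib_left min_mult_distrib_left right_diff_distrib)
  also have "\<dots> = max 0 (min (R2 * b) (T ^ 2 / b) - R1 * b)"
    using assms by (simp add: t_def power2_eq_square)
  finally show ?thesis by (simp add: t_def max_def)
qed

text \<open>The pairs are counted for each \<open>b\<close> separately. There are at most
  \<open>2 T\<close> values of \<open>b\<close>, each with an error of at most 1, and the sum over
  \<open>b\<close> is a Riemann sum. Dividing its error by \<open>q^2\<close> makes the whole bound
  independent of \<open>q\<close>.\<close>

lemma cone_pairs_residue_class:
  fixes R1 R2 T :: real and q r s :: nat
  assumes R: "1 \<le> R1" "R1 < R2" and T: "T \<ge> 1" and rs: "r < q" "s < q"
  shows "\<bar>real (card (cone_pairs R1 R2 T (\<lambda>a b. a mod q = r \<and> b mod q = s))) / T ^ 2 - ln (R2 / R1) / 2 / q ^ 2\<bar>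
    \<le> (2 + 3 * (R1 + R2)) / T"
proof -
  define Bs where "Bs = {b. b \<le> nat \<lfloor>T\<rfloor> \<and> b mod q = s}"
  define F where "F = (\<lambda>b::nat. {a::nat. 0 < b \<and> R1 * real b < real a \<and> real a < R2 * real b \<and> real a * real b < T ^ 2 \<and> a mod q = r})"
  define u where "u = (\<lambda>b::nat. R1 * b)"
  define v where "v = (\<lambda>b::nat. max (R1 * b) (min (R2 * b) (T ^ 2 / b)))"
  have fin: "finite Bs" by (simp add: Bs_def)
  have Fin: "F b = (if b = 0 then {} else {a::nat. u b < real a \<and> real a < v b \<and> a mod q = r})" for b
    by (auto simp: F_def u_def v_def less_divide_eq less_max_iff_disj)
  have finF: "finite (F b)" for b
    by (rule finite_subset[of _ "{..nat \<lceil>R2 * b\<rceil>}"]) (auto simp: F_def, linarith)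
  have "cone_pairs R1 R2 T (\<lambda>a b. a mod q = r \<and> b mod q = s) = (\<lambda>(b, a). (a, b)) ` (SIGMA b:Bs. F b)"
  proof (intro equalityI subsetI)
    fix x assume x: "x \<in> cone_pairs R1 R2 T (\<lambda>a b. a mod q = r \<and> b mod q = s)"
    obtain a b where e: "x = (a, b)" by fastforce
    have "b \<le> nat \<lfloor>T\<rfloor>" using cone_pairs_bounds(3)[OF R T x[unfolded e]] by linarith
    hence "(b, a) \<in> (SIGMA b:Bs. F b)" using x by (auto simp: e cone_pairs_def Bs_def F_def)
    thus "x \<in> (\<lambda>(b, a). (a, b)) ` (SIGMA b:Bs. F b)" unfolding e by (rule image_eqI[rotated]) simp
  qed (auto simp: cone_pairs_def Bs_def F_def)
  also have "card \<dots> = card (SIGMA b:Bs. F b)" by (intro card_image) (auto simp: inj_on_def)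
  also have "\<dots> = (\<Sum>b\<in>Bs. card (F b))" using fin finF by simp
  finally have card: "real (card (cone_pairs R1 R2 T (\<lambda>a b. a mod q = r \<and> b mod q = s))) = (\<Sum>b\<in>Bs. real (card (F b)))"
    by simp
  have "\<bar>real (card (F b)) - T * fibre_length R1 R2 (b / T) / q\<bar> \<le> 1" for b
  proof (cases "b = 0")
    case True
    thus ?thesis by (simp add: Fin fibre_length_def)
  next
    case False
    hence "T * fibre_length R1 R2 (b / T) = v b - u b"
      using scaled_fibre_length[OF R T, of b] by (simp add: u_def v_def)
    moreover have "0 \<le> u b" "u b \<le> v b" using R by (auto simp: u_def v_def)
    ultimately show ?thesis using card_residue_open_interval[of "u b" "v b" r q] rs False by (simp add: Fin)
  qed
  hence le: "\<bar>\<Sum>b\<in>Bs. real (card (F b)) - T * fibre_length R1 R2 (b / T) / q\<bar> \<le> (\<Sum>b\<in>Bs. 1)"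
    by (intro order_trans[OF sum_abs] sum_mono) auto
  have "card Bs \<le> card {..nat \<lfloor>T\<rfloor>}" by (intro card_mono) (auto simp: Bs_def)
  hence "(\<Sum>b\<in>Bs. 1 :: real) \<le> real (card {..nat \<lfloor>T\<rfloor>})" by simp
  also have "\<dots> \<le> 2 * T" using T by simp linarith
  finally have 1: "\<bar>(\<Sum>b\<in>Bs. real (card (F b))) - (\<Sum>b\<in>Bs. T * fibre_length R1 R2 (b / T) / q)\<bar> \<le> 2 * T"
    using le by (simp add: sum_subtractf)
  define S where "S = (\<Sum>b\<in>Bs. fibre_length R1 R2 (b / T))"
  have S: "(\<Sum>b\<in>Bs. T * fibre_length R1 R2 (b / T) / q) = T * S / q"
    by (simp add: S_def sum_distrib_left sum_divide_distrib)
  have q: "q > 0" using rs by simp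
  define c where "c = real (card (cone_pairs R1 R2 T (\<lambda>a b. a mod q = r \<and> b mod q = s)))"
  have "\<bar>c - T * S / q\<bar> \<le> 2 * T" using 1 unfolding S c_def card by simp
  hence "\<bar>c - T * S / q\<bar> / T ^ 2 \<le> 2 * T / T ^ 2" by (rule divide_right_mono) simp
  moreover have "\<bar>c - T * S / q\<bar> / T ^ 2 = \<bar>c / T ^ 2 - T * S / q / T ^ 2\<bar>"
    unfolding diff_divide_distrib[symmetric] by (simp only: abs_divide abs_power2)
  moreover have "T * S / q / T ^ 2 = (q / T * S) / q ^ 2" using T q by (simp add: power2_eq_square)
  moreover have "2 * T / T ^ 2 = 2 / T" using T by (simp add: power2_eq_square)
  ultimately have A: "\<bar>c / T ^ 2 - (q / T * S) / q ^ 2\<bar> \<le> 2 / T" by simp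
  have "\<bar>q / T * S - ln (R2 / R1) / 2\<bar> \<le> 3 * (R1 + R2) * q^2 / T"
    unfolding S_def Bs_def by (rule fibre_length_riemann[OF R rs(2) T])
  hence "\<bar>q / T * S - ln (R2 / R1) / 2\<bar> / q ^ 2 \<le> 3 * (R1 + R2) * q^2 / T / q ^ 2" by (rule divide_right_mono) simp
  moreover have "\<bar>q / T * S - ln (R2 / R1) / 2\<bar> / q ^ 2 = \<bar>(q / T * S) / q ^ 2 - ln (R2 / R1) / 2 / q ^ 2\<bar>"
    unfolding diff_divide_distrib[symmetric] by (simp add: abs_divide)
  moreover have "3 * (R1 + R2) * q^2 / T / q ^ 2 = 3 * (R1 + R2) / T" using q by simp
  ultimately have "\<bar>(q / T * S) / q ^ 2 - ln (R2 / R1) / 2 / q ^ 2\<bar> \<le> 3 * (R1 + R2) / T" by simp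
  with A have "\<bar>c / T ^ 2 - ln (R2 / R1) / 2 / q ^ 2\<bar> \<le> 2 / T + 3 * (R1 + R2) / T" by linarith
  thus ?thesis by (simp add: c_def add_divide_distrib)
qed

section \<open>Conditions modulo q and their densities\<close>

definition periodic :: "nat \<Rightarrow> (nat \<Rightarrow> nat \<Rightarrow> bool) \<Rightarrow> bool" where
  "periodic q P \<longleftrightarrow> (\<forall>a b. P (a mod q) (b mod q) \<longleftrightarrow> P a b)"

definition residue_pairs :: "nat \<Rightarrow> (nat \<Rightarrow> nat \<Rightarrow> bool) \<Rightarrow> (nat \<times> nat) set" where
  "residue_pairs q P = {(r, s). r < q \<and> s < q \<and> P r s}"

definition residue_density :: "nat \<Rightarrow> (nat \<Rightarrow> nat \<Rightarrow> bool) \<Rightarrow> real" where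
  "residue_density q P = card (residue_pairs q P) / real q ^ 2"

lemma finite_residue_pairs [simp]: "finite (residue_pairs q P)"
  by (rule finite_subset[of _ "{..<q} \<times> {..<q}"]) (auto simp: residue_pairs_def)

lemma card_residue_pairs_le: "card (residue_pairs q P) \<le> q ^ 2"
proof -
  have "card (residue_pairs q P) \<le> card ({..<q} \<times> {..<q})"
    by (rule card_mono) (auto simp: residue_pairs_def)
  thus ?thesis by (simp add: power2_eq_square)
qed

lemma cone_pairs_periodic:
  fixes R1 R2 T :: real and q :: nat
  assumes R: "1 \<le> R1" "R1 < R2" and T: "T \<ge> 1" and q: "q > 0" and P: "periodic q P"
  shows "\<bar>real (card (cone_pairs R1 R2 T P)) / T ^ 2 - residue_density q P * (ln (R2 / R1) / 2)\<bar>
    \<le> q ^ 2 * (2 + 3 * (R1 + R2)) / T"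
proof -
  define c where "c = (\<lambda>(r, s). card (cone_pairs R1 R2 T (\<lambda>a b. a mod q = r \<and> b mod q = s)))"
  define I where "I = ln (R2 / R1) / 2"
  have "cone_pairs R1 R2 T P = (\<Union>(r, s)\<in>residue_pairs q P. cone_pairs R1 R2 T (\<lambda>a b. a mod q = r \<and> b mod q = s))"
    using P q by (auto simp: cone_pairs_def residue_pairs_def periodic_def)
  also have "card \<dots> = (\<Sum>x\<in>residue_pairs q P. c x)"
    unfolding c_def split_def
    by (rule card_UN_disjoint) (auto simp: finite_cone_pairs[OF R T], auto simp: cone_pairs_def)
  finally have card: "real (card (cone_pairs R1 R2 T P)) / T ^ 2 = (\<Sum>x\<in>residue_pairs q P. c x / T ^ 2)"
    by (simp add: sum_divide_distrib)
  have dens: "residue_density q P * I = (\<Sum>x\<in>residue_pairs q P. I / q ^ 2)"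
    by (simp add: residue_density_def)
  have "\<bar>real (card (cone_pairs R1 R2 T P)) / T ^ 2 - residue_density q P * I\<bar>
     = \<bar>\<Sum>x\<in>residue_pairs q P. c x / T ^ 2 - I / q ^ 2\<bar>"
    unfolding card dens by (simp add: sum_subtractf)
  also have "\<dots> \<le> (\<Sum>x\<in>residue_pairs q P. (2 + 3 * (R1 + R2)) / T)"
  proof (intro order_trans[OF sum_abs] sum_mono)
    fix x assume "x \<in> residue_pairs q P"
    thus "\<bar>c x / T ^ 2 - I / q ^ 2\<bar> \<le> (2 + 3 * (R1 + R2)) / T"
      using cone_pairs_residue_class[OF R T, of "fst x" q "snd x"]
      by (auto simp: residue_pairs_def c_def I_def)
  qed
  also have "\<dots> = card (residue_pairs q P) * ((2 + 3 * (R1 + R2)) / T)" by simp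
  also have "\<dots> \<le> real (q ^ 2) * ((2 + 3 * (R1 + R2)) / T)"
    using card_residue_pairs_le[of q P] R T by (intro mult_right_mono) (auto simp flip: of_nat_power)
  finally show ?thesis by (simp add: I_def)
qed

lemma residue_density_mult:
  assumes P: "periodic m P" and Q: "periodic n Q" and co: "coprime m n" and mn: "m > 0" "n > 0"
  shows "residue_density (m * n) (\<lambda>a b. P a b \<and> Q a b) = residue_density m P * residue_density n Q"
    and "periodic (m * n) (\<lambda>a b. P a b \<and> Q a b)"
proof -
  define f where "f = (\<lambda>(a, b). ((a mod m, b mod m), (a mod n, b mod n)))"
  have crt: "\<exists>!x. x < m * n \<and> x mod m = r \<and> x mod n = s" if "r < m" "s < n" for r s
    using binary_chinese_remainder_unique_nat[OF co, of r s] that mn by (simp add: cong_def)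
  have P': "P (a mod m) (b mod m) = P a b" and Q': "Q (a mod n) (b mod n) = Q a b" for a b
    using P Q by (auto simp: periodic_def)
  have "bij_betw f (residue_pairs (m * n) (\<lambda>a b. P a b \<and> Q a b)) (residue_pairs m P \<times> residue_pairs n Q)"
  proof (rule bij_betw_imageI)
    show "inj_on f (residue_pairs (m * n) (\<lambda>a b. P a b \<and> Q a b))"
    proof (rule inj_onI, clarify)
      fix a b a' b' assume *: "(a, b) \<in> residue_pairs (m * n) (\<lambda>a b. P a b \<and> Q a b)"
        "(a', b') \<in> residue_pairs (m * n) (\<lambda>a b. P a b \<and> Q a b)" "f (a, b) = f (a', b')"
      thus "a = a' \<and> b = b'"
        using crt[of "a mod m" "a mod n"] crt[of "b mod m" "b mod n"] mn
        by (auto simp: f_def residue_pairs_def)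
    qed
    show "f ` residue_pairs (m * n) (\<lambda>a b. P a b \<and> Q a b) = residue_pairs m P \<times> residue_pairs n Q"
    proof (intro equalityI subsetI)
      fix x assume "x \<in> f ` residue_pairs (m * n) (\<lambda>a b. P a b \<and> Q a b)"
      thus "x \<in> residue_pairs m P \<times> residue_pairs n Q"
        using mn by (auto simp: f_def residue_pairs_def P' Q')
    next
      fix x assume x: "x \<in> residue_pairs m P \<times> residue_pairs n Q"
      obtain r s r' s' where e: "x = ((r, s), (r', s'))" by (metis surj_pair)
      have *: "r < m" "s < m" "P r s" "r' < n" "s' < n" "Q r' s'" using x e by (auto simp: residue_pairs_def)
      obtain a where a: "a < m * n" "a mod m = r" "a mod n = r'" using crt[OF *(1,4)] by blast
      obtain b where b: "b < m * n" "b mod m = s" "b mod n = s'" using crt[OF *(2,5)] by blast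
      have "P a b" "Q a b" using * a b P'[of a b] Q'[of a b] by auto
      hence "(a, b) \<in> residue_pairs (m * n) (\<lambda>a b. P a b \<and> Q a b)" using a b by (simp add: residue_pairs_def)
      thus "x \<in> f ` residue_pairs (m * n) (\<lambda>a b. P a b \<and> Q a b)"
        by (rule rev_image_eqI) (simp add: e f_def a b)
    qed
  qed
  hence "card (residue_pairs (m * n) (\<lambda>a b. P a b \<and> Q a b)) = card (residue_pairs m P) * card (residue_pairs n Q)"
    by (simp add: bij_betw_same_card card_cartesian_product)
  thus "residue_density (m * n) (\<lambda>a b. P a b \<and> Q a b) = residue_density m P * residue_density n Q"
    by (simp add: residue_density_def power_mult_distrib)
  have "P (a mod (m * n)) (b mod (m * n)) = P a b" for a b
    using P'[of "a mod (m * n)" "b mod (m * n)"] P'[of a b] by (simp add: mod_mod_cancel)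
  moreover have "Q (a mod (m * n)) (b mod (m * n)) = Q a b" for a b
    using Q'[of "a mod (m * n)" "b mod (m * n)"] Q'[of a b] by (simp add: mod_mod_cancel)
  ultimately show "periodic (m * n) (\<lambda>a b. P a b \<and> Q a b)" by (simp add: periodic_def)
qed

definition locally_admissible :: "nat \<Rightarrow> nat \<Rightarrow> nat \<Rightarrow> bool" where
  "locally_admissible p a b \<longleftrightarrow> \<not> p ^ 2 dvd a \<and> \<not> p ^ 2 dvd b \<and> \<not> (p dvd a \<and> p dvd b)"

lemma periodic_locally_admissible: "periodic (p ^ 2) (locally_admissible p)"
proof -
  have "p dvd a mod p ^ 2 \<longleftrightarrow> p dvd a" for a by (rule dvd_mod_iff) simp
  moreover have "p ^ 2 dvd a mod p ^ 2 \<longleftrightarrow> p ^ 2 dvd a" for a by (rule dvd_mod_iff) simp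
  ultimately show ?thesis by (simp add: periodic_def locally_admissible_def)
qed

text \<open>Modulo \<open>p^2\<close> neither coordinate may be 0, which leaves
  \<open>(p^2 - 1)^2\<close> pairs. Those with both coordinates among the \<open>p - 1\<close>
  non-zero multiples of \<open>p\<close>, collected in \<open>V\<close>, are removed.\<close>

lemma residue_density_locally_admissible:
  assumes "p > 1"
  shows "residue_density (p ^ 2) (locally_admissible p) = 1 - 3 / real p ^ 2 + 2 / real p ^ 3"
proof -
  define V where "V = (\<lambda>k. p * k) ` {1..<p}"
  have V: "V \<subseteq> {1..<p ^ 2}" "card V = p - 1" "finite V"
    using assms unfolding V_def by (auto simp: card_image inj_on_def power2_eq_square)
  have memV: "r \<in> V \<longleftrightarrow> p dvd r" if "r \<in> {1..<p ^ 2}" for r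
    using that assms by (auto simp: V_def power2_eq_square elim!: dvdE)
  have nd: "p ^ 2 dvd r \<longleftrightarrow> r = 0" if "r < p ^ 2" for r using that by (auto dest: dvd_imp_le)
  have "residue_pairs (p ^ 2) (locally_admissible p) = {1..<p ^ 2} \<times> {1..<p ^ 2} - V \<times> V"
  proof (intro equalityI subsetI)
    fix x assume x: "x \<in> residue_pairs (p ^ 2) (locally_admissible p)"
    obtain r s where e: "x = (r, s)" by fastforce
    have *: "r < p ^ 2" "s < p ^ 2" "locally_admissible p r s" using x e by (auto simp: residue_pairs_def)
    hence "0 < r" "0 < s" by (metis dvd_0_right locally_admissible_def gr0I)+
    thus "x \<in> {1..<p ^ 2} \<times> {1..<p ^ 2} - V \<times> V"
      using * \<open>0 < r\<close> \<open>0 < s\<close> memV[of r] memV[of s] by (auto simp: e locally_admissible_def)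
  next
    fix x assume x: "x \<in> {1..<p ^ 2} \<times> {1..<p ^ 2} - V \<times> V"
    obtain r s where e: "x = (r, s)" by fastforce
    have *: "r \<in> {1..<p ^ 2}" "s \<in> {1..<p ^ 2}" "\<not> (r \<in> V \<and> s \<in> V)" using x e by auto
    thus "x \<in> residue_pairs (p ^ 2) (locally_admissible p)"
      using memV[of r] memV[of s] nd[of r] nd[of s] by (auto simp: e locally_admissible_def residue_pairs_def)
  qed
  hence "card (residue_pairs (p ^ 2) (locally_admissible p)) = (p ^ 2 - 1) * (p ^ 2 - 1) - (p - 1) * (p - 1)"
    using V by (simp add: card_Diff_subset card_cartesian_product Sigma_mono)
  moreover have "(p - 1) * (p - 1) \<le> (p ^ 2 - 1) * (p ^ 2 - 1)"
    using assms by (intro mult_mono diff_le_mono) (auto simp: power2_eq_square)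
  moreover have "1 \<le> p ^ 2" using assms by simp
  ultimately have "real (card (residue_pairs (p ^ 2) (locally_admissible p))) = (real p ^ 2 - 1) ^ 2 - (real p - 1) ^ 2"
    using assms by (simp add: of_nat_diff power2_eq_square)
  also have "\<dots> = real p ^ 4 - 3 * real p ^ 2 + 2 * real p"
    by (simp add: algebra_simps power2_eq_square power4_eq_xxxx)
  finally have "residue_density (p ^ 2) (locally_admissible p) = (real p ^ 4 - 3 * real p ^ 2 + 2 * real p) / real p ^ 4"
    by (simp add: residue_density_def)
  also have "\<dots> = 1 - 3 / real p ^ 2 + 2 / real p ^ 3"
    using assms by (simp add: add_divide_distrib diff_divide_distrib power2_eq_square power3_eq_cube power4_eq_xxxx)
  finally show ?thesis .
qed

section \<open>The sieve\<close>

definition euler_factor :: "nat \<Rightarrow> real" where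
  "euler_factor p = 1 - 3 / real p ^ 2 + 2 / real p ^ 3"

lemma abs_euler_factor_minus_1_le:
  assumes "p > 1"
  shows "\<bar>euler_factor p - 1\<bar> \<le> 3 / real p ^ 2"
proof -
  define y where "y = 1 / real p"
  have y: "0 < y" "y \<le> 1" using assms by (simp_all add: y_def)
  have "y ^ 3 \<le> y ^ 2" using y by (intro power_decreasing) auto
  moreover have "0 < y ^ 3" using y by simp
  moreover have "euler_factor p = 1 - 3 * y ^ 2 + 2 * y ^ 3" "3 / real p ^ 2 = 3 * y ^ 2"
    by (simp_all add: euler_factor_def y_def power_divide)
  ultimately show ?thesis by linarith
qed

text \<open>\<open>E\<close> is the condition at the prime 3, where the type is decided.\<close>

definition sieve :: "(nat \<Rightarrow> nat \<Rightarrow> bool) \<Rightarrow> nat set \<Rightarrow> nat \<Rightarrow> nat \<Rightarrow> bool" where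
  "sieve E S a b \<longleftrightarrow> E a b \<and> (\<forall>p\<in>S. locally_admissible p a b)"

lemma residue_density_sieve:
  assumes E: "periodic 9 E" and S: "finite S" "\<And>p. p \<in> S \<Longrightarrow> nprime p \<and> p \<noteq> 3"
  shows "\<exists>q>0. periodic q (sieve E S) \<and> residue_density q (sieve E S) = residue_density 9 E * (\<Prod>p\<in>S. euler_factor p)"
proof -
  \<comment> \<open>9 is the modulus of \<open>E\<close>; excluding 3 from \<open>S\<close> keeps it
    coprime to the squares of the sieving primes.\<close>
  define M where "M = (\<lambda>S::nat set. 9 * (\<Prod>p\<in>S. p ^ 2))"
  have "periodic (M S) (sieve E S) \<and> residue_density (M S) (sieve E S) = residue_density 9 E * (\<Prod>p\<in>S. euler_factor p) \<and> M S > 0"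
    using S
  proof (induction S rule: finite_induct)
    case empty
    thus ?case using E by (simp add: sieve_def M_def)
  next
    case (insert p S)
    have p: "nprime p" "p \<noteq> 3" using insert.prems by auto
    have IH: "periodic (M S) (sieve E S)" "residue_density (M S) (sieve E S) = residue_density 9 E * (\<Prod>p\<in>S. euler_factor p)" "M S > 0"
      using insert by auto
    have co: "coprime p r" if "nprime r" "p \<noteq> r" for r using that p(1) by (metis primes_coprime)
    have "coprime p (3 ^ 2)" using co[of 3] p by (subst coprime_power_right_iff) simp
    moreover have "coprime p (r ^ 2)" if "r \<in> S" for r
    proof -
      have "coprime p r" using that insert by (intro co) auto
      thus ?thesis by simp
    qed
    ultimately have "coprime p (M S)" unfolding M_def
      by (auto intro!: prod_coprime_right)
    hence "coprime (M S) (p ^ 2)" by (simp add: coprime_commute)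
    note * = residue_density_mult[OF IH(1) periodic_locally_admissible[of p] this IH(3)]
    have p1: "p > 1" using p(1) by (rule prime_gt_1_nat)
    have "M (insert p S) = M S * p ^ 2" using insert.hyps by (simp add: M_def)
    moreover have "sieve E (insert p S) = (\<lambda>a b. sieve E S a b \<and> locally_admissible p a b)"
      by (auto simp: sieve_def fun_eq_iff)
    ultimately show ?case
      using * IH p1 insert.hyps by (simp add: residue_density_locally_admissible euler_factor_def)
  qed
  thus ?thesis by blast
qed

text \<open>Only positive multiples are counted, so no rounding term appears. In the tail of the
  sieve such terms would add up over a range of moduli that grows with \<open>T\<close>.\<close>

lemma card_multiples_le:
  fixes N d :: nat
  shows "real (card {n \<in> {1..N}. d dvd n}) \<le> real N / real d"
proof (cases "d = 0")
  case False
  have "{n \<in> {1..N}. d dvd n} \<subseteq> (\<lambda>k. d * k) ` {1..N div d}"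
  proof
    fix n assume n: "n \<in> {n \<in> {1..N}. d dvd n}"
    then obtain k where k: "n = d * k" by blast
    have "k \<le> N div d" using n k False by (simp add: less_eq_div_iff_mult_less_eq mult.commute)
    thus "n \<in> (\<lambda>k. d * k) ` {1..N div d}" using n k by auto
  qed
  hence "card {n \<in> {1..N}. d dvd n} \<le> card ((\<lambda>k. d * k) ` {1..N div d})" by (intro card_mono) auto
  also have "\<dots> \<le> N div d" using card_image_le[of "{1..N div d}" "\<lambda>k. d * k"] by simp
  finally show ?thesis using of_nat_div_le_of_nat[of N d, where ?'a = real] by linarith
qed auto

lemma sum_inverse_squares_le:
  fixes z M :: nat
  assumes "z \<ge> 1"
  shows "(\<Sum>p\<in>{z<..M}. 1 / real p ^ 2) \<le> 1 / z"
proof -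
  have tele: "(\<Sum>p\<in>{z<..M}. 1 / real p ^ 2) \<le> 1 / z - 1 / M" if "z \<le> M" for M
    using that
  proof (induction M rule: dec_induct)
    case (step n)
    have n: "n \<ge> 1" using step assms by simp
    have "1 / real (Suc n) ^ 2 \<le> 1 / (real n * real (Suc n))"
      using n by (intro divide_left_mono) (auto simp: power2_eq_square)
    also have "\<dots> = 1 / real n - 1 / real (Suc n)" using n by (simp add: field_simps)
    finally have "1 / real (Suc n) ^ 2 \<le> 1 / real n - 1 / real (Suc n)" .
    moreover have "{z<..Suc n} = insert (Suc n) {z<..n}" using step by auto
    ultimately show ?case using step.IH by simp
  qed simp
  have "1 / real M \<ge> 0" by simp
  thus ?thesis using tele[of M] assms by (cases "z \<le> M") (linarith, simp)
qed

text \<open>There are three ways to fail, each confined to a product set of density at most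
  \<open>1 / p^2\<close>.\<close>

lemma card_not_locally_admissible_le:
  fixes p A B :: nat
  assumes "p > 0"
  shows "real (card {(a, b). a \<in> {1..A} \<and> b \<in> {1..B} \<and> \<not> locally_admissible p a b}) \<le> 3 * (real A * real B / real p ^ 2)"
proof -
  let ?m = "\<lambda>N d. {n \<in> {1..N}. d dvd n}"
  have "{(a, b). a \<in> {1..A} \<and> b \<in> {1..B} \<and> \<not> locally_admissible p a b}
     \<subseteq> ?m A (p ^ 2) \<times> {1..B} \<union> ({1..A} \<times> ?m B (p ^ 2) \<union> ?m A p \<times> ?m B p)"
    by (auto simp: locally_admissible_def)
  hence "card {(a, b). a \<in> {1..A} \<and> b \<in> {1..B} \<and> \<not> locally_admissible p a b}
     \<le> card (?m A (p ^ 2) \<times> {1..B} \<union> ({1..A} \<times> ?m B (p ^ 2) \<union> ?m A p \<times> ?m B p))"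
    by (intro card_mono) auto
  also have "\<dots> \<le> card (?m A (p ^ 2) \<times> {1..B}) + (card ({1..A} \<times> ?m B (p ^ 2)) + card (?m A p \<times> ?m B p))"
    by (intro order_trans[OF card_Un_le] add_left_mono card_Un_le)
  finally have le: "real (card {(a, b). a \<in> {1..A} \<and> b \<in> {1..B} \<and> \<not> locally_admissible p a b})
     \<le> real (card (?m A (p ^ 2))) * real B + (real A * real (card (?m B (p ^ 2))) + real (card (?m A p)) * real (card (?m B p)))"
    unfolding card_cartesian_product by (simp flip: of_nat_mult of_nat_add)
  note le
  also have "real (card (?m A (p ^ 2))) * real B + (real A * real (card (?m B (p ^ 2))) + real (card (?m A p)) * real (card (?m B p)))
     \<le> (real A / real (p ^ 2)) * real B + (real A * (real B / real (p ^ 2)) + (real A / real p) * (real B / real p))"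
    by (intro add_mono mult_mono card_multiples_le order_refl) simp_all
  also have "\<dots> = 3 * (real A * real B / real p ^ 2)" by (simp add: power2_eq_square)
  finally show ?thesis .
qed

text \<open>A pair lost to a prime \<open>p > z\<close> lies in the box with sides
  \<open>R2 T\<close> and \<open>T\<close>, and \<open>p\<close> cannot exceed both coordinates, so
  a finite union covers all losses. Each modulus costs at most \<open>3 R2 T^2 / p^2\<close>, and
  the inverse squares beyond \<open>z\<close> sum to at most \<open>1 / z\<close>.\<close>

lemma card_sieve_tail:
  fixes R1 R2 T :: real and z :: nat
  assumes R: "1 \<le> R1" "R1 < R2" and T: "T \<ge> 1" and z: "z \<ge> 1"
  shows "real (card (cone_pairs R1 R2 T (sieve E {p. nprime p \<and> p \<noteq> 3 \<and> p \<le> z}) - cone_pairs R1 R2 T (sieve E {p. nprime p \<and> p \<noteq> 3})))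
    \<le> 3 * R2 * T ^ 2 / z"
proof -
  define A B where "A = nat \<lfloor>R2 * T\<rfloor>" and "B = nat \<lfloor>T\<rfloor>"
  define N where "N = (\<lambda>p. {(a, b). a \<in> {1..A} \<and> b \<in> {1..B} \<and> \<not> locally_admissible p a b})"
  have finN: "finite (N p)" for p by (rule finite_subset[of _ "{1..A} \<times> {1..B}"]) (auto simp: N_def)
  have sub: "cone_pairs R1 R2 T (sieve E {p. nprime p \<and> p \<noteq> 3 \<and> p \<le> z}) - cone_pairs R1 R2 T (sieve E {p. nprime p \<and> p \<noteq> 3})
     \<subseteq> (\<Union>p\<in>{z<..A + B}. N p)"
  proof
    fix x assume x: "x \<in> cone_pairs R1 R2 T (sieve E {p. nprime p \<and> p \<noteq> 3 \<and> p \<le> z}) - cone_pairs R1 R2 T (sieve E {p. nprime p \<and> p \<noteq> 3})"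
    obtain a b where e: "x = (a, b)" by fastforce
    have ab: "a \<in> {1..A}" "b \<in> {1..B}"
      using x cone_pairs_subset[OF R T, of "sieve E {p. nprime p \<and> p \<noteq> 3 \<and> p \<le> z}"] unfolding e A_def B_def by auto
    obtain p where p: "nprime p" "\<not> p \<le> z" "\<not> locally_admissible p a b"
      using x by (auto simp: e cone_pairs_def sieve_def)
    have "p \<le> p ^ 2" using prime_gt_0_nat[OF p(1)] by (simp add: power2_eq_square)
    have "p \<le> a \<or> p \<le> b"
    proof -
      have "p ^ 2 dvd a \<or> p ^ 2 dvd b \<or> p dvd a" using p(3) by (auto simp: locally_admissible_def)
      hence "p ^ 2 \<le> a \<or> p ^ 2 \<le> b \<or> p \<le> a" using ab by (auto dest: dvd_imp_le)
      thus ?thesis using \<open>p \<le> p ^ 2\<close> by linarith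
    qed
    hence "p \<in> {z<..A + B}" using ab p by auto
    moreover have "x \<in> N p" using p ab by (simp add: N_def e)
    ultimately show "x \<in> (\<Union>p\<in>{z<..A + B}. N p)" by blast
  qed
  have "card (cone_pairs R1 R2 T (sieve E {p. nprime p \<and> p \<noteq> 3 \<and> p \<le> z}) - cone_pairs R1 R2 T (sieve E {p. nprime p \<and> p \<noteq> 3}))
    \<le> card (\<Union>p\<in>{z<..A + B}. N p)" by (rule card_mono[OF _ sub]) (auto simp: finN)
  also have "\<dots> \<le> (\<Sum>p\<in>{z<..A + B}. card (N p))" by (rule card_UN_le) simp
  finally have "real (card (cone_pairs R1 R2 T (sieve E {p. nprime p \<and> p \<noteq> 3 \<and> p \<le> z}) - cone_pairs R1 R2 T (sieve E {p. nprime p \<and> p \<noteq> 3})))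
    \<le> (\<Sum>p\<in>{z<..A + B}. real (card (N p)))" by (simp flip: of_nat_sum)
  also have "\<dots> \<le> (\<Sum>p\<in>{z<..A + B}. 3 * (real A * real B / real p ^ 2))"
    unfolding N_def by (intro sum_mono card_not_locally_admissible_le) auto
  also have "\<dots> = 3 * (real A * real B) * (\<Sum>p\<in>{z<..A + B}. 1 / real p ^ 2)" by (simp add: sum_distrib_left)
  also have "\<dots> \<le> 3 * ((R2 * T) * T) * (1 / z)"
  proof (intro mult_mono sum_inverse_squares_le z)
    have "R2 * T \<ge> 0" using R T by simp
    thus "real A \<le> R2 * T" "real B \<le> T" "0 \<le> R2 * T" using T by (auto simp: A_def B_def)
    thus "0 \<le> 3 * (R2 * T * T)" using T by simp
  qed (auto intro!: sum_nonneg)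
  also have "\<dots> = 3 * R2 * T ^ 2 / z" by (simp add: power2_eq_square)
  finally show ?thesis .
qed

text \<open>The prime 3 is treated apart because the type is decided there; the factor 27/20 removes
  its Euler factor 20/27 from the full product.\<close>

lemma euler_product_tendsto:
  defines "f \<equiv> \<lambda>p::nat. if nprime p then 1 - 3 / real p ^ 2 + 2 / real p ^ 3 else 1"
  shows "(\<lambda>z. \<Prod>p\<in>{p. nprime p \<and> p \<noteq> 3 \<and> p \<le> z}. euler_factor p) \<longlonglongrightarrow> prodinf f * (27 / 20)"
proof -
  have "summable (\<lambda>p. norm (f p - 1))"
  proof (rule summable_comparison_test')
    show "summable (\<lambda>p. 3 * (1 / real p ^ 2))" 
      using inverse_power_summable[of 2, where ?'a = real] by (intro summable_mult) (simp add: divide_inverse)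
    show "norm (norm (f p - 1)) \<le> 3 * (1 / real p ^ 2)" for p
      using abs_euler_factor_minus_1_le[of p] prime_gt_1_nat[of p] by (auto simp: f_def euler_factor_def)
  qed
  hence "convergent_prod f"
    by (intro abs_convergent_prod_imp_convergent_prod summable_imp_abs_convergent_prod)
  hence lim: "(\<lambda>n. \<Prod>p\<le>n. f p) \<longlonglongrightarrow> prodinf f" by (rule convergent_prod_LIMSEQ)
  have "(\<Prod>p\<le>z. f p) = (\<Prod>p\<in>{p. nprime p \<and> p \<noteq> 3 \<and> p \<le> z}. euler_factor p) * (20 / 27)" if "z \<ge> 3" for z
  proof -
    have "(\<Prod>p\<le>z. f p) = (\<Prod>p\<in>insert 3 {p. nprime p \<and> p \<noteq> 3 \<and> p \<le> z}. f p)"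
      using that by (intro prod.mono_neutral_right) (auto simp: f_def)
    also have "\<dots> = f 3 * (\<Prod>p\<in>{p. nprime p \<and> p \<noteq> 3 \<and> p \<le> z}. f p)"
      by (subst prod.insert) (auto intro: finite_subset[of _ "{..z}"])
    also have "(\<Prod>p\<in>{p. nprime p \<and> p \<noteq> 3 \<and> p \<le> z}. f p) = (\<Prod>p\<in>{p. nprime p \<and> p \<noteq> 3 \<and> p \<le> z}. euler_factor p)"
      by (intro prod.cong) (auto simp: f_def euler_factor_def)
    also have "f 3 = 20 / 27" by (simp add: f_def)
    finally show ?thesis by simp
  qed
  note prod_eq = this
  have "eventually (\<lambda>z. (\<Prod>p\<le>z. f p) * (27 / 20) = (\<Prod>p\<in>{p. nprime p \<and> p \<noteq> 3 \<and> p \<le> z}. euler_factor p)) sequentially"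
    using eventually_ge_at_top[of 3] by eventually_elim (simp add: prod_eq)
  moreover have "(\<lambda>z. (\<Prod>p\<le>z. f p) * (27 / 20)) \<longlonglongrightarrow> prodinf f * (27 / 20)"
    by (intro tendsto_intros lim)
  ultimately show ?thesis by (rule Lim_transform_eventually[rotated])
qed

text \<open>The cut-off \<open>z\<close> is fixed first, so that the remaining Euler factors and the
  sieve tail each cost less than \<open>e / 3\<close>; only then does \<open>T\<close> grow. The
  modulus \<open>q\<close> is fixed together with \<open>z\<close>, so its square in the error term
  does no harm.\<close>

theorem cone_pairs_sieve_asymptotics:
  fixes R1 R2 :: real
  assumes R: "1 \<le> R1" "R1 < R2" and E: "periodic 9 E"
  defines "f \<equiv> \<lambda>p::nat. if nprime p then 1 - 3 / real p ^ 2 + 2 / real p ^ 3 else 1"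
  shows "((\<lambda>T. card (cone_pairs R1 R2 T (sieve E {p. nprime p \<and> p \<noteq> 3})) / T ^ 2)
    \<longlongrightarrow> residue_density 9 E * (prodinf f * (27 / 20)) * (ln (R2 / R1) / 2)) at_top"
proof (rule tendstoI)
  fix e :: real assume e: "e > 0"
  define S where "S = (\<lambda>z. {p::nat. nprime p \<and> p \<noteq> 3 \<and> p \<le> z})"
  define d where "d = (\<lambda>z. residue_density 9 E * (\<Prod>p\<in>S z. euler_factor p) * (ln (R2 / R1) / 2))"
  let ?L = "residue_density 9 E * (prodinf f * (27 / 20)) * (ln (R2 / R1) / 2)"
  have "d \<longlonglongrightarrow> ?L" unfolding d_def f_def S_def
    by (intro tendsto_intros euler_product_tendsto)
  note d_lim = this
  have e3: "e / 3 > 0" using e by simp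
  have "eventually (\<lambda>z. \<bar>d z - ?L\<bar> < e / 3) sequentially"
    using tendstoD[OF d_lim e3] unfolding dist_real_def .
  moreover have z_lim: "(\<lambda>z. 3 * R2 / real z) \<longlonglongrightarrow> 0" by real_asymp
  have "eventually (\<lambda>z. \<bar>3 * R2 / real z - 0\<bar> < e / 3) sequentially"
    using tendstoD[OF z_lim e3] unfolding dist_real_def .
  ultimately have "eventually (\<lambda>z. \<bar>d z - ?L\<bar> < e / 3 \<and> \<bar>3 * R2 / real z - 0\<bar> < e / 3 \<and> z \<ge> 1) sequentially"
    using eventually_ge_at_top[of 1] by eventually_elim simp
  then obtain z where z: "\<bar>d z - ?L\<bar> < e / 3" "\<bar>3 * R2 / real z - 0\<bar> < e / 3" "z \<ge> 1"
    unfolding eventually_sequentially by blast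
  have finS: "finite (S z)" by (rule finite_subset[of _ "{..z}"]) (auto simp: S_def)
  obtain q where q: "q > 0" "periodic q (sieve E (S z))" "residue_density q (sieve E (S z)) = residue_density 9 E * (\<Prod>p\<in>S z. euler_factor p)"
    using residue_density_sieve[OF E finS] by (auto simp: S_def)
  have T_lim: "((\<lambda>T. real (q ^ 2) * (2 + 3 * (R1 + R2)) / T) \<longlongrightarrow> 0) at_top" by real_asymp
  have "eventually (\<lambda>T. \<bar>real (q ^ 2) * (2 + 3 * (R1 + R2)) / T - 0\<bar> < e / 3) at_top"
    using tendstoD[OF T_lim e3] unfolding dist_real_def .
  thus "eventually (\<lambda>T. dist (card (cone_pairs R1 R2 T (sieve E {p. nprime p \<and> p \<noteq> 3})) / T ^ 2) ?L < e) at_top"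
    using eventually_ge_at_top[of 1]
  proof eventually_elim
    case (elim T)
    let ?U = "cone_pairs R1 R2 T (sieve E (S z))" and ?V = "cone_pairs R1 R2 T (sieve E {p. nprime p \<and> p \<noteq> 3})"
    have sub: "?V \<subseteq> ?U" by (auto simp: cone_pairs_def sieve_def S_def)
    have fin: "finite ?U" "finite ?V" using finite_cone_pairs[OF R elim(2)] by blast+
    have "card ?U = card ?V + card (?U - ?V)" using sub fin by (simp add: card_Diff_subset card_mono)
    moreover have "real (card (?U - ?V)) \<le> 3 * R2 * T ^ 2 / z"
      unfolding S_def by (rule card_sieve_tail[OF R elim(2) z(3)])
    ultimately have "\<bar>real (card ?U) - real (card ?V)\<bar> \<le> 3 * R2 / z * T ^ 2" by simp
    hence "\<bar>real (card ?U) - real (card ?V)\<bar> / T ^ 2 \<le> 3 * R2 / z" using elim(2) by (simp add: pos_divide_le_eq)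
    moreover have "\<bar>real (card ?U) - real (card ?V)\<bar> / T ^ 2 = \<bar>real (card ?U) / T ^ 2 - real (card ?V) / T ^ 2\<bar>"
      unfolding diff_divide_distrib[symmetric] by (simp only: abs_divide abs_power2)
    moreover have "\<bar>real (card ?U) / T ^ 2 - d z\<bar> \<le> real (q ^ 2) * (2 + 3 * (R1 + R2)) / T"
      using cone_pairs_periodic[OF R elim(2) q(1,2)] unfolding q(3) d_def by simp
    ultimately have "\<bar>real (card ?V) / T ^ 2 - ?L\<bar> < e" using elim(1) z by linarith
    thus ?case by (simp add: dist_real_def)
  qed
qed

section \<open>Asymptotic counts\<close>

lemma type_II_pair_iff:
  "type_II_pair a b \<longleftrightarrow> \<not> 3 dvd a \<and> \<not> 3 dvd b \<and> (a mod 9 = b mod 9 \<or> (a + b) mod 9 = 0)"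
proof -
  have "a mod 9 = b mod 9 \<longleftrightarrow> int (a mod 9) = int (b mod 9)" by (rule of_nat_eq_iff[symmetric])
  also have "\<dots> \<longleftrightarrow> 9 dvd int a - int b" unfolding zmod_int mod_eq_dvd_iff by simp
  finally have "9 dvd int a - int b \<longleftrightarrow> a mod 9 = b mod 9" ..
  moreover have "9 dvd int a + int b \<longleftrightarrow> (a + b) mod 9 = 0"
    using int_dvd_int_iff[of 9 "a + b"] by (simp add: dvd_eq_mod_eq_0)
  moreover have "3 dvd a * b \<longleftrightarrow> 3 dvd a \<or> 3 dvd b" by (rule prime_dvd_mult_iff) simp
  ultimately show ?thesis unfolding type_II_pair_def by argo
qed

lemma periodic_type_II_pair: "periodic 9 type_II_pair"
proof -
  have "3 dvd a mod 9 \<longleftrightarrow> 3 dvd a" for a :: nat by (rule dvd_mod_iff) simp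
  thus ?thesis by (simp add: periodic_def type_II_pair_iff mod_add_eq)
qed

lemma type_II_pair_locally_admissible: "type_II_pair a b \<Longrightarrow> locally_admissible 3 a b"
proof -
  assume "type_II_pair a b"
  hence "\<not> 3 dvd a" "\<not> 3 dvd b" by (auto simp: type_II_pair_iff)
  thus ?thesis unfolding locally_admissible_def by (meson dvd_trans dvd_power zero_less_numeral)
qed

text \<open>12 is 6 times 2: each of the six units modulo 9 is paired with itself and with its
  negative.\<close>

lemma card_type_II_residue_pairs: "card (residue_pairs 9 type_II_pair) = 12"
proof -
  define P where "P = (\<lambda>(r, s). \<not> 3 dvd r \<and> \<not> 3 dvd s \<and> (r mod 9 = s mod 9 \<or> (r + s) mod 9 = (0 :: nat)))"
  have "residue_pairs 9 type_II_pair = set (filter P (List.product [0..<9] [0..<9]))"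
    by (auto simp: residue_pairs_def type_II_pair_iff P_def)
  also have "filter P (List.product [0..<9] [0..<9]) =
    [(1, 1), (1, 8), (2, 2), (2, 7), (4, 4), (4, 5), (5, 4), (5, 5), (7, 2), (7, 7), (8, 1), (8, 8)]"
    unfolding P_def by code_simp
  finally show ?thesis by simp
qed

definition type_I_local :: "nat \<Rightarrow> nat \<Rightarrow> bool" where
  "type_I_local a b \<longleftrightarrow> locally_admissible 3 a b \<and> \<not> type_II_pair a b"

lemma periodic_type_I_local: "periodic 9 type_I_local"
  using periodic_type_II_pair periodic_locally_admissible[of 3]
  by (simp add: periodic_def type_I_local_def)

lemma residue_density_type_II: "residue_density 9 type_II_pair = 4 / 27"
  by (simp add: residue_density_def card_type_II_residue_pairs)

lemma residue_density_type_I: "residue_density 9 type_I_local = 16 / 27"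
proof -
  have "residue_pairs 9 (locally_admissible 3) = residue_pairs 9 type_II_pair \<union> residue_pairs 9 type_I_local"
    using type_II_pair_locally_admissible by (auto simp: residue_pairs_def type_I_local_def)
  moreover have "residue_pairs 9 type_II_pair \<inter> residue_pairs 9 type_I_local = {}"
    by (auto simp: residue_pairs_def type_I_local_def)
  ultimately have "card (residue_pairs 9 (locally_admissible 3)) =
      card (residue_pairs 9 type_II_pair) + card (residue_pairs 9 type_I_local)"
    by (simp add: card_Un_disjoint)
  hence "residue_density 9 (locally_admissible 3) = residue_density 9 type_II_pair + residue_density 9 type_I_local"
    by (simp add: residue_density_def add_divide_distrib)
  moreover have "residue_density 9 (locally_admissible 3) = 20 / 27"
    using residue_density_locally_admissible[of 3] by simp
  ultimately show ?thesis by (simp add: residue_density_type_II)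
qed

section \<open>Translation of the field counts into pair counts\<close>

lemma squarefree_coprime_iff_local:
  fixes a b :: nat
  assumes "a > 0" "b > 0"
  shows "coprime a b \<and> squarefree a \<and> squarefree b \<longleftrightarrow> (\<forall>p. nprime p \<longrightarrow> locally_admissible p a b)"
proof -
  have "squarefree n \<longleftrightarrow> (\<forall>p. nprime p \<longrightarrow> \<not> p ^ 2 dvd n)" if "n > 0" for n :: nat
    using that by (subst squarefree_factorial_semiring) auto
  moreover have "coprime a b \<longleftrightarrow> (\<forall>p. nprime p \<longrightarrow> \<not> (p dvd a \<and> p dvd b))"
  proof
    assume "coprime a b"
    thus "\<forall>p. nprime p \<longrightarrow> \<not> (p dvd a \<and> p dvd b)"
      using coprime_common_divisor not_prime_unit by blast
  next
    assume *: "\<forall>p. nprime p \<longrightarrow> \<not> (p dvd a \<and> p dvd b)"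
    show "coprime a b"
    proof (rule ccontr)
      assume "\<not> coprime a b"
      hence "gcd a b \<noteq> 1" by (simp add: coprime_iff_gcd_eq_1)
      then obtain p where "nprime p" "p dvd gcd a b" using prime_factor_nat by blast
      with * show False by (meson dvd_trans gcd_dvd1 gcd_dvd2)
    qed
  qed
  ultimately show ?thesis using assms unfolding locally_admissible_def by blast
qed

text \<open>\<open>R1 \<ge> 1\<close> makes \<open>b < a\<close> automatic in the cone, so the order
  required of admissible pairs reappears nowhere on the right. The local condition at 3 is split off
  to be merged with \<open>Q\<close>, which will be the type.\<close>

lemma admissible_pairs_eq_cone_pairs:
  fixes R1 R2 T :: real
  assumes R: "1 \<le> R1"
  shows "{(a, b). admissible_pair a b \<and> Q a b \<and> R1 < real a / real b \<and> real a / real b < R2 \<and> real a * real b < T ^ 2}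
    = cone_pairs R1 R2 T (sieve (\<lambda>a b. locally_admissible 3 a b \<and> Q a b) {p. nprime p \<and> p \<noteq> 3})"
proof -
  have 3: "nprime (3 :: nat)" by simp
  have "admissible_pair a b \<and> Q a b \<and> R1 < real a / real b \<and> real a / real b < R2 \<and> real a * real b < T ^ 2 \<longleftrightarrow>
    0 < b \<and> R1 * real b < real a \<and> real a < R2 * real b \<and> real a * real b < T ^ 2 \<and>
    sieve (\<lambda>a b. locally_admissible 3 a b \<and> Q a b) {p. nprime p \<and> p \<noteq> 3} a b" for a b
  proof (cases "b > 0 \<and> R1 * real b < real a")
    case True
    have "1 * real b \<le> R1 * real b" using R by (intro mult_right_mono) auto
    hence "b < a" using True by linarith
    have "admissible_pair a b \<longleftrightarrow> (\<forall>p. nprime p \<longrightarrow> locally_admissible p a b)"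
      using squarefree_coprime_iff_local[of a b] True \<open>b < a\<close> by (auto simp: admissible_pair_def)
    also have "\<dots> \<longleftrightarrow> locally_admissible 3 a b \<and> (\<forall>p. nprime p \<and> p \<noteq> 3 \<longrightarrow> locally_admissible p a b)"
      using 3 by blast
    finally show ?thesis using True by (auto simp: sieve_def less_divide_eq divide_less_eq)
  qed (auto simp: admissible_pair_def less_divide_eq)
  thus ?thesis unfolding cone_pairs_def by auto
qed

text \<open>The scale \<open>T\<close> for which \<open>c (a b)\<^sup>2 < x\<close> means \<open>a b < T\<^sup>2\<close>.\<close>

definition discriminant_radius :: "real \<Rightarrow> real \<Rightarrow> real" where
  "discriminant_radius c x = sqrt (sqrt (x / c))"

lemma discriminant_radius_iff:
  assumes "c > 0" "x > 0"
  shows "c * (real a * real b) ^ 2 < x \<longleftrightarrow> real a * real b < discriminant_radius c x ^ 2"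
proof -
  have "c * (real a * real b) ^ 2 < x \<longleftrightarrow> (real a * real b) ^ 2 < x / c"
    using assms(1) by (simp add: pos_less_divide_eq mult.commute)
  also have "\<dots> \<longleftrightarrow> sqrt ((real a * real b) ^ 2) < sqrt (x / c)" by (rule real_sqrt_less_iff[symmetric])
  also have "\<dots> \<longleftrightarrow> real a * real b < sqrt (x / c)" by simp
  finally show ?thesis using assms by (simp add: discriminant_radius_def)
qed

lemma in_fields_in_range_iff:
  "K \<in> fields_in_range x R1 R2 \<longleftrightarrow> subfield K CC \<and> (\<exists>a b. cubic_params K a b \<and>
     (if type_II_pair a b then 3 else 27) * (real a * real b) ^ 2 < x \<and>
     R1 < real a / real b \<and> real a / real b < R2)"
proof -
  have "abs (real_of_rat (discriminant K)) = (if type_II_pair a b then 3 else 27) * (real a * real b) ^ 2"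
    "real_of_rat (ratio K) = real a / real b"
    if "subfield K CC" "cubic_params K a b" for a b
    using that by (simp_all add: discriminant_eq ratio_eq of_rat_minus of_rat_mult of_rat_power of_rat_divide abs_mult power_mult_distrib)
  thus ?thesis unfolding fields_in_range_def mem_Collect_eq pure_cubic_field_iff by metis
qed

text \<open>Once the type \<open>t\<close> is fixed, the factor 3 or 27 in the discriminant is a
  constant, and the bound on the discriminant becomes a bound on \<open>a * b\<close>.\<close>

lemma in_fields_in_range_type_iff:
  assumes "x > 0"
  shows "K \<in> fields_in_range x R1 R2 \<and> (type_II K \<longleftrightarrow> t) \<longleftrightarrow> subfield K CC \<and> (\<exists>a b. cubic_params K a b \<and>
    ((type_II_pair a b \<longleftrightarrow> t) \<and> R1 < real a / real b \<and> real a / real b < R2 \<and>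
     real a * real b < discriminant_radius (if t then 3 else 27) x ^ 2))" (is "?l \<longleftrightarrow> ?r")
proof
  assume l: ?l
  then obtain a b where ab: "subfield K CC" "cubic_params K a b"
    "(if type_II_pair a b then 3 else 27) * (real a * real b) ^ 2 < x" "R1 < real a / real b" "real a / real b < R2"
    unfolding in_fields_in_range_iff by blast
  moreover have "type_II_pair a b \<longleftrightarrow> t" using l type_II_iff[OF ab(1,2)] by blast
  moreover have "real a * real b < discriminant_radius (if t then 3 else 27) x ^ 2"
    using ab(3) \<open>type_II_pair a b \<longleftrightarrow> t\<close> by (subst discriminant_radius_iff[symmetric]) (use assms in auto)
  ultimately show ?r by blast
next
  assume r: ?r
  then obtain a b where ab: "subfield K CC" "cubic_params K a b" "type_II_pair a b \<longleftrightarrow> t"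
    "R1 < real a / real b" "real a / real b < R2"
    "real a * real b < discriminant_radius (if t then 3 else 27) x ^ 2" by blast
  moreover have "(if type_II_pair a b then 3 else 27) * (real a * real b) ^ 2 < x"
    using ab(6) unfolding ab(3) by (subst discriminant_radius_iff) (use assms in auto)
  moreover have "type_II K \<longleftrightarrow> t" using type_II_iff[OF ab(1,2)] ab(3) by blast
  ultimately show ?l unfolding in_fields_in_range_iff by blast
qed

lemma N_II_eq:
  assumes "1 \<le> R1" "x > 0"
  shows "N_II x R1 R2 = card (cone_pairs R1 R2 (discriminant_radius 3 x) (sieve type_II_pair {p. nprime p \<and> p \<noteq> 3}))"
proof -
  have "K \<in> {K \<in> fields_in_range x R1 R2. type_II K} \<longleftrightarrow> subfield K CC \<and> (\<exists>a b. cubic_params K a b \<and>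
      (type_II_pair a b \<and> R1 < real a / real b \<and> real a / real b < R2 \<and> real a * real b < discriminant_radius 3 x ^ 2))" for K
    using in_fields_in_range_type_iff[OF assms(2), of K R1 R2 True] by simp
  hence "N_II x R1 R2 = card {(a, b). admissible_pair a b \<and> (type_II_pair a b \<and> R1 < real a / real b \<and>
      real a / real b < R2 \<and> real a * real b < discriminant_radius 3 x ^ 2)}"
    unfolding N_II_def by (rule card_quotient_pure_cubic_iso)
  also have "\<dots> = card (cone_pairs R1 R2 (discriminant_radius 3 x)
      (sieve (\<lambda>a b. locally_admissible 3 a b \<and> type_II_pair a b) {p. nprime p \<and> p \<noteq> 3}))"
    using admissible_pairs_eq_cone_pairs[OF assms(1)] by simp
  also have "(\<lambda>a b. locally_admissible 3 a b \<and> type_II_pair a b) = type_II_pair"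
    using type_II_pair_locally_admissible by (auto simp: fun_eq_iff)
  finally show ?thesis .
qed

lemma N_I_eq:
  assumes "1 \<le> R1" "x > 0"
  shows "N_I x R1 R2 = card (cone_pairs R1 R2 (discriminant_radius 27 x) (sieve type_I_local {p. nprime p \<and> p \<noteq> 3}))"
proof -
  have "K \<in> {K \<in> fields_in_range x R1 R2. type_I K} \<longleftrightarrow> subfield K CC \<and> (\<exists>a b. cubic_params K a b \<and>
      (\<not> type_II_pair a b \<and> R1 < real a / real b \<and> real a / real b < R2 \<and> real a * real b < discriminant_radius 27 x ^ 2))" for K
    using in_fields_in_range_type_iff[OF assms(2), of K R1 R2 False] by (simp add: type_I_def)
  hence "N_I x R1 R2 = card {(a, b). admissible_pair a b \<and> (\<not> type_II_pair a b \<and> R1 < real a / real b \<and>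
      real a / real b < R2 \<and> real a * real b < discriminant_radius 27 x ^ 2)}"
    unfolding N_I_def by (rule card_quotient_pure_cubic_iso)
  also have "\<dots> = card (cone_pairs R1 R2 (discriminant_radius 27 x)
      (sieve (\<lambda>a b. locally_admissible 3 a b \<and> \<not> type_II_pair a b) {p. nprime p \<and> p \<noteq> 3}))"
    using admissible_pairs_eq_cone_pairs[OF assms(1), of "\<lambda>a b. \<not> type_II_pair a b"] by simp
  also have "(\<lambda>a b. locally_admissible 3 a b \<and> \<not> type_II_pair a b) = type_I_local"
    by (auto simp: fun_eq_iff type_I_local_def)
  finally show ?thesis .
qed

lemma cone_pairs_smallo:
  fixes R1 R2 c :: real
  assumes R: "1 \<le> R1" "R1 < R2" and E: "periodic 9 E" and c: "c > 0"
    and N: "\<And>x. x > 0 \<Longrightarrow> N x = card (cone_pairs R1 R2 (discriminant_radius c x) (sieve E {p. nprime p \<and> p \<noteq> 3}))"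
  shows "(\<lambda>x::real. real (N x) - residue_density 9 E * (C_const * (27 / 20)) * (ln (R2 / R1) / 2) / sqrt c * sqrt x)
    \<in> o[at_top](\<lambda>x. sqrt x)"
proof (rule smalloI_tendsto)
  let ?L = "residue_density 9 E * (C_const * (27 / 20)) * (ln (R2 / R1) / 2)"
  let ?g = "\<lambda>T. card (cone_pairs R1 R2 T (sieve E {p. nprime p \<and> p \<noteq> 3})) / T ^ 2"
  have "filterlim (discriminant_radius c) at_top at_top"
    unfolding discriminant_radius_def using c by real_asymp
  hence "((\<lambda>x. ?g (discriminant_radius c x)) \<longlongrightarrow> ?L) at_top"
    using cone_pairs_sieve_asymptotics[OF R E] unfolding C_const_def by (rule filterlim_compose[rotated])
  hence "((\<lambda>x. ?g (discriminant_radius c x) / sqrt c - ?L / sqrt c) \<longlongrightarrow> ?L / sqrt c - ?L / sqrt c) at_top"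
    by (intro tendsto_intros) (use c in auto)
  hence "((\<lambda>x. ?g (discriminant_radius c x) / sqrt c - ?L / sqrt c) \<longlongrightarrow> 0) at_top" by simp
  thus "((\<lambda>x. (real (N x) - ?L / sqrt c * sqrt x) / sqrt x) \<longlongrightarrow> 0) at_top"
  proof (rule Lim_transform_eventually)
    show "eventually (\<lambda>x. ?g (discriminant_radius c x) / sqrt c - ?L / sqrt c = (real (N x) - ?L / sqrt c * sqrt x) / sqrt x) at_top"
      using eventually_gt_at_top[of 0]
    proof eventually_elim
      case (elim x)
      \<comment> \<open>Passing from \<open>T^2\<close> to \<open>sqrt x\<close> is what brings
        \<open>1 / sqrt c\<close> into the constant.\<close>
      have "discriminant_radius c x ^ 2 = sqrt x / sqrt c"
        using elim c by (simp add: discriminant_radius_def real_sqrt_divide power_divide)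
      hence "?g (discriminant_radius c x) / sqrt c = real (N x) / sqrt x"
        using N[OF elim] elim c by simp
      thus ?case using elim by (simp add: diff_divide_distrib)
    qed
  qed
  show "eventually (\<lambda>x. sqrt x \<noteq> 0) at_top"
    using eventually_gt_at_top[of "0::real"] by eventually_elim simp
qed

theorem theorem3p2:
  fixes R1 R2 :: real
  assumes "1 \<le> R1" and "1 \<le> R2" and "R1 < R2"
  shows "(\<lambda>x::real. real (N_I x R1 R2) - 2 * C_const / (15 * sqrt 3) * sqrt x * ln (R2 / R1))
           \<in> o[at_top](\<lambda>x. sqrt x) \<and>
         (\<lambda>x::real. real (N_II x R1 R2) - C_const / (10 * sqrt 3) * sqrt x * ln (R2 / R1))
           \<in> o[at_top](\<lambda>x. sqrt x) \<and>
         (\<lambda>x::real. real (N_total x R1 R2) - 7 * C_const / (30 * sqrt 3) * sqrt x * ln (R2 / R1))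
           \<in> o[at_top](\<lambda>x. sqrt x)"
proof -
  have "sqrt (9 * 3) = sqrt 9 * sqrt 3" by (rule real_sqrt_mult)
  moreover have "sqrt 9 = sqrt (3 ^ 2)" by simp
  ultimately have s: "sqrt 27 = 3 * sqrt 3" by (simp only: real_sqrt_abs) simp
  \<comment> \<open>The constant is the density 16/27 at 3, times 27/20 for the Euler factor removed
    there, times 1/2 from the area, divided by \<open>sqrt 27 = 3 * sqrt 3\<close> from the
    discriminant.\<close>
  have "residue_density 9 type_I_local * (C_const * (27 / 20)) * (ln (R2 / R1) / 2) / sqrt 27 * sqrt x
      = 2 * C_const / (15 * sqrt 3) * sqrt x * ln (R2 / R1)" for x
    unfolding s residue_density_type_I by (simp add: field_simps)
  hence I: "(\<lambda>x::real. real (N_I x R1 R2) - 2 * C_const / (15 * sqrt 3) * sqrt x * ln (R2 / R1))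
           \<in> o[at_top](\<lambda>x. sqrt x)"
    using cone_pairs_smallo[OF assms(1,3) periodic_type_I_local _ N_I_eq[OF assms(1)]] by simp
  \<comment> \<open>Here the density at 3 is 4/27 and the discriminant contributes
    \<open>sqrt 3\<close>.\<close>
  have "residue_density 9 type_II_pair * (C_const * (27 / 20)) * (ln (R2 / R1) / 2) / sqrt 3 * sqrt x
      = C_const / (10 * sqrt 3) * sqrt x * ln (R2 / R1)" for x
    unfolding residue_density_type_II by (simp add: field_simps)
  hence II: "(\<lambda>x::real. real (N_II x R1 R2) - C_const / (10 * sqrt 3) * sqrt x * ln (R2 / R1))
           \<in> o[at_top](\<lambda>x. sqrt x)"
    using cone_pairs_smallo[OF assms(1,3) periodic_type_II_pair _ N_II_eq[OF assms(1)]] by simp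
  have "(\<lambda>x::real. real (N_total x R1 R2) - 7 * C_const / (30 * sqrt 3) * sqrt x * ln (R2 / R1))
    = (\<lambda>x. (real (N_I x R1 R2) - 2 * C_const / (15 * sqrt 3) * sqrt x * ln (R2 / R1))
       + (real (N_II x R1 R2) - C_const / (10 * sqrt 3) * sqrt x * ln (R2 / R1)))"
    by (simp add: fun_eq_iff N_total_def field_simps)
  with I II sum_in_smallo(1)[OF I II] show ?thesis by simp
qed

end
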